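(* Let $X$ be a smooth manifold of dimension $n$, $\mathcal{L}\subset T^\ast X$ a connected Lagrangian submanifold and $\nu_0\in\mathcal{L}$ a base point. For a path $\sigma$ in the fibre $\mathbb{L}(\mathcal{L})_{\nu_0}$ from $\lambda(\nu_0)$ to $\lambda_0(\nu_0)$ put $$\mu(\gamma)=\mu_0\Big(\lambda_\ast\gamma\ast{\lambda_0^\sigma}_\ast(\gamma^{-1})\Big),\qquad \gamma\in\pi_1(\mathcal{L},\nu_0).$$ Then $\mu$ does not depend on the path $\sigma$ chosen to join $\lambda(\nu_0)$ to $\lambda_0(\nu_0)$ in the fibre. Moreover $\mu$ is a group homomorphism $\pi_1(\mathcal{L},\nu_0)\to\mathbb{Z}$, that is, $\mu\in H^1(\mathcal{L},\mathbb{Z})$.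
   Context: $\mathbb{L}(n)$ is the Grassmannian of Lagrangian subspaces of $T^\ast\mathbb{R}^n$ with $\omega=\sum_j d\xi_j\wedge dx_j$; identifying $T^\ast\mathbb{R}^n$ with $\mathbb{C}^n$ by $z=x+i\xi$ one has $\mathbb{L}(n)=U(n)/O(n)$, and $Det^2:\mathbb{L}(n)\to\mathbb{S}^1$, $u\mathbb{R}^n\mapsto\det(u)^2$, is well defined. For a loop $\gamma$ in $\mathbb{L}(n)$, $\mu_0(\gamma)=\mathrm{Degree}(Det^2\circ\gamma)$; $\mu_0$ is an isomorphism $\pi_1(\mathbb{L}(n))\to\mathbb{Z}$. The Lagrangian Grassmannian of any $2n$-dimensional symplectic vector space is identified with $\mathbb{L}(n)$ by a linear symplectic isomorphism; $\mu_0$ of a loop (or free homotopy class) does not depend on this choice. $T^\ast X$ (projection $\pi_0:T^\ast X\to X$) carries its canonical symplectic form $\omega=d\xi\wedge dx$. $\pi:\mathbb{L}(\mathcal{L})\to\mathcal{L}$ is the fibre bundle whose fibre over $\nu\in\mathcal{L}$ is the Grassmannian of Lagrangian subspaces of $T_\nu(T^\ast X)$, so its fibre is $\mathbb{L}(n)$, with inclusion $i$ of the fibre. It has two sections: $\lambda(\nu)=T_\nu\mathcal{L}$ and $\lambda_0(\nu)=\ker d\pi_0(\nu)$ (the vertical subspace, tangent to $T^\ast_{\pi_0(\nu)}X$). Because of these sections there is a split exact sequence $0\to\pi_1(\mathbb{L}(n))\xrightarrow{i_\ast}\pi_1(\mathbb{L}(\mathcal{L}))\xrightarrow{\pi_\ast}\pi_1(\mathcal{L})\to0$.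 Paths are composed from left to right: $a\ast b$ is $a$ followed by $b$. ${\lambda_0^\sigma}_\ast(\gamma)$ is the class of the loop $\sigma\ast(\lambda_0\circ\gamma)\ast\sigma^{-1}$ based at $\lambda(\nu_0)$. The class $\lambda_\ast\gamma\ast{\lambda_0^\sigma}_\ast(\gamma^{-1})$ is in $\ker\pi_\ast$, hence is regarded as an element of $\pi_1(\mathbb{L}(n))$, to which $\mu_0$ is applied. *)

theory Defs
  imports
    "HOL-Complex_Analysis.Winding_Numbers"
    "HOL-Algebra.Elementary_Groups"
begin

section \<open>The fundamental group of an abstract topology\<close>

text \<open>The library operations on paths require a type of class topological space, whereas the
  spaces below are abstract topologies.\<close>

definition join_path :: "(real \<Rightarrow> 'a) \<Rightarrow> (real \<Rightarrow> 'a) \<Rightarrow> real \<Rightarrow> 'a" where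
  "join_path p q = (\<lambda>t. if t \<le> 1/2 then p (2 * t) else q (2 * t - 1))"

definition reverse_path :: "(real \<Rightarrow> 'a) \<Rightarrow> real \<Rightarrow> 'a" where
  "reverse_path p = (\<lambda>t. p (1 - t))"

definition path_class :: "'a topology \<Rightarrow> (real \<Rightarrow> 'a) \<Rightarrow> (real \<Rightarrow> 'a) set" where
  "path_class X p =
     {q. homotopic_with (\<lambda>r. r 0 = p 0 \<and> r 1 = p 1) (top_of_set {0..1}) X p q}"

definition loops_at :: "'a topology \<Rightarrow> 'a \<Rightarrow> (real \<Rightarrow> 'a) set" where
  "loops_at X a = {p. pathin X p \<and> p 0 = a \<and> p 1 = a}"

definition fundamental_group :: "'a topology \<Rightarrow> 'a \<Rightarrow> (real \<Rightarrow> 'a) set monoid" where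
  "fundamental_group X a =
     \<lparr>carrier = path_class X ` loops_at X a,
      monoid.mult = (\<lambda>C D. \<Union>p\<in>C. \<Union>q\<in>D. path_class X (join_path p q)),
      one = path_class X (\<lambda>_. a)\<rparr>"

text \<open>The map on homotopy classes, with values in classes of paths in \<open>Y\<close>, that is induced by
  an operation \<open>F\<close> on paths.\<close>

definition class_map ::
    "'b topology \<Rightarrow> ((real \<Rightarrow> 'a) \<Rightarrow> real \<Rightarrow> 'b) \<Rightarrow> (real \<Rightarrow> 'a) set \<Rightarrow> (real \<Rightarrow> 'b) set" where
  "class_map Y F C = (\<Union>p\<in>C. path_class Y (F p))"

definition pi1_map :: "'b topology \<Rightarrow> ('a \<Rightarrow> 'b) \<Rightarrow> (real \<Rightarrow> 'a) set \<Rightarrow> (real \<Rightarrow> 'b) set" where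
  "pi1_map Y f = class_map Y (\<lambda>p. f \<circ> p)"


section \<open>Smooth manifolds\<close>

primrec Ck_on :: "nat \<Rightarrow> 'a::euclidean_space set \<Rightarrow> ('a \<Rightarrow> 'b::euclidean_space) \<Rightarrow> bool" where
  "Ck_on 0 S f \<longleftrightarrow> continuous_on S f"
| "Ck_on (Suc k) S f \<longleftrightarrow>
     (\<forall>x\<in>S. f differentiable (at x)) \<and> (\<forall>v. Ck_on k S (\<lambda>x. frechet_derivative f (at x) v))"

text \<open>Only used for open \<open>S\<close>.\<close>

definition smooth_on :: "'a::euclidean_space set \<Rightarrow> ('a \<Rightarrow> 'b::euclidean_space) \<Rightarrow> bool" where
  "smooth_on S f \<longleftrightarrow> (\<forall>k. Ck_on k S f)"

type_synonym ('a, 'e) chart = "'a set \<times> ('a \<Rightarrow> 'e)"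

definition transition :: "('a, 'e) chart \<Rightarrow> ('a, 'e) chart \<Rightarrow> 'e \<Rightarrow> 'e" where
  "transition c d = snd d \<circ> inv_into (fst c) (snd c)"

definition is_chart :: "'a topology \<Rightarrow> ('a, 'e::euclidean_space) chart \<Rightarrow> bool" where
  "is_chart X c \<longleftrightarrow> openin X (fst c) \<and> open (snd c ` fst c) \<and>
     homeomorphic_map (subtopology X (fst c)) (top_of_set (snd c ` fst c)) (snd c)"

definition smoothly_compatible ::
    "('a, 'e::euclidean_space) chart \<Rightarrow> ('a, 'e) chart \<Rightarrow> bool" where
  "smoothly_compatible c d \<longleftrightarrow>
     smooth_on (snd c ` (fst c \<inter> fst d)) (transition c d) \<and>
     smooth_on (snd d ` (fst c \<inter> fst d)) (transition d c)"

definition smooth_atlas :: "'a topology \<Rightarrow> ('a, 'e::euclidean_space) chart set \<Rightarrow> bool" where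
  "smooth_atlas X A \<longleftrightarrow> (\<forall>c\<in>A. is_chart X c) \<and> \<Union>(fst ` A) = topspace X \<and>
     (\<forall>c\<in>A. \<forall>d\<in>A. smoothly_compatible c d)"

definition smooth_manifold :: "'a topology \<Rightarrow> ('a, 'e::euclidean_space) chart set \<Rightarrow> bool" where
  "smooth_manifold X A \<longleftrightarrow> Hausdorff_space X \<and> second_countable X \<and> smooth_atlas X A"

text \<open>For a smooth atlas of \<open>X\<close> this is \<open>X\<close> itself; it serves to topologise the cotangent bundle.\<close>

definition atlas_topology :: "('a, 'e::euclidean_space) chart set \<Rightarrow> 'a topology" where
  "atlas_topology A = topology_generated_by {{p\<in>fst c. snd c p \<in> S} | c S. c \<in> A \<and> open S}"

text \<open>A tangent vector is given by its coordinates in all charts of the atlas around the base point,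
  related by the derivatives of the transition maps (and set to 0 for the other charts).\<close>

type_synonym ('a, 'e) tangent = "('a, 'e) chart \<Rightarrow> 'e"

definition tangent_space ::
    "('a, 'e::euclidean_space) chart set \<Rightarrow> 'a \<Rightarrow> ('a, 'e) tangent set" where
  "tangent_space A p =
     {v. (\<forall>c. \<not> (c \<in> A \<and> p \<in> fst c) \<longrightarrow> v c = 0) \<and>
         (\<forall>c\<in>A. \<forall>d\<in>A. p \<in> fst c \<and> p \<in> fst d \<longrightarrow>
            v d = frechet_derivative (transition c d) (at (snd c p)) (v c))}"

text \<open>The tangent vector at \<open>p\<close> with coordinates \<open>a\<close> in the chart \<open>c\<close>.\<close>

definition coordinate_tangent ::
    "('a, 'e::euclidean_space) chart set \<Rightarrow> 'a \<Rightarrow> ('a, 'e) chart \<Rightarrow> 'e \<Rightarrow> ('a, 'e) tangent" where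
  "coordinate_tangent A p c a =
     (\<lambda>d. if d \<in> A \<and> p \<in> fst d then frechet_derivative (transition c d) (at (snd c p)) a else 0)"

definition differential ::
    "('a, 'e::euclidean_space) chart set \<Rightarrow> ('b, 'f::euclidean_space) chart set \<Rightarrow> ('a \<Rightarrow> 'b) \<Rightarrow> 'a \<Rightarrow>
     ('a, 'e) tangent \<Rightarrow> ('b, 'f) tangent" where
  "differential A B f p v =
     (let c = (SOME c. c \<in> A \<and> p \<in> fst c) in
      (\<lambda>d. if d \<in> B \<and> f p \<in> fst d
           then frechet_derivative (snd d \<circ> f \<circ> inv_into (fst c) (snd c)) (at (snd c p)) (v c)
           else 0))"

definition embedded_submanifold ::
    "'a topology \<Rightarrow> ('a, 'e::euclidean_space) chart set \<Rightarrow> 'a set \<Rightarrow> nat \<Rightarrow> bool" where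
  "embedded_submanifold X A L k \<longleftrightarrow> L \<subseteq> topspace X \<and>
     (\<forall>p\<in>L. \<exists>c K. is_chart X c \<and> (\<forall>d\<in>A. smoothly_compatible c d) \<and> p \<in> fst c \<and>
        subspace K \<and> dim K = k \<and> snd c ` (L \<inter> fst c) = snd c ` fst c \<inter> K)"

text \<open>Velocities at \<open>p\<close> of the smooth curves lying in \<open>L\<close>.\<close>

definition submanifold_tangent ::
    "('a, 'e::euclidean_space) chart set \<Rightarrow> 'a set \<Rightarrow> 'a \<Rightarrow> ('a, 'e) tangent set" where
  "submanifold_tangent A L p =
     {v \<in> tangent_space A p. \<exists>g :: real \<Rightarrow> 'a. range g \<subseteq> L \<and> g 0 = p \<and>
        (\<forall>c\<in>A. p \<in> fst c \<longrightarrow>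
           (\<exists>e>0. g ` {-e<..<e} \<subseteq> fst c \<and> smooth_on {-e<..<e} (snd c \<circ> g)) \<and>
           ((snd c \<circ> g) has_vector_derivative v c) (at 0))}"


section \<open>Lagrangian subspaces and the Maslov index of a loop\<close>

definition lagrangian_subspaces :: "'v set \<Rightarrow> ('v \<Rightarrow> 'v \<Rightarrow> real) \<Rightarrow> 'v set set" where
  "lagrangian_subspaces V om = {W. W \<subseteq> V \<and> W = {v\<in>V. \<forall>w\<in>W. om v w = 0}}"

text \<open>Points of \<open>T\<^sup>*\<real>\<^sup>n\<close> are pairs \<open>(x, \<xi>)\<close>; the form is \<open>\<Sum>\<^sub>j d\<xi>\<^sub>j \<and> dx\<^sub>j\<close>.\<close>

type_synonym 'n phase = "(real ^ 'n) \<times> (real ^ 'n)"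

definition std_form :: "'n::finite phase \<Rightarrow> 'n phase \<Rightarrow> real" where
  "std_form v w = snd v \<bullet> fst w - fst v \<bullet> snd w"

definition complex_of_phase :: "'n::finite phase \<Rightarrow> complex ^ 'n" where
  "complex_of_phase v = (\<chi> j. Complex (fst v $ j) (snd v $ j))"

definition unitary_matrices :: "(complex ^ 'n::finite ^ 'n) set" where
  "unitary_matrices = {u. transpose (map_matrix cnj u) ** u = mat 1}"

text \<open>The subspace \<open>u\<real>\<^sup>n\<close>, seen in \<open>T\<^sup>*\<real>\<^sup>n\<close>.\<close>

definition unitary_image :: "complex ^ 'n::finite ^ 'n \<Rightarrow> 'n phase set" where
  "unitary_image u = {v. \<exists>x :: real ^ 'n. complex_of_phase v = u *v (\<chi> j. complex_of_real (x $ j))}"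

abbreviation Lag :: "'n::finite phase set set" where
  "Lag \<equiv> lagrangian_subspaces UNIV std_form"

text \<open>The topology of \<open>U(n)/O(n)\<close>.\<close>

definition Lag_topology :: "'n::finite phase set topology" where
  "Lag_topology = topology (\<lambda>S. S \<subseteq> Lag \<and>
     openin (top_of_set unitary_matrices) {u \<in> unitary_matrices. unitary_image u \<in> S})"

lemma openin_Lag_topology:
  "openin Lag_topology S \<longleftrightarrow> S \<subseteq> (Lag :: 'n::finite phase set set) \<and>
     openin (top_of_set unitary_matrices) {u \<in> unitary_matrices. unitary_image u \<in> S}"
proof -
  let ?U = "unitary_matrices :: (complex ^ 'n ^ 'n) set"
  let ?P = "\<lambda>S. {u \<in> ?U. unitary_image u \<in> S}"
  have "istopology (\<lambda>S. S \<subseteq> Lag \<and> openin (top_of_set ?U) (?P S))"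
    unfolding istopology_def
  proof (intro conjI allI impI)
    fix S T assume "S \<subseteq> Lag \<and> openin (top_of_set ?U) (?P S)" "T \<subseteq> Lag \<and> openin (top_of_set ?U) (?P T)"
    moreover have "?P (S \<inter> T) = ?P S \<inter> ?P T" by auto
    ultimately show "S \<inter> T \<subseteq> Lag" "openin (top_of_set ?U) (?P (S \<inter> T))"
      by (auto intro: openin_Int)
  next
    fix K assume *: "\<forall>S\<in>K. S \<subseteq> Lag \<and> openin (top_of_set ?U) (?P S)"
    have "?P (\<Union>K) = \<Union>(?P ` K)" by auto
    moreover have "openin (top_of_set ?U) (\<Union>(?P ` K))"
      using * by (intro openin_Union) blast
    ultimately show "openin (top_of_set ?U) (?P (\<Union>K))" by (simp only:)
    show "\<Union>K \<subseteq> Lag" using * by blast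
  qed
  then show ?thesis
    unfolding Lag_topology_def by (simp add: topology_inverse')
qed

definition Det2 :: "'n::finite phase set \<Rightarrow> complex" where
  "Det2 W = (THE z. \<exists>u\<in>unitary_matrices. unitary_image u = W \<and> z = (det u)\<^sup>2)"

text \<open>The degree of a loop \<open>[0,1] \<rightarrow> \<S>\<^sup>1\<close>.\<close>

definition circle_degree :: "(real \<Rightarrow> complex) \<Rightarrow> int" where
  "circle_degree f = (THE k. winding_number f 0 = of_int k)"

definition mu0_std :: "(real \<Rightarrow> 'n::finite phase set) \<Rightarrow> int" where
  "mu0_std \<alpha> = circle_degree (Det2 \<circ> \<alpha>)"


section \<open>The cotangent bundle\<close>

type_synonym ('a, 'n) covector = "('a, real ^ 'n) tangent \<Rightarrow> real"
type_synonym ('a, 'n) cotangent_point = "'a \<times> ('a, 'n) covector"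
type_synonym ('a, 'n) cotangent_tangent = "(('a, 'n) cotangent_point, 'n phase) tangent"

definition cotangent_space ::
    "('a, real ^ 'n::finite) chart set \<Rightarrow> 'a \<Rightarrow> ('a, 'n) covector set" where
  "cotangent_space A x =
     {\<xi>. (\<forall>v\<in>tangent_space A x. \<forall>w\<in>tangent_space A x. \<xi> (\<lambda>c. v c + w c) = \<xi> v + \<xi> w) \<and>
         (\<forall>v\<in>tangent_space A x. \<forall>r. \<xi> (\<lambda>c. r *\<^sub>R v c) = r * \<xi> v) \<and>
         (\<forall>v. v \<notin> tangent_space A x \<longrightarrow> \<xi> v = 0)}"

definition cotangent_bundle ::
    "('a, real ^ 'n::finite) chart set \<Rightarrow> ('a, 'n) cotangent_point set" where
  "cotangent_bundle A = {(x, \<xi>). x \<in> \<Union>(fst ` A) \<and> \<xi> \<in> cotangent_space A x}"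

text \<open>The canonical coordinates \<open>(x, \<xi>)\<close>, with \<open>\<xi>\<^sub>j = \<xi>(\<partial>/\<partial>x\<^sub>j)\<close>, defined by a chart of the base.\<close>

definition cotangent_chart ::
    "('a, real ^ 'n::finite) chart set \<Rightarrow> ('a, real ^ 'n) chart \<Rightarrow>
     (('a, 'n) cotangent_point, 'n phase) chart" where
  "cotangent_chart A c =
     ({\<nu> \<in> cotangent_bundle A. fst \<nu> \<in> fst c},
      \<lambda>\<nu>. (snd c (fst \<nu>), \<chi> j. snd \<nu> (coordinate_tangent A (fst \<nu>) c (axis j 1))))"

definition cotangent_atlas ::
    "('a, real ^ 'n::finite) chart set \<Rightarrow> (('a, 'n) cotangent_point, 'n phase) chart set" where
  "cotangent_atlas A = cotangent_chart A ` A"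

definition cotangent_topology ::
    "('a, real ^ 'n::finite) chart set \<Rightarrow> ('a, 'n) cotangent_point topology" where
  "cotangent_topology A = atlas_topology (cotangent_atlas A)"

text \<open>The form \<open>d\<xi> \<and> dx\<close> on the tangent space at \<open>\<nu>\<close>: its expression is the same in all
  canonical coordinates.\<close>

definition canonical_form ::
    "('a, real ^ 'n::finite) chart set \<Rightarrow> ('a, 'n) cotangent_point \<Rightarrow>
     ('a, 'n) cotangent_tangent \<Rightarrow> ('a, 'n) cotangent_tangent \<Rightarrow> real" where
  "canonical_form A \<nu> v w =
     (THE r. \<forall>c\<in>A. fst \<nu> \<in> fst c \<longrightarrow>
        r = std_form (v (cotangent_chart A c)) (w (cotangent_chart A c)))"

definition lagrangian_submanifold ::
    "('a, real ^ 'n::finite) chart set \<Rightarrow> ('a, 'n) cotangent_point set \<Rightarrow> bool" where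
  "lagrangian_submanifold A L \<longleftrightarrow>
     embedded_submanifold (cotangent_topology A) (cotangent_atlas A) L (CARD('n)) \<and>
     (\<forall>\<nu>\<in>L. \<forall>v\<in>submanifold_tangent (cotangent_atlas A) L \<nu>.
              \<forall>w\<in>submanifold_tangent (cotangent_atlas A) L \<nu>. canonical_form A \<nu> v w = 0)"


section \<open>The bundle of Lagrangian Grassmannians over a Lagrangian submanifold\<close>

type_synonym ('a, 'n) lag_point =
  "('a, 'n) cotangent_point \<times> ('a, 'n) cotangent_tangent set"

definition lagrangians_at ::
    "('a, real ^ 'n::finite) chart set \<Rightarrow> ('a, 'n) cotangent_point \<Rightarrow>
     ('a, 'n) cotangent_tangent set set" where
  "lagrangians_at A \<nu> =
     lagrangian_subspaces (tangent_space (cotangent_atlas A) \<nu>) (canonical_form A \<nu>)"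

definition lag_bundle ::
    "('a, real ^ 'n::finite) chart set \<Rightarrow> ('a, 'n) cotangent_point set \<Rightarrow>
     ('a, 'n) lag_point set" where
  "lag_bundle A L = {(\<nu>, W). \<nu> \<in> L \<and> W \<in> lagrangians_at A \<nu>}"

text \<open>The topology for which \<open>(\<nu>, W) \<mapsto> (\<nu>, coordinates of W)\<close> is a local trivialisation over the
  domain of each canonical chart.\<close>

definition lag_bundle_topology ::
    "('a, real ^ 'n::finite) chart set \<Rightarrow> ('a, 'n) cotangent_point set \<Rightarrow>
     ('a, 'n) lag_point topology" where
  "lag_bundle_topology A L = topology_generated_by
     {{(\<nu>, W) \<in> lag_bundle A L. fst \<nu> \<in> fst c \<and> \<nu> \<in> S \<and> (\<lambda>w. w (cotangent_chart A c)) ` W \<in> T}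
      | c S T. c \<in> A \<and> openin (subtopology (cotangent_topology A) L) S \<and> openin Lag_topology T}"

definition lag_fibre_topology ::
    "('a, real ^ 'n::finite) chart set \<Rightarrow> ('a, 'n) cotangent_point set \<Rightarrow>
     ('a, 'n) cotangent_point \<Rightarrow> ('a, 'n) lag_point topology" where
  "lag_fibre_topology A L \<nu> = subtopology (lag_bundle_topology A L) {p. fst p = \<nu>}"

definition tangent_section ::
    "('a, real ^ 'n::finite) chart set \<Rightarrow> ('a, 'n) cotangent_point set \<Rightarrow>
     ('a, 'n) cotangent_point \<Rightarrow> ('a, 'n) lag_point" where
  "tangent_section A L \<nu> = (\<nu>, submanifold_tangent (cotangent_atlas A) L \<nu>)"

definition vertical_section ::
    "('a, real ^ 'n::finite) chart set \<Rightarrow> ('a, 'n) cotangent_point \<Rightarrow> ('a, 'n) lag_point" where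
  "vertical_section A \<nu> =
     (\<nu>, {v \<in> tangent_space (cotangent_atlas A) \<nu>.
            differential (cotangent_atlas A) A fst \<nu> v = (\<lambda>_. 0)})"

definition symplectic_iso_at ::
    "('a, real ^ 'n::finite) chart set \<Rightarrow> ('a, 'n) cotangent_point \<Rightarrow>
     (('a, 'n) cotangent_tangent \<Rightarrow> 'n phase) \<Rightarrow> bool" where
  "symplectic_iso_at A \<nu> T \<longleftrightarrow>
     (let V = tangent_space (cotangent_atlas A) \<nu> in
      bij_betw T V UNIV \<and>
      (\<forall>v\<in>V. \<forall>w\<in>V. T (\<lambda>c. v c + w c) = T v + T w) \<and>
      (\<forall>v\<in>V. \<forall>r. T (\<lambda>c. r *\<^sub>R v c) = r *\<^sub>R T v) \<and>
      (\<forall>v\<in>V. \<forall>w\<in>V. std_form (T v) (T w) = canonical_form A \<nu> v w))"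

text \<open>\<open>\<mu>\<^sub>0\<close> of a loop in the fibre over \<open>\<nu>\<close>, through an arbitrary identification of the fibre
  with \<open>\<L>(n)\<close>.\<close>

definition mu0 ::
    "('a, real ^ 'n::finite) chart set \<Rightarrow> ('a, 'n) cotangent_point \<Rightarrow>
     (real \<Rightarrow> ('a, 'n) lag_point) \<Rightarrow> int" where
  "mu0 A \<nu> \<alpha> =
     (let T = (SOME T. symplectic_iso_at A \<nu> T) in mu0_std (\<lambda>t. T ` snd (\<alpha> t)))"

definition mu0_class ::
    "('a, real ^ 'n::finite) chart set \<Rightarrow> ('a, 'n) cotangent_point \<Rightarrow>
     (real \<Rightarrow> ('a, 'n) lag_point) set \<Rightarrow> int" where
  "mu0_class A \<nu> C = the_elem (mu0 A \<nu> ` C)"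


section \<open>The Maslov class\<close>

definition joining_path ::
    "('a, real ^ 'n::finite) chart set \<Rightarrow> ('a, 'n) cotangent_point set \<Rightarrow>
     ('a, 'n) cotangent_point \<Rightarrow> (real \<Rightarrow> ('a, 'n) lag_point) \<Rightarrow> bool" where
  "joining_path A L \<nu> \<sigma> \<longleftrightarrow> pathin (lag_fibre_topology A L \<nu>) \<sigma> \<and>
     \<sigma> 0 = tangent_section A L \<nu> \<and> \<sigma> 1 = vertical_section A \<nu>"

definition conjugated_vertical_map ::
    "('a, real ^ 'n::finite) chart set \<Rightarrow> ('a, 'n) cotangent_point set \<Rightarrow>
     (real \<Rightarrow> ('a, 'n) lag_point) \<Rightarrow>
     (real \<Rightarrow> ('a, 'n) cotangent_point) set \<Rightarrow> (real \<Rightarrow> ('a, 'n) lag_point) set" where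
  "conjugated_vertical_map A L \<sigma> =
     class_map (lag_bundle_topology A L)
       (\<lambda>p. join_path \<sigma> (join_path (vertical_section A \<circ> p) (reverse_path \<sigma>)))"

abbreviation pi1_submanifold ::
    "('a, real ^ 'n::finite) chart set \<Rightarrow> ('a, 'n) cotangent_point set \<Rightarrow>
     ('a, 'n) cotangent_point \<Rightarrow> (real \<Rightarrow> ('a, 'n) cotangent_point) set monoid" where
  "pi1_submanifold A L \<nu> \<equiv> fundamental_group (subtopology (cotangent_topology A) L) \<nu>"

abbreviation pi1_lag_bundle ::
    "('a, real ^ 'n::finite) chart set \<Rightarrow> ('a, 'n) cotangent_point set \<Rightarrow>
     ('a, 'n) cotangent_point \<Rightarrow> (real \<Rightarrow> ('a, 'n) lag_point) set monoid" where
  "pi1_lag_bundle A L \<nu> \<equiv> fundamental_group (lag_bundle_topology A L) (tangent_section A L \<nu>)"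

abbreviation pi1_lag_fibre ::
    "('a, real ^ 'n::finite) chart set \<Rightarrow> ('a, 'n) cotangent_point set \<Rightarrow>
     ('a, 'n) cotangent_point \<Rightarrow> (real \<Rightarrow> ('a, 'n) lag_point) set monoid" where
  "pi1_lag_fibre A L \<nu> \<equiv> fundamental_group (lag_fibre_topology A L \<nu>) (tangent_section A L \<nu>)"

text \<open>The class in the kernel of \<open>\<pi>\<^sub>*\<close> is pulled back to the fibre along the injection \<open>i\<^sub>*\<close>.\<close>

definition maslov ::
    "('a, real ^ 'n::finite) chart set \<Rightarrow> ('a, 'n) cotangent_point set \<Rightarrow>
     ('a, 'n) cotangent_point \<Rightarrow> (real \<Rightarrow> ('a, 'n) lag_point) \<Rightarrow>
     (real \<Rightarrow> ('a, 'n) cotangent_point) set \<Rightarrow> int" where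
  "maslov A L \<nu> \<sigma> \<gamma> =
     mu0_class A \<nu>
       (inv_into (carrier (pi1_lag_fibre A L \<nu>)) (pi1_map (lag_bundle_topology A L) id)
          (pi1_map (lag_bundle_topology A L) (tangent_section A L) \<gamma>
           \<otimes>\<^bsub>pi1_lag_bundle A L \<nu>\<^esub>
           conjugated_vertical_map A L \<sigma> (inv\<^bsub>pi1_submanifold A L \<nu>\<^esub> \<gamma>)))"

end

theory Submission
  imports Defs
begin

text \<open>A Riemannian metric on \<open>X\<close> would reduce the structure group of the symplectic bundle \<open>T(T\<^sup>*X)\<close>,
  with its vertical Lagrangian subbundle, to \<open>O(n)\<close>, and so would extend \<open>Det\<^sup>2\<close> to a continuous map
  from \<open>\<L>(L)\<close> to the circle. Such a map is built here directly. In canonical coordinates a compatible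
  structure is a matrix \<open>Y\<close> whose Hermitian part is positive definite; a change of canonical
  coordinates acts on these matrices by affine maps, so the standard structures \<open>Y = 1\<close> of the charts can
  be glued by a partition of unity. On one fibre the resulting map is homotopic, up to constants, to
  \<open>Det\<^sup>2\<close> in any symplectic identification, because the set of the matrices \<open>Y\<close> is convex. Hence the winding
  number of this map along loops extends \<open>\<mu>\<^sub>0\<close> to an additive, homotopy invariant function on all loops of
  \<open>\<L>(L)\<close>, and \<open>\<mu>(\<gamma>)\<close> is its value on \<open>\<lambda> \<circ> \<gamma>\<close> minus its value on \<open>\<lambda>\<^sub>0 \<circ> \<gamma>\<close>: the path \<open>\<sigma>\<close> cancels.
  That the class defining \<open>\<mu>(\<gamma>)\<close> comes from the fibre is shown by contracting the path along its
  projection to \<open>L\<close>, one canonical chart at a time.\<close>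

section \<open>Homotopy classes of paths\<close>

text \<open>For a real basis of a Lagrangian subspace with position matrix \<open>A\<close> and
  momentum matrix \<open>B\<close>, \<open>Det2\<close> is the phase of
  \<open>det (A + i B)^2\<close>. The square is forced: a change of real basis multiplies the
  determinant by a real number of either sign. The twisted version uses \<open>B - i Y A\<close>,
  which is \<open>-i (A + i B)\<close> for \<open>Y = 1\<close>. A change of canonical coordinates
  sends \<open>(a, b)\<close> to \<open>(J a, S a + G b)\<close>; multiplying the new
  \<open>B - i Y A\<close> by \<open>J^T\<close> gives the old one with
  \<open>J^T Y J + i J^T S\<close> in place of \<open>Y\<close>. As the form is preserved,
  \<open>J^T S\<close> is symmetric, so the added term is skew-Hermitian and the Hermitian part
  stays positive; for cotangent charts this is the symmetry of second derivatives. The obstacle is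
  continuity: the Grassmannian has a quotient topology, the bundle a topology given by generators,
  and there is no global choice of frames. The matrix \<open>w = u u^T\<close> embeds the
  Grassmannian in the unitary matrices and satisfies \<open>w C* = C\<close> for every frame
  \<open>C = A + i B\<close>; thus \<open>w\<close> is a matrix quotient, and continuity follows
  from Cramer's rule.\<close>

lemma mem_path_class_iff:
  "q \<in> path_class X p \<longleftrightarrow>
     (\<exists>h. continuous_map (top_of_set ({0..1::real} \<times> {0..1::real})) X h \<and>
          (\<forall>t\<in>{0..1}. h (0, t) = p t) \<and> (\<forall>t\<in>{0..1}. h (1, t) = q t) \<and>
          (\<forall>s\<in>{0..1}. h (s, 0) = p 0 \<and> h (s, 1) = p 1))"
proof -
  have "q \<in> path_class X p \<longleftrightarrow> (\<exists>h. continuous_map (prod_topology (top_of_set {0..1::real}) (top_of_set {0..1::real})) X h \<and>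
          (\<forall>t\<in>topspace (top_of_set {0..1}). h (0, t) = p t) \<and> (\<forall>t\<in>topspace (top_of_set {0..1}). h (1, t) = q t) \<and>
          (\<forall>s\<in>{0..1}. h (s, 0) = p 0 \<and> h (s, 1) = p 1))"
    unfolding path_class_def mem_Collect_eq by (rule homotopic_with[where P = "\<lambda>r. r 0 = p 0 \<and> r 1 = p 1"]) simp
  then show ?thesis unfolding topspace_euclidean_subtopology prod_topology_subtopology_eu .
qed

lemma path_class_self: "pathin X p \<Longrightarrow> p \<in> path_class X p"
  by (simp add: path_class_def pathin_def)

lemma path_class_endpoints: assumes "q \<in> path_class X p" shows "q 0 = p 0" "q 1 = p 1"
  using homotopic_with_imp_property[OF assms[unfolded path_class_def mem_Collect_eq]] by auto

lemma path_class_pathin: assumes "q \<in> path_class X p" shows "pathin X q" "pathin X p"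
  using homotopic_with_imp_continuous_maps[OF assms[unfolded path_class_def mem_Collect_eq]]
  by (auto simp: pathin_def)

lemma path_class_sym: assumes "q \<in> path_class X p" shows "p \<in> path_class X q"
  using homotopic_with_symD[OF assms[unfolded path_class_def mem_Collect_eq]]
  by (simp add: path_class_def path_class_endpoints[OF assms])

lemma path_class_trans:
  assumes "q \<in> path_class X p" "r \<in> path_class X q" shows "r \<in> path_class X p"
  unfolding path_class_def mem_Collect_eq
  by (rule homotopic_with_trans[OF assms(1)[unfolded path_class_def mem_Collect_eq]])
     (use assms(2) in \<open>simp add: path_class_def path_class_endpoints[OF assms(1)]\<close>)

lemma path_class_eqI: "q \<in> path_class X p \<Longrightarrow> path_class X q = path_class X p"
  using path_class_trans path_class_sym by blast

text \<open>The unit interval is convex, so the straight-line homotopy between the two parameters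
  stays inside it. The identities between concatenations below are of this kind: both sides are one
  path with two parameters.\<close>

lemma path_class_reparam:
  fixes f g :: "real \<Rightarrow> real"
  assumes p: "pathin X p" and f: "continuous_on {0..1} f" "f ` {0..1} \<subseteq> {0..1}"
    and g: "continuous_on {0..1} g" "g ` {0..1} \<subseteq> {0..1}" and e: "f 0 = g 0" "f 1 = g 1"
  shows "p \<circ> g \<in> path_class X (p \<circ> f)"
  unfolding mem_path_class_iff
proof (intro exI conjI)
  let ?h = "\<lambda>(s, t). (1 - s) * f t + s * g t"
  have "continuous_on ({0..1} \<times> {0..1}) ?h"
    unfolding case_prod_unfold
    by (intro continuous_intros continuous_on_compose2[OF f(1)] continuous_on_compose2[OF g(1)]) auto
  moreover have "(1 - s) * f t + s * g t \<in> {0..1}" if "s \<in> {0..1}" "t \<in> {0..1}" for s t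
  proof -
    have "f t \<in> {0..1}" "g t \<in> {0..1}" using f(2) g(2) that by blast+
    then have "(1 - s) *\<^sub>R f t + s *\<^sub>R g t \<in> {0..1}"
      using that by (intro convexD[of "{0..1}"]) auto
    then show ?thesis by simp
  qed
  then have "?h \<in> {0..1} \<times> {0..1} \<rightarrow> {0..1}" by auto
  ultimately have "continuous_map (top_of_set ({0..1} \<times> {0..1})) (top_of_set {0..1}) ?h"
    by (auto simp: image_subset_iff_funcset)
  then show "continuous_map (top_of_set ({0..1} \<times> {0..1})) X (p \<circ> ?h)"
    using p unfolding pathin_def by (rule continuous_map_compose)
qed (auto simp: e algebra_simps)

lemma path_class_map:
  assumes "q \<in> path_class X p" "continuous_map X Y f" shows "f \<circ> q \<in> path_class Y (f \<circ> p)"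
  unfolding path_class_def mem_Collect_eq
  by (rule homotopic_with_compose_continuous_map_left
        [OF assms(1)[unfolded path_class_def mem_Collect_eq] assms(2)]) auto

text \<open>Pasting along \<open>t = 1/2\<close>: applied to two homotopies, it concatenates them
  stage by stage.\<close>

lemma continuous_map_join_square:
  assumes h: "continuous_map (top_of_set (S \<times> {0..1})) X h" and k: "continuous_map (top_of_set (S \<times> {0..1})) X k"
    and e: "\<And>s. s \<in> S \<Longrightarrow> h (s, 1) = k (s, 0)"
  shows "continuous_map (top_of_set (S \<times> {0..1})) X
           (\<lambda>(s, t). if t \<le> 1/2 then h (s, 2 * t) else k (s, 2 * t - 1 :: real))"
  unfolding case_prod_unfold
proof (rule continuous_map_cases_le)
  let ?T = "top_of_set (S \<times> {0..1::real})"
  show "continuous_map ?T euclideanreal snd" "continuous_map ?T euclideanreal (\<lambda>_. 1/2)"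
    by (auto intro: continuous_intros)
  have "continuous_map (subtopology ?T {x \<in> topspace ?T. snd x \<le> 1/2}) ?T (\<lambda>x. (fst x, 2 * snd x))"
    by (auto simp: subtopology_subtopology intro!: continuous_intros)
  from continuous_map_compose[OF this h]
  show "continuous_map (subtopology ?T {x \<in> topspace ?T. snd x \<le> 1/2}) X (\<lambda>x. h (fst x, 2 * snd x))"
    by (simp add: o_def)
  have "continuous_map (subtopology ?T {x \<in> topspace ?T. 1/2 \<le> snd x}) ?T (\<lambda>x. (fst x, 2 * snd x - 1))"
    by (auto simp: subtopology_subtopology intro!: continuous_intros)
  from continuous_map_compose[OF this k]
  show "continuous_map (subtopology ?T {x \<in> topspace ?T. 1/2 \<le> snd x}) X (\<lambda>x. k (fst x, 2 * snd x - 1))"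
    by (simp add: o_def)
next
  fix x assume "x \<in> topspace (top_of_set (S \<times> {0..1::real}))" "snd x = 1/2"
  then have "2 * snd x = 1" "fst x \<in> S" by auto
  then show "h (fst x, 2 * snd x) = k (fst x, 2 * snd x - 1)" using e by simp
qed

lemma path_class_join:
  fixes p :: "real \<Rightarrow> 'a"
  assumes p: "p' \<in> path_class X p" and q: "q' \<in> path_class X q" and e: "p 1 = q 0"
  shows "join_path p' q' \<in> path_class X (join_path p q)"
proof -
  obtain h :: "real \<times> real \<Rightarrow> 'a" where h: "continuous_map (top_of_set ({0..1} \<times> {0..1})) X h" "\<forall>t\<in>{0..1}. h (0, t) = p t"
     "\<forall>t\<in>{0..1}. h (1, t) = p' t" "\<forall>s\<in>{0..1}. h (s, 0) = p 0 \<and> h (s, 1) = p 1"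
    using p unfolding mem_path_class_iff by blast
  obtain k :: "real \<times> real \<Rightarrow> 'a" where k: "continuous_map (top_of_set ({0..1} \<times> {0..1})) X k" "\<forall>t\<in>{0..1}. k (0, t) = q t"
     "\<forall>t\<in>{0..1}. k (1, t) = q' t" "\<forall>s\<in>{0..1}. k (s, 0) = q 0 \<and> k (s, 1) = q 1"
    using q unfolding mem_path_class_iff by blast
  show ?thesis
    unfolding mem_path_class_iff
    by (rule exI, intro conjI, rule continuous_map_join_square[OF h(1) k(1)])
       (use h k e in \<open>auto simp: join_path_def\<close>)
qed

lemma pathin_join:
  assumes "pathin X p" "pathin X q" "p 1 = q 0" shows "pathin X (join_path p q)"
  using path_class_join[OF path_class_self path_class_self] assms path_class_pathin by blast

lemma join_path_0 [simp]: "join_path p q 0 = p 0" and join_path_1 [simp]: "join_path p q 1 = q 1"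
  by (auto simp: join_path_def)

lemma reverse_path_0 [simp]: "reverse_path p 0 = p 1" and reverse_path_1 [simp]: "reverse_path p 1 = p 0"
  by (auto simp: reverse_path_def)

lemma comp_join_path: "f \<circ> join_path p q = join_path (f \<circ> p) (f \<circ> q)"
  by (auto simp: join_path_def)

lemma comp_reverse_path: "f \<circ> reverse_path p = reverse_path (f \<circ> p)"
  by (auto simp: reverse_path_def)

lemma pathin_reparam:
  assumes "pathin X p" "continuous_on {0..1} f" "f ` {0..1} \<subseteq> {0..1}" shows "pathin X (p \<circ> f)"
  using path_class_reparam[OF assms assms(2,3)] path_class_pathin by blast

lemma pathin_reverse: assumes "pathin X p" shows "pathin X (reverse_path p)"
proof -
  have "pathin X (p \<circ> (\<lambda>t. 1 - t))"
    by (intro pathin_reparam assms continuous_intros) auto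
  then show ?thesis by (simp add: reverse_path_def o_def)
qed

lemma continuous_on_join_path:
  fixes f g :: "real \<Rightarrow> real"
  assumes "continuous_on {0..1} f" "continuous_on {0..1} g" "f 1 = g 0"
  shows "continuous_on {0..1} (join_path f g)"
  using pathin_join[of euclidean f g] assms by (simp add: path_def)

lemma join_path_image: "f ` {0..1} \<subseteq> S \<Longrightarrow> g ` {0..1} \<subseteq> S \<Longrightarrow> join_path f g ` {0..1} \<subseteq> S"
  by (auto simp: join_path_def image_subset_iff)

section \<open>Groupoid laws for homotopy classes of paths\<close>

lemma path_class_join_assoc:
  assumes p: "pathin X p" and q: "pathin X q" and r: "pathin X r" and e: "p 1 = q 0" "q 1 = r 0"
  shows "path_class X (join_path (join_path p q) r) = path_class X (join_path p (join_path q r))"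
proof -
  let ?P = "join_path p (join_path q r)"
  \<comment> \<open>\<open>k\<close> carries the breakpoints 1/4 and 1/2 of the left bracketing to
    the breakpoints 1/2 and 3/4 of the right one, with slopes 2, 1 and 1/2; the minimum glues the
    first two pieces.\<close>
  define k where "k = (\<lambda>t::real. if t \<le> 1/2 then min (2 * t) (t + 1/4) else (t + 1) / 2)"
  have k: "continuous_on {0..1} k" unfolding k_def
    by (rule continuous_on_cases_le[where h = "\<lambda>x. x"] | intro continuous_intros | simp)+
  have k01: "k ` {0..1} \<subseteq> {0..1}" by (auto simp: k_def)
  have P: "pathin X ?P" using assms by (intro pathin_join) auto
  have "path_class X (?P \<circ> k) = path_class X (?P \<circ> (\<lambda>t. t))"
    by (intro path_class_eqI path_class_reparam P k k01) (auto simp: k_def)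
  moreover have "join_path (join_path p q) r = ?P \<circ> k"
  proof
    fix t :: real
    consider "t \<le> 1/4" | "1/4 < t" "t \<le> 1/2" | "t > 1/2" by linarith
    then show "join_path (join_path p q) r t = (?P \<circ> k) t"
    proof cases
      case 1 then show ?thesis by (simp add: join_path_def k_def)
    next
      case 2
      then have "k t = t + 1/4" by (simp add: k_def)
      then show ?thesis using 2 by (simp add: join_path_def algebra_simps)
    next
      case 3 then show ?thesis by (auto simp: join_path_def k_def field_simps)
    qed
  qed
  ultimately show ?thesis by (simp add: o_def)
qed

lemma path_class_join_const_left:
  assumes p: "pathin X p" and a: "a = p 0"
  shows "path_class X (join_path (\<lambda>_. a) p) = path_class X p"
proof -
  define k where "k = (\<lambda>t::real. max 0 (2 * t - 1))"
  have "path_class X (p \<circ> k) = path_class X (p \<circ> (\<lambda>t. t))"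
    by (intro path_class_eqI path_class_reparam p) (auto simp: k_def intro!: continuous_intros)
  moreover have "join_path (\<lambda>_. a) p = p \<circ> k"
    by (auto simp: join_path_def k_def a)
  ultimately show ?thesis by (simp add: o_def)
qed

lemma path_class_join_reverse_right:
  assumes p: "pathin X p"
  shows "path_class X (join_path p (reverse_path p)) = path_class X (\<lambda>_. p 0)"
proof -
  \<comment> \<open>The parameter goes from 0 to 1 and back, so it can be deformed to the constant 0
    with fixed ends.\<close>
  define k where "k = (\<lambda>t::real. min (2 * t) (2 - 2 * t))"
  have "path_class X (p \<circ> k) = path_class X (p \<circ> (\<lambda>t. 0))"
    by (intro path_class_eqI path_class_reparam p) (auto simp: k_def intro!: continuous_intros)
  moreover have "join_path p (reverse_path p) = p \<circ> k"
    by (auto simp: join_path_def k_def reverse_path_def intro!: arg_cong[where f=p])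
  ultimately show ?thesis by (simp add: o_def)
qed

lemma reverse_reverse_path [simp]: "reverse_path (reverse_path p) = p"
  by (auto simp: reverse_path_def)

lemma path_class_join_reverse_left:
  assumes p: "pathin X p"
  shows "path_class X (join_path (reverse_path p) p) = path_class X (\<lambda>_. p 1)"
  using path_class_join_reverse_right[OF pathin_reverse[OF p]] by simp

section \<open>Induced maps and the fundamental group\<close>

lemma class_map_path_class:
  assumes "pathin X p" and F: "\<And>q. q \<in> path_class X p \<Longrightarrow> F q \<in> path_class Y (F p)"
  shows "class_map Y F (path_class X p) = path_class Y (F p)"
proof -
  have "path_class Y (F q) = path_class Y (F p)" if "q \<in> path_class X p" for q
    using F[OF that] by (rule path_class_eqI)
  moreover have "path_class X p \<noteq> {}" using path_class_self assms(1) by blast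
  ultimately show ?thesis unfolding class_map_def by auto
qed

lemma pi1_map_path_class:
  assumes "pathin X p" "continuous_map X Y f"
  shows "pi1_map Y f (path_class X p) = path_class Y (f \<circ> p)"
  unfolding pi1_map_def using assms by (intro class_map_path_class path_class_map)

text \<open>As for \<open>class_map\<close>, the union runs over representatives that all yield the
  same class, and it is nonempty because each path represents its own class.\<close>

lemma fundamental_group_mult:
  assumes "pathin X p" "pathin X q" "p 1 = q 0"
  shows "path_class X p \<otimes>\<^bsub>fundamental_group X a\<^esub> path_class X q = path_class X (join_path p q)"
proof -
  have "path_class X (join_path p' q') = path_class X (join_path p q)"
    if "p' \<in> path_class X p" "q' \<in> path_class X q" for p' q'
    using path_class_join[OF that assms(3)] by (rule path_class_eqI)
  then have "(\<Union>p'\<in>path_class X p. \<Union>q'\<in>path_class X q. path_class X (join_path p' q')) =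
      (\<Union>p'\<in>path_class X p. \<Union>q'\<in>path_class X q. path_class X (join_path p q))"
    by simp
  also have "\<dots> = path_class X (join_path p q)"
    using path_class_self[OF assms(1)] path_class_self[OF assms(2)] by blast
  finally show ?thesis by (simp add: fundamental_group_def)
qed

lemma carrier_fundamental_group:
  "carrier (fundamental_group X a) = path_class X ` {p. pathin X p \<and> p 0 = a \<and> p 1 = a}"
  by (simp add: fundamental_group_def loops_at_def)

lemma fundamental_group_one: "\<one>\<^bsub>fundamental_group X a\<^esub> = path_class X (\<lambda>_. a)"
  by (simp add: fundamental_group_def)

lemma group_fundamental_group:
  assumes "a \<in> topspace X" shows "group (fundamental_group X a)"
proof (rule groupI)
  note defs = carrier_fundamental_group fundamental_group_one
  show "\<one>\<^bsub>fundamental_group X a\<^esub> \<in> carrier (fundamental_group X a)"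
    using assms by (auto simp: defs)
  fix x assume "x \<in> carrier (fundamental_group X a)"
  then obtain p where p: "pathin X p" "p 0 = a" "p 1 = a" "x = path_class X p" by (auto simp: defs)
  show "\<one>\<^bsub>fundamental_group X a\<^esub> \<otimes>\<^bsub>fundamental_group X a\<^esub> x = x"
    using p assms by (auto simp: defs fundamental_group_mult path_class_join_const_left)
  show "\<exists>y\<in>carrier (fundamental_group X a). y \<otimes>\<^bsub>fundamental_group X a\<^esub> x = \<one>\<^bsub>fundamental_group X a\<^esub>"
    by (rule bexI[of _ "path_class X (reverse_path p)"])
       (use p in \<open>auto simp: defs fundamental_group_mult pathin_reverse path_class_join_reverse_left\<close>)
  fix y assume "y \<in> carrier (fundamental_group X a)"
  then obtain q where q: "pathin X q" "q 0 = a" "q 1 = a" "y = path_class X q" by (auto simp: defs)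
  show "x \<otimes>\<^bsub>fundamental_group X a\<^esub> y \<in> carrier (fundamental_group X a)"
    using p q by (auto simp: defs fundamental_group_mult intro!: imageI pathin_join)
  fix z assume "z \<in> carrier (fundamental_group X a)"
  then obtain r where r: "pathin X r" "r 0 = a" "r 1 = a" "z = path_class X r" by (auto simp: defs)
  show "x \<otimes>\<^bsub>fundamental_group X a\<^esub> y \<otimes>\<^bsub>fundamental_group X a\<^esub> z =
        x \<otimes>\<^bsub>fundamental_group X a\<^esub> (y \<otimes>\<^bsub>fundamental_group X a\<^esub> z)"
    using p q r by (simp add: fundamental_group_mult pathin_join path_class_join_assoc)
qed

lemma fundamental_group_inv:
  assumes "pathin X p" "p 0 = a" "p 1 = a"
  shows "inv\<^bsub>fundamental_group X a\<^esub> (path_class X p) = path_class X (reverse_path p)"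
proof -
  have "a \<in> topspace X" using assms path_start_in_topspace by blast
  then interpret group "fundamental_group X a" by (rule group_fundamental_group)
  show ?thesis
    by (rule inv_equality)
       (use assms in \<open>auto simp: carrier_fundamental_group fundamental_group_one fundamental_group_mult
            pathin_reverse path_class_join_reverse_left\<close>)
qed

section \<open>Complex matrices\<close>

text \<open>Points of the cotangent bundle and of the Lagrangian bundle are pairs, and quantifiers
  over them are kept over a single variable. The first two rules would trade products with a
  transpose for products from the other side.\<close>

declare transpose_matrix_vector [simp del] vector_transpose_matrix [simp del]
  split_paired_All [simp del] split_paired_Ex [simp del]

text \<open>Continuity is expressed by limits along a filter: one family of rules then serves
  Euclidean domains and, through \<open>atin\<close>, abstract topologies.\<close>

lemma tendsto_matrix_mult [tendsto_intros]:
  fixes f g :: "'a \<Rightarrow> 'b::real_normed_algebra_1 ^ 'n ^ 'n"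
  assumes "(f \<longlongrightarrow> A) F" "(g \<longlongrightarrow> B) F" shows "((\<lambda>x. f x ** g x) \<longlongrightarrow> A ** B) F"
  unfolding matrix_matrix_mult_def by (intro tendsto_intros assms)

lemma tendsto_det [tendsto_intros]:
  fixes f :: "'a \<Rightarrow> complex ^ 'n ^ 'n"
  assumes "(f \<longlongrightarrow> A) F" shows "((\<lambda>x. det (f x)) \<longlongrightarrow> det A) F"
  unfolding det_def by (intro tendsto_intros assms)

lemma tendsto_map_matrix_cnj [tendsto_intros]:
  assumes "(f \<longlongrightarrow> A) F" shows "((\<lambda>x. map_matrix cnj (f x)) \<longlongrightarrow> map_matrix cnj A) F"
  unfolding map_matrix_def by (intro tendsto_intros assms)

lemma tendsto_map_matrix_of_real [tendsto_intros]:
  assumes "(f \<longlongrightarrow> A) F"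
  shows "((\<lambda>x. map_matrix complex_of_real (f x)) \<longlongrightarrow> map_matrix complex_of_real A) F"
  unfolding map_matrix_def by (intro tendsto_intros assms)

lemma tendsto_transpose [tendsto_intros]:
  assumes "(f \<longlongrightarrow> A) F" shows "((\<lambda>x. transpose (f x)) \<longlongrightarrow> transpose A) F"
  unfolding transpose_def by (intro tendsto_intros assms)

lemma map_matrix_cnj_mult: "map_matrix cnj (A ** B) = map_matrix cnj A ** map_matrix cnj B"
  by (simp add: vec_eq_iff matrix_matrix_mult_def)

lemma map_matrix_cnj_cnj [simp]: "map_matrix cnj (map_matrix cnj A) = A"
  by (simp add: vec_eq_iff)

lemma map_matrix_cnj_transpose: "map_matrix cnj (transpose A) = transpose (map_matrix cnj A)"
  by (simp add: vec_eq_iff transpose_def)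

lemma det_map_matrix_cnj: "det (map_matrix cnj A) = cnj (det A)"
  by (simp add: det_def)

lemma det_map_matrix_of_real: "det (map_matrix complex_of_real A) = of_real (det A)"
  by (simp add: det_def)

lemma matrix_add_rdistrib: "(A + B) ** C = A ** C + B ** (C :: 'a::semiring_1 ^ 'n ^ 'm)"
  by (simp add: vec_eq_iff matrix_matrix_mult_def sum.distrib algebra_simps)

lemma matrix_diff_rdistrib: "(A - B) ** C = A ** C - B ** (C :: 'a::ring_1 ^ 'n ^ 'm)"
  by (simp add: vec_eq_iff matrix_matrix_mult_def sum_subtractf algebra_simps)

lemma matrix_diff_ldistrib: "C ** (A - B) = C ** A - (C :: 'a::ring_1 ^ 'n ^ 'm) ** B"
  by (simp add: vec_eq_iff matrix_matrix_mult_def sum_subtractf algebra_simps)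

lemmas matrix_distribs = matrix_add_ldistrib matrix_add_rdistrib matrix_diff_rdistrib matrix_diff_ldistrib

lemma mat_mult_left: "(mat k ** A) $ i $ j = (k :: 'a::semiring_1) * A $ i $ j"
  by (simp add: matrix_matrix_mult_def mat_def if_distrib if_distribR cong: if_cong)

lemma mat_mult_commute: "mat k ** A = A ** mat (k :: 'a::comm_semiring_1)"
  by (simp add: vec_eq_iff matrix_matrix_mult_def mat_def if_distrib if_distribR mult.commute cong: if_cong)

lemma matrix_mult_right_cancel:
  fixes A :: "'a::field ^ 'n ^ 'n"
  assumes "det A \<noteq> 0" "B ** A = C ** A" shows "B = C"
proof -
  obtain A' where "A ** A' = mat 1" using assms(1) by (auto simp: invertible_det_nz[symmetric] invertible_def)
  then show ?thesis using assms(2) by (metis matrix_mul_assoc matrix_mul_rid)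
qed

lemma det_nz_iff_kernel:
  fixes A :: "'a::field ^ 'n ^ 'n"
  shows "det A \<noteq> 0 \<longleftrightarrow> (\<forall>x. A *v x = 0 \<longrightarrow> x = 0)"
  unfolding invertible_det_nz[symmetric] matrix_left_invertible_ker[symmetric]
  by (metis invertible_def matrix_left_right_inverse)

text \<open>Cramer's rule: each row of \<open>w\<close> solves a linear system with matrix
  \<open>transpose D\<close>, so its entries are quotients of determinants. Continuity of a matrix
  known only through an equation \<open>w ** D = N\<close> is always obtained in this way.\<close>

lemma tendsto_matrix_quotient:
  fixes w N D :: "'a \<Rightarrow> complex ^ 'n ^ 'n"
  assumes eq: "\<forall>\<^sub>F x in F. w x ** D x = N x \<and> det (D x) \<noteq> 0" and eq0: "w0 ** D0 = N0" "det D0 \<noteq> 0"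
    and D: "(D \<longlongrightarrow> D0) F" and N: "(N \<longlongrightarrow> N0) F"
  shows "(w \<longlongrightarrow> w0) F"
proof -
  let ?q = "\<lambda>D N r. \<chi> k. det (\<chi> i j. if j = k then N $ r $ i else transpose D $ i $ j) / det D"
  have row: "w $ r = ?q D N r" if "w ** D = N" "det D \<noteq> 0" for w D N :: "complex ^ 'n ^ 'n" and r
  proof -
    have "transpose D *v (w $ r) = N $ r"
      using that(1) by (auto simp: vec_eq_iff matrix_matrix_mult_def matrix_vector_mult_def transpose_def mult.commute)
    then show ?thesis using cramer[of "transpose D" "w $ r" "N $ r"] that(2) by simp
  qed
  have "((\<lambda>x. w x $ r) \<longlongrightarrow> w0 $ r) F" for r
  proof (rule Lim_transform_eventually)
    show "\<forall>\<^sub>F x in F. ?q (D x) (N x) r = w x $ r"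
    proof (rule eventually_mono[OF eq])
      fix x assume "w x ** D x = N x \<and> det (D x) \<noteq> 0"
      then show "?q (D x) (N x) r = w x $ r" using row[of "w x" "D x" "N x" r] by (elim conjE) (rule sym)
    qed
    show "((\<lambda>x. ?q (D x) (N x) r) \<longlongrightarrow> w0 $ r) F"
      unfolding row[OF eq0]
    proof (intro tendsto_intros D eq0(2))
      fix i j k
      show "((\<lambda>x. if j = k then N x $ r $ i else transpose (D x) $ i $ j) \<longlongrightarrow>
              (if j = k then N0 $ r $ i else transpose D0 $ i $ j)) F"
        by (cases "j = k") (auto intro!: tendsto_intros N D)
    qed
  qed
  then show ?thesis by (rule vec_tendstoI)
qed


section \<open>Lagrangian subspaces and symmetric unitary matrices\<close>

abbreviation cvec :: "real ^ 'n \<Rightarrow> complex ^ 'n" where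
  "cvec x \<equiv> (\<chi> j. complex_of_real (x $ j))"

definition phase_of_complex :: "complex ^ 'n \<Rightarrow> 'n::finite phase" where
  "phase_of_complex z = (\<chi> j. Re (z $ j), \<chi> j. Im (z $ j))"

abbreviation cnj_vec :: "complex ^ 'n \<Rightarrow> complex ^ 'n" where
  "cnj_vec z \<equiv> (\<chi> j. cnj (z $ j))"

definition frame_matrix :: "('n \<Rightarrow> 'n::finite phase) \<Rightarrow> complex ^ 'n ^ 'n" where
  "frame_matrix b = (\<chi> i j. complex_of_phase (b j) $ i)"

lemma complex_of_phase_of_complex [simp]: "complex_of_phase (phase_of_complex z) = z"
  by (simp add: complex_of_phase_def phase_of_complex_def vec_eq_iff complex_eq_iff)

lemma phase_of_complex_of_phase [simp]: "phase_of_complex (complex_of_phase v) = v"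
  by (simp add: complex_of_phase_def phase_of_complex_def prod_eq_iff vec_eq_iff)

lemma complex_of_phase_inject [simp]: "complex_of_phase v = complex_of_phase w \<longleftrightarrow> v = w"
  by (metis phase_of_complex_of_phase)

lemma linear_complex_of_phase: "linear complex_of_phase"
  by (rule linearI) (auto simp: complex_of_phase_def vec_eq_iff complex_eq_iff)

lemma linear_phase_of_complex: "linear phase_of_complex"
  by (rule linearI) (auto simp: phase_of_complex_def vec_eq_iff prod_eq_iff)

lemma frame_matrix_cvec: "frame_matrix b *v cvec x = complex_of_phase (\<Sum>j\<in>UNIV. x $ j *\<^sub>R b j)"
  by (simp add: linear_sum[OF linear_complex_of_phase] linear_cmul[OF linear_complex_of_phase]
      frame_matrix_def matrix_vector_mult_def vec_eq_iff vector_scaleR_component)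
     (simp add: scaleR_conv_of_real mult.commute)

text \<open>Under \<open>z = x + i \<xi>\<close> the Hermitian product splits into the Euclidean
  product as its real part and the symplectic form as its imaginary part.\<close>

lemma std_form_Im: "std_form v w = Im (\<Sum>j\<in>UNIV. complex_of_phase v $ j * cnj (complex_of_phase w $ j))"
  by (simp add: std_form_def complex_of_phase_def inner_vec_def sum_subtractf[symmetric])

lemma phase_inner_Re: "v \<bullet> w = Re (\<Sum>j\<in>UNIV. complex_of_phase v $ j * cnj (complex_of_phase w $ j))"
  for v :: "'n::finite phase"
  by (simp add: inner_prod_def complex_of_phase_def inner_vec_def sum.distrib[symmetric])

lemma std_form_linear:
  "std_form (v + v') w = std_form v w + std_form v' w" "std_form v (w + w') = std_form v w + std_form v w'"
  "std_form (r *\<^sub>R v) w = r * std_form v w" "std_form v (r *\<^sub>R w) = r * std_form v w"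
  by (auto simp: std_form_def algebra_simps inner_simps)

lemma std_form_0 [simp]: "std_form 0 w = 0" "std_form v 0 = 0" by (auto simp: std_form_def)

lemma std_form_nondegenerate: assumes "\<And>w. std_form v w = 0" shows "v = (0 :: 'n::finite phase)"
proof -
  \<comment> \<open>The test vector is the product of \<open>v\<close> by \<open>-i\<close>.\<close>
  have "std_form v (snd v, - fst v) = v \<bullet> v"
    by (cases v) (simp add: std_form_def inner_prod_def inner_commute)
  then show ?thesis using assms by simp
qed

section \<open>Unitary frames of Lagrangian subspaces\<close>

lemma unitary_det_nz: assumes "u \<in> unitary_matrices" shows "det u \<noteq> 0"
proof -
  have "det (transpose (map_matrix cnj u)) * det u = 1"
    using assms by (simp add: unitary_matrices_def det_mul[symmetric] del: det_transpose)
  then show ?thesis by auto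
qed

lemma unitaryD:
  assumes "u \<in> unitary_matrices"
  shows "transpose (map_matrix cnj u) ** u = mat 1" "u ** transpose (map_matrix cnj u) = mat 1"
    "transpose u ** map_matrix cnj u = mat 1" "map_matrix cnj u ** transpose u = mat 1"
proof -
  show 1: "transpose (map_matrix cnj u) ** u = mat 1" using assms by (simp add: unitary_matrices_def)
  then show 2: "u ** transpose (map_matrix cnj u) = mat 1" by (simp add: matrix_left_right_inverse)
  show "transpose u ** map_matrix cnj u = mat 1" using arg_cong[OF 1, of transpose]
    by (simp add: matrix_transpose_mul transpose_mat)
  then show "map_matrix cnj u ** transpose u = mat 1" by (simp add: matrix_left_right_inverse)
qed

lemma mem_unitary_image:
  "v \<in> unitary_image u \<longleftrightarrow> (\<exists>x. complex_of_phase v = u *v cvec x)"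
  by (simp add: unitary_image_def)

lemma unitary_image_real_iff:
  assumes "u \<in> unitary_matrices"
  shows "v \<in> unitary_image u \<longleftrightarrow> (\<forall>j. Im ((transpose (map_matrix cnj u) *v complex_of_phase v) $ j) = 0)"
proof
  assume "v \<in> unitary_image u"
  then obtain x where "complex_of_phase v = u *v cvec x" by (auto simp: mem_unitary_image)
  then have "transpose (map_matrix cnj u) *v complex_of_phase v = cvec x"
    using unitaryD(1)[OF assms] by (simp add: matrix_vector_mul_assoc)
  then show "\<forall>j. Im ((transpose (map_matrix cnj u) *v complex_of_phase v) $ j) = 0" by simp
next
  let ?y = "transpose (map_matrix cnj u) *v complex_of_phase v"
  assume "\<forall>j. Im (?y $ j) = 0"
  then have "?y = cvec (\<chi> j. Re (?y $ j))" by (simp add: vec_eq_iff complex_eq_iff)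
  moreover have "u *v ?y = complex_of_phase v" using unitaryD(2)[OF assms] by (simp add: matrix_vector_mul_assoc)
  ultimately show "v \<in> unitary_image u" unfolding mem_unitary_image by metis
qed

text \<open>Moving \<open>u\<close> to the other side of the Hermitian product leaves the real
  vector \<open>x\<close> as second factor, so only the imaginary parts of the first one
  contribute.\<close>

lemma std_form_unitary_image:
  assumes "complex_of_phase w = u *v cvec x"
  shows "std_form v w = (\<Sum>j\<in>UNIV. Im ((transpose (map_matrix cnj u) *v complex_of_phase v) $ j) * x $ j)"
proof -
  have "(\<Sum>i\<in>UNIV. complex_of_phase v $ i * cnj ((u *v cvec x) $ i)) =
        (\<Sum>i\<in>UNIV. \<Sum>j\<in>UNIV. complex_of_phase v $ i * cnj (u $ i $ j) * of_real (x $ j))"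
    by (simp add: matrix_vector_mult_def sum_distrib_left mult.assoc)
  also have "\<dots> = (\<Sum>j\<in>UNIV. (transpose (map_matrix cnj u) *v complex_of_phase v) $ j * of_real (x $ j))"
    by (subst sum.swap) (simp add: matrix_vector_mult_def transpose_def sum_distrib_left sum_distrib_right mult_ac)
  finally show ?thesis unfolding std_form_Im assms by simp
qed

lemma Lag_iff: "W \<in> Lag \<longleftrightarrow> (\<forall>v. v \<in> W \<longleftrightarrow> (\<forall>w\<in>W. std_form v w = 0))"
  unfolding lagrangian_subspaces_def by blast

lemma LagI:
  assumes "\<And>v w. v \<in> W \<Longrightarrow> w \<in> W \<Longrightarrow> std_form v w = 0"
    and "\<And>v. (\<And>w. w \<in> W \<Longrightarrow> std_form v w = 0) \<Longrightarrow> v \<in> W"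
  shows "W \<in> Lag"
  unfolding Lag_iff using assms by blast

lemma Lag_isotropic: "W \<in> Lag \<Longrightarrow> v \<in> W \<Longrightarrow> w \<in> W \<Longrightarrow> std_form v w = 0"
  unfolding Lag_iff by blast

lemma Lag_maximal: "W \<in> Lag \<Longrightarrow> (\<And>w. w \<in> W \<Longrightarrow> std_form v w = 0) \<Longrightarrow> v \<in> W"
  unfolding Lag_iff by blast

lemma Lag_subspace: assumes "W \<in> Lag" shows "subspace W"
  using Lag_isotropic[OF assms] by (intro subspaceI Lag_maximal[OF assms]) (simp_all add: std_form_linear)

lemma unitary_image_Lag: assumes u: "u \<in> unitary_matrices" shows "unitary_image u \<in> Lag"
proof -
  let ?y = "\<lambda>v j. Im ((transpose (map_matrix cnj u) *v complex_of_phase v) $ j)"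
  have "v \<in> unitary_image u \<longleftrightarrow> (\<forall>w\<in>unitary_image u. std_form v w = 0)" for v
  proof
    assume "v \<in> unitary_image u"
    then have "?y v j = 0" for j using unitary_image_real_iff[OF u] by blast
    then show "\<forall>w\<in>unitary_image u. std_form v w = 0"
      by (auto simp: mem_unitary_image std_form_unitary_image)
  next
    assume *: "\<forall>w\<in>unitary_image u. std_form v w = 0"
    have "?y v k = 0" for k
    proof -
      \<comment> \<open>Pairing with the \<open>k\<close>-th column of \<open>u\<close> isolates the
        \<open>k\<close>-th imaginary part.\<close>
      let ?w = "phase_of_complex (u *v cvec (axis k 1))"
      have "?w \<in> unitary_image u" by (auto simp: mem_unitary_image)
      then have "std_form v ?w = 0" using * by blast
      then have "(\<Sum>j\<in>UNIV. ?y v j * (axis k 1 :: real ^ 'a) $ j) = 0"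
        by (subst (asm) std_form_unitary_image[OF complex_of_phase_of_complex])
      then show ?thesis by (simp add: axis_def if_distrib cong: if_cong)
    qed
    then show "v \<in> unitary_image u" using unitary_image_real_iff[OF u] by blast
  qed
  then show ?thesis unfolding Lag_iff by blast
qed

text \<open>Taking symplectic complements reverses the inclusion, while both subspaces are their own
  complements.\<close>

lemma Lag_subset_eq: assumes "W \<in> Lag" "W' \<in> Lag" "W \<subseteq> W'" shows "W = W'"
  using assms unfolding Lag_iff by blast

lemma dim_symplectic_complement:
  fixes W :: "'n::finite phase set"
  assumes "subspace W" shows "dim {v. \<forall>w\<in>W. std_form v w = 0} + dim W = 2 * CARD('n)"
proof -
  \<comment> \<open>\<open>?R\<close> is multiplication by \<open>i\<close>: the symplectic
    complement of \<open>W\<close> is the Euclidean orthogonal complement of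
    \<open>i W\<close>.\<close>
  let ?R = "\<lambda>w :: 'n phase. (- snd w, fst w)"
  have lin: "linear ?R" by (rule linearI) auto
  have inj: "inj ?R" by (auto simp: inj_on_def prod_eq_iff)
  have "{v. \<forall>w\<in>W. std_form v w = 0} = {v \<in> UNIV. \<forall>x\<in>?R ` W. orthogonal x v}"
    by (auto simp: std_form_def orthogonal_def inner_prod_def inner_commute)
  moreover have "dim {v \<in> UNIV. \<forall>x\<in>?R ` W. orthogonal x v} + dim (?R ` W) = dim (UNIV :: 'n phase set)"
    by (rule dim_subspace_orthogonal_to_vectors) (auto intro: linear_subspace_image lin assms)
  moreover have "dim (?R ` W) = dim W" by (rule dim_image_eq[OF lin]) (use inj in \<open>auto simp: inj_on_def\<close>)
  ultimately show ?thesis by (simp add: DIM_prod)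
qed

lemma dim_Lag: "dim W = CARD('n)" if "W \<in> Lag" for W :: "'n::finite phase set"
proof -
  have "{v. \<forall>w\<in>W. std_form v w = 0} = W" using Lag_isotropic[OF that] Lag_maximal[OF that] by blast
  then show ?thesis using dim_symplectic_complement[OF Lag_subspace[OF that]] by simp
qed

lemma isotropic_Lag:
  fixes W :: "'n::finite phase set"
  assumes "subspace W" "\<And>v w. v \<in> W \<Longrightarrow> w \<in> W \<Longrightarrow> std_form v w = 0" "dim W = CARD('n)"
  shows "W \<in> Lag"
proof -
  let ?C = "{v. \<forall>w\<in>W. std_form v w = 0}"
  have "subspace ?C" unfolding subspace_def by (auto simp: std_form_linear)
  then have "W = ?C"
    by (intro subspace_dim_equal) (use assms dim_symplectic_complement[OF assms(1)] in auto)
  then show ?thesis unfolding Lag_iff by blast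
qed

lemma orthonormal_frame:
  fixes K :: "'a::euclidean_space set"
  assumes "subspace K" "dim K = CARD('n)"
  obtains b :: "'n::finite \<Rightarrow> 'a" where "\<And>j. b j \<in> K" "\<And>i j. b i \<bullet> b j = (if i = j then 1 else 0)"
proof -
  obtain B where B: "B \<subseteq> K" "pairwise orthogonal B" "\<And>x. x \<in> B \<Longrightarrow> norm x = 1" "independent B" "card B = dim K"
    using orthonormal_basis_subspace[OF assms(1)] by metis
  have "finite B" using B(4) independent_imp_finite by blast
  then obtain b :: "'n \<Rightarrow> 'a" where b: "bij_betw b UNIV B"
    using finite_same_card_bij[of "UNIV :: 'n set" B] B(5) assms(2) by auto
  have bB: "b j \<in> B" for j using b by (auto simp: bij_betw_def)
  show thesis
  proof
    show "b j \<in> K" for j using bB B(1) by blast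
    show "b i \<bullet> b j = (if i = j then 1 else 0)" for i j
    proof (cases "i = j")
      case True then show ?thesis using B(3)[OF bB] by (simp add: norm_eq_1)
    next
      case False
      then have "b i \<noteq> b j" using b by (auto simp: bij_betw_def inj_on_def)
      then show ?thesis using B(2) bB False by (auto simp: pairwise_def orthogonal_def)
    qed
  qed
qed

text \<open>An orthonormal basis of \<open>W\<close> supplies the columns of \<open>u\<close>: the
  real parts of their Hermitian products are those of an orthonormal system, and the imaginary parts
  vanish because \<open>W\<close> is isotropic.\<close>

lemma Lag_unitary_image:
  fixes W :: "'n::finite phase set"
  assumes W: "W \<in> Lag" obtains u where "u \<in> unitary_matrices" "unitary_image u = W"
proof -
  obtain b :: "'n \<Rightarrow> 'n phase" where b: "\<And>j. b j \<in> W" "\<And>i j. b i \<bullet> b j = (if i = j then 1 else 0)"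
    using orthonormal_frame[OF Lag_subspace[OF W] dim_Lag[OF W]] by blast
  let ?u = "frame_matrix b"
  have "(transpose (map_matrix cnj ?u) ** ?u) $ i $ j = mat 1 $ i $ j" for i j
  proof -
    have e: "(transpose (map_matrix cnj ?u) ** ?u) $ i $ j =
          (\<Sum>k\<in>UNIV. complex_of_phase (b j) $ k * cnj (complex_of_phase (b i) $ k))"
      by (simp add: matrix_matrix_mult_def transpose_def frame_matrix_def mult.commute)
    have "b j \<bullet> b i = (if i = j then 1 else 0)" by (simp add: b(2))
    moreover have "std_form (b j) (b i) = 0" using Lag_isotropic[OF W] b(1) by blast
    ultimately show ?thesis unfolding e phase_inner_Re std_form_Im by (simp add: complex_eq_iff mat_def)
  qed
  then have u: "?u \<in> unitary_matrices" by (simp add: unitary_matrices_def vec_eq_iff)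
  have "unitary_image ?u \<subseteq> W"
  proof
    fix v assume "v \<in> unitary_image ?u"
    then obtain x where "v = (\<Sum>j\<in>UNIV. x $ j *\<^sub>R b j)"
      by (auto simp: mem_unitary_image frame_matrix_cvec)
    then show "v \<in> W" using b(1) by (auto intro!: subspace_sum subspace_scale Lag_subspace[OF W])
  qed
  then show thesis using that u Lag_subset_eq[OF unitary_image_Lag[OF u] W] by blast
qed

text \<open>For \<open>W = u\<real>\<^sup>n\<close> the matrix \<open>w = u u\<^sup>T\<close> only depends on \<open>W\<close>, since \<open>W = {z. w z\<^sup>* = z}\<close> where \<open>z\<^sup>*\<close> is the
  complex conjugate; moreover \<open>Det\<^sup>2 W = det w\<close>.\<close>

definition lag_matrix :: "'n::finite phase set \<Rightarrow> complex ^ 'n ^ 'n" where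
  "lag_matrix W = (THE w. \<exists>u\<in>unitary_matrices. unitary_image u = W \<and> w = u ** transpose u)"

lemma cnj_vec_mult: "cnj_vec (A *v x) = map_matrix cnj A *v cnj_vec x"
  by (simp add: vec_eq_iff matrix_vector_mult_def)

lemma cnj_vec_cvec [simp]: "cnj_vec (cvec x) = cvec x"
  by (simp add: vec_eq_iff)

lemma frame_matrix_eqI:
  assumes "\<And>j. A *v cnj_vec (complex_of_phase (b j)) = complex_of_phase (b j)"
  shows "A ** map_matrix cnj (frame_matrix b) = frame_matrix b"
  using assms by (simp add: vec_eq_iff frame_matrix_def matrix_matrix_mult_def matrix_vector_mult_def)

lemma unitary_image_fixed:
  assumes u: "u \<in> unitary_matrices" and v: "v \<in> unitary_image u"
  shows "(u ** transpose u) *v cnj_vec (complex_of_phase v) = complex_of_phase v"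
proof -
  obtain x where x: "complex_of_phase v = u *v cvec x" using v by (auto simp: mem_unitary_image)
  have "(u ** transpose u) *v cnj_vec (complex_of_phase v) = (u ** (transpose u ** map_matrix cnj u)) *v cvec x"
    unfolding x cnj_vec_mult cnj_vec_cvec by (simp only: matrix_vector_mul_assoc matrix_mul_assoc)
  then show ?thesis by (simp add: unitaryD(3)[OF u] x)
qed

lemma unitary_frame:
  fixes u :: "complex ^ 'n::finite ^ 'n"
  obtains b where "u = frame_matrix b" "\<And>j. b j \<in> unitary_image u"
proof
  let ?b = "\<lambda>j. phase_of_complex (column j u)"
  show "u = frame_matrix ?b" by (simp add: vec_eq_iff frame_matrix_def column_def)
  have "u *v cvec (axis j 1) = column j u" for j
    by (simp add: vec_eq_iff matrix_vector_mult_def column_def axis_def if_distrib cong: if_cong)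
  then show "?b j \<in> unitary_image u" for j
    unfolding mem_unitary_image by (metis complex_of_phase_of_complex)
qed

text \<open>The issue is independence of the frame. The columns of another unitary frame
  \<open>u'\<close> lie in the same subspace, so they satisfy the equation \<open>w z* = z\<close>,
  and this equation on all columns of an invertible matrix determines \<open>w\<close>.\<close>

lemma lag_matrix_unitary_image:
  assumes u: "u \<in> unitary_matrices" shows "lag_matrix (unitary_image u) = u ** transpose u"
  unfolding lag_matrix_def
proof (rule the_equality)
  show "\<exists>u'\<in>unitary_matrices. unitary_image u' = unitary_image u \<and> u ** transpose u = u' ** transpose u'"
    using u by blast
  fix w assume "\<exists>u'\<in>unitary_matrices. unitary_image u' = unitary_image u \<and> w = u' ** transpose u'"
  then obtain u' where u': "u' \<in> unitary_matrices" "unitary_image u' = unitary_image u" "w = u' ** transpose u'"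
    by blast
  obtain b where b: "u' = frame_matrix b" "\<And>j. b j \<in> unitary_image u'" using unitary_frame by blast
  have "u ** transpose u ** map_matrix cnj u' = u'"
    unfolding b(1) using b(2) unfolding u'(2) by (intro frame_matrix_eqI unitary_image_fixed u)
  then have "w = u ** transpose u ** (map_matrix cnj u' ** transpose u')"
    unfolding u'(3) by (metis matrix_mul_assoc)
  then show "w = u ** transpose u" by (simp add: unitaryD(4)[OF u'(1)])
qed

lemma lag_matrix_mem_iff:
  assumes "W \<in> Lag"
  shows "v \<in> W \<longleftrightarrow> lag_matrix W *v cnj_vec (complex_of_phase v) = complex_of_phase v"
proof -
  obtain u where u: "u \<in> unitary_matrices" "unitary_image u = W" using Lag_unitary_image[OF assms] .
  let ?z = "complex_of_phase v" and ?y = "transpose (map_matrix cnj u) *v complex_of_phase v"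
  have "v \<in> W" if "(u ** transpose u) *v cnj_vec ?z = ?z"
  proof -
    \<comment> \<open>Applying the conjugate transpose of \<open>u\<close> to
      \<open>w z* = z\<close> turns the equation into \<open>y = y*\<close>, that is, into the
      reality of \<open>y\<close>.\<close>
    have "?y = (transpose (map_matrix cnj u) ** u ** transpose u) *v cnj_vec ?z"
      by (subst that[symmetric]) (simp only: matrix_vector_mul_assoc matrix_mul_assoc)
    also have "\<dots> = cnj_vec ?y"
      by (simp add: unitaryD(1)[OF u(1)] cnj_vec_mult map_matrix_cnj_transpose)
    finally have "?y $ j = cnj (?y $ j)" for j by (metis vec_lambda_beta)
    then have "Im (?y $ j) = 0" for j by (metis Reals_cnj_iff complex_is_Real_iff)
    then show ?thesis using unitary_image_real_iff[OF u(1)] u(2) by blast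
  qed
  moreover have "(u ** transpose u) *v cnj_vec ?z = ?z" if "v \<in> W"
    using unitary_image_fixed[OF u(1)] u(2) that by blast
  ultimately show ?thesis using lag_matrix_unitary_image[OF u(1)] u(2) by metis
qed

lemma lag_matrix_frame:
  assumes "W \<in> Lag" "\<And>j. b j \<in> W"
  shows "lag_matrix W ** map_matrix cnj (frame_matrix b) = frame_matrix b"
  using assms lag_matrix_mem_iff by (intro frame_matrix_eqI) blast

lemma lag_matrix_inj:
  assumes "W \<in> Lag" "W' \<in> Lag" "lag_matrix W = lag_matrix W'" shows "W = W'"
proof -
  have "v \<in> W \<longleftrightarrow> v \<in> W'" for v
    unfolding lag_matrix_mem_iff[OF assms(1)] lag_matrix_mem_iff[OF assms(2)] assms(3) ..
  then show ?thesis by blast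
qed

lemma complex_vec_inner: "x \<bullet> y = Re (\<Sum>j\<in>UNIV. x $ j * cnj (y $ j))" for x y :: "complex ^ 'n"
  by (simp add: inner_vec_def inner_complex_def)

lemma complex_matrix_adjoint:
  "(A *v x) \<bullet> y = x \<bullet> (transpose (map_matrix cnj A) *v y)" for A :: "complex ^ 'n ^ 'm"
proof -
  have "(\<Sum>j\<in>UNIV. (A *v x) $ j * cnj (y $ j)) = (\<Sum>j\<in>UNIV. \<Sum>i\<in>UNIV. A $ j $ i * x $ i * cnj (y $ j))"
    by (simp add: matrix_vector_mult_def sum_distrib_right)
  also have "\<dots> = (\<Sum>i\<in>UNIV. x $ i * cnj ((transpose (map_matrix cnj A) *v y) $ i))"
    by (subst sum.swap) (simp add: matrix_vector_mult_def transpose_def sum_distrib_left mult_ac)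
  finally show ?thesis by (simp add: complex_vec_inner)
qed

lemma unitary_mult: "u \<in> unitary_matrices \<Longrightarrow> v \<in> unitary_matrices \<Longrightarrow> u ** v \<in> unitary_matrices"
proof -
  assume u: "u \<in> unitary_matrices" and v: "v \<in> unitary_matrices"
  have "transpose (map_matrix cnj (u ** v)) ** (u ** v) =
     transpose (map_matrix cnj v) ** (transpose (map_matrix cnj u) ** u) ** v"
    by (simp only: map_matrix_cnj_mult matrix_transpose_mul matrix_mul_assoc)
  then show ?thesis by (simp add: unitaryD(1)[OF u] unitaryD(1)[OF v] unitary_matrices_def)
qed

lemma unitary_transpose: "u \<in> unitary_matrices \<Longrightarrow> transpose u \<in> unitary_matrices"
  using unitaryD(4)[of u] by (simp add: unitary_matrices_def map_matrix_cnj_transpose)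

lemma unitary_norm: assumes "u \<in> unitary_matrices" shows "norm (u *v x) = norm x"
  by (simp add: norm_eq_sqrt_inner complex_matrix_adjoint matrix_vector_mul_assoc unitaryD(1)[OF assms])

lemma lag_matrix_unitary: assumes "W \<in> Lag" shows "lag_matrix W \<in> unitary_matrices"
proof -
  obtain u where u: "u \<in> unitary_matrices" "unitary_image u = W" using Lag_unitary_image[OF assms] .
  then show ?thesis using lag_matrix_unitary_image[OF u(1)] unitary_mult unitary_transpose by metis
qed

lemma Det2_eq_det_lag_matrix: assumes "W \<in> Lag" shows "Det2 W = det (lag_matrix W)"
proof -
  obtain u where u: "u \<in> unitary_matrices" "unitary_image u = W" using Lag_unitary_image[OF assms] .
  have e: "(det u)\<^sup>2 = det (lag_matrix W)" if "u \<in> unitary_matrices" "unitary_image u = W" for u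
    using lag_matrix_unitary_image[OF that(1)] that(2) by (simp add: det_mul power2_eq_square)
  show ?thesis unfolding Det2_def by (rule the_equality) (use u e in auto)
qed

section \<open>Compactness of the unitary group and the topology of the Grassmannian\<close>

lemma compact_unitary_matrices: "compact (unitary_matrices :: (complex ^ 'n::finite ^ 'n) set)"
proof -
  let ?U = "unitary_matrices :: (complex ^ 'n ^ 'n) set"
  have "closed ?U"
    unfolding unitary_matrices_def
    by (intro closed_Collect_eq) (auto simp: continuous_on_def intro!: tendsto_intros)
  moreover have "norm u \<le> of_nat CARD('n) * of_nat CARD('n)" if u: "u \<in> ?U" for u
  proof -
    \<comment> \<open>An entry is a coordinate of the image of a basis vector, and \<open>u\<close>
      is an isometry.\<close>
    have entry: "norm (u $ i $ j) \<le> 1" for i j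
    proof -
      have "u $ i $ j = (u *v axis j 1) $ i"
        by (simp add: matrix_vector_mult_def axis_def if_distrib cong: if_cong)
      also have "norm \<dots> \<le> norm (u *v axis j 1)" by (rule Finite_Cartesian_Product.norm_nth_le)
      finally show ?thesis by (simp add: unitary_norm[OF u])
    qed
    have "norm (u $ i) \<le> (\<Sum>j\<in>UNIV. norm (u $ i $ j))" for i
      unfolding norm_vec_def by (rule L2_set_le_sum) auto
    also have "(\<Sum>j\<in>UNIV. norm (u $ i $ j)) \<le> of_nat CARD('n) * 1" for i
      by (rule sum_bounded_above) (use entry in auto)
    finally have row: "norm (u $ i) \<le> of_nat CARD('n)" for i by simp
    have "norm u \<le> (\<Sum>i\<in>UNIV. norm (u $ i))"
      unfolding norm_vec_def[of u] by (rule L2_set_le_sum) auto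
    also have "\<dots> \<le> of_nat CARD('n) * of_nat CARD('n)"
      by (rule sum_bounded_above) (use row in auto)
    finally show ?thesis .
  qed
  then have "bounded ?U" by (auto simp: bounded_iff)
  ultimately show ?thesis by (simp add: compact_eq_bounded_closed)
qed

lemma topspace_Lag_topology [simp]: "topspace Lag_topology = (Lag :: 'n::finite phase set set)"
proof -
  have "{u \<in> unitary_matrices. unitary_image u \<in> Lag} = (unitary_matrices :: (complex ^ 'n ^ 'n) set)"
    using unitary_image_Lag by blast
  then have "openin Lag_topology (Lag :: 'n phase set set)" by (simp add: openin_Lag_topology)
  moreover have "S \<subseteq> Lag" if "openin Lag_topology S" for S :: "'n phase set set"
    using that by (simp add: openin_Lag_topology)
  ultimately show ?thesis by (metis openin_subset openin_topspace subset_antisym)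
qed

lemma continuous_on_unitary_square: "continuous_on S (\<lambda>u :: complex ^ 'n ^ 'n. u ** transpose u)"
  by (auto simp: continuous_on_def intro!: tendsto_intros)

lemma continuous_map_lag_matrix: "continuous_map Lag_topology euclidean (lag_matrix :: 'n::finite phase set \<Rightarrow> _)"
  unfolding continuous_map_def
proof (intro conjI allI impI)
  fix V :: "(complex ^ 'n ^ 'n) set" assume "openin euclidean V"
  then have "open V" by simp
  let ?U = "unitary_matrices :: (complex ^ 'n ^ 'n) set"
  have "{u \<in> ?U. unitary_image u \<in> {W \<in> topspace Lag_topology. lag_matrix W \<in> V}} =
      ?U \<inter> (\<lambda>u. u ** transpose u) -` V"
    by (auto simp: unitary_image_Lag lag_matrix_unitary_image)
  moreover have "openin (top_of_set ?U) \<dots>"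
    by (rule continuous_openin_preimage_gen[OF continuous_on_unitary_square \<open>open V\<close>])
  ultimately show "openin Lag_topology {W \<in> topspace Lag_topology. lag_matrix W \<in> V}"
    by (simp only: openin_Lag_topology) auto
qed auto

text \<open>The quotient topology of \<open>U(n)/O(n)\<close> is induced by \<open>lag_matrix\<close>, because \<open>U(n)\<close> is compact.\<close>

lemma continuous_map_into_Lag_topology:
  fixes f :: "'a \<Rightarrow> 'n::finite phase set"
  assumes f: "\<And>x. x \<in> topspace Y \<Longrightarrow> f x \<in> Lag"
    and c: "continuous_map Y euclidean (\<lambda>x. lag_matrix (f x))"
  shows "continuous_map Y Lag_topology f"
  unfolding continuous_map_def
proof (intro conjI allI impI)
  show "f \<in> topspace Y \<rightarrow> topspace Lag_topology" using f by auto
  fix S :: "'n phase set set" assume S: "openin Lag_topology S"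
  let ?U = "unitary_matrices :: (complex ^ 'n ^ 'n) set"
  let ?P = "{u \<in> ?U. unitary_image u \<in> S}"
  \<comment> \<open>\<open>?K\<close> consists of the values of \<open>lag_matrix\<close> on the
    subspaces outside \<open>S\<close>. It is closed, being the continuous image of a compact set,
    and by injectivity of \<open>lag_matrix\<close> its complement detects membership in
    \<open>S\<close>.\<close>
  let ?K = "(\<lambda>u. u ** transpose u) ` (?U - ?P)"
  have "closedin (top_of_set ?U) (?U - ?P)" using S by (auto simp: openin_Lag_topology)
  then have "compact (?U - ?P)" using compact_unitary_matrices closedin_compact by blast
  then have "closed ?K" by (intro compact_imp_closed compact_continuous_image continuous_on_unitary_square)
  moreover have "f x \<in> S \<longleftrightarrow> lag_matrix (f x) \<notin> ?K" if x: "x \<in> topspace Y" for x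
  proof -
    obtain u where u: "u \<in> ?U" "unitary_image u = f x" using Lag_unitary_image[OF f[OF x]] .
    have "unitary_image u' = f x" if "u' \<in> ?U" "lag_matrix (f x) = u' ** transpose u'" for u'
      using that lag_matrix_inj[OF f[OF x] unitary_image_Lag[OF that(1)]]
        lag_matrix_unitary_image[OF that(1)] by auto
    moreover have "lag_matrix (f x) = u ** transpose u" using lag_matrix_unitary_image[OF u(1)] u(2) by simp
    ultimately show ?thesis using u by auto
  qed
  then have "{x \<in> topspace Y. f x \<in> S} = {x \<in> topspace Y. lag_matrix (f x) \<in> - ?K}" by auto
  ultimately show "openin Y {x \<in> topspace Y. f x \<in> S}"
    using openin_continuous_map_preimage[OF c, of "- ?K"] by (simp add: open_Compl)
qed

section \<open>The square of the determinant relative to a compatible structure\<close>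

text \<open>The inner product on complex vectors is the real part of the Hermitian one, so the
  condition says that the Hermitian part of \<open>Y\<close> is positive definite.\<close>

definition accretive :: "complex ^ 'n ^ 'n \<Rightarrow> bool" where
  "accretive Y \<longleftrightarrow> (\<forall>a. a \<noteq> 0 \<longrightarrow> 0 < a \<bullet> (Y *v a))"

text \<open>If \<open>W\<close> has a real basis with coordinate matrices \<open>A\<close> (positions) and \<open>B\<close> (momenta), and
  \<open>w = lag_matrix W\<close>, then \<open>twisted_det2 Y w\<close> is \<open>(-4)\<^sup>n det (B - \<i>YA)\<^sup>2\<close> up to a positive factor.\<close>

definition twisted_det2 :: "complex ^ 'n ^ 'n \<Rightarrow> complex ^ 'n ^ 'n \<Rightarrow> complex" where
  "twisted_det2 Y w = (det (w - mat 1 + Y ** (w + mat 1)))\<^sup>2 / det w"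

lemma accretive_mat_1: "accretive (mat 1)"
  by (simp add: accretive_def)

lemma scaleR_matrix_mult_left: "(c *\<^sub>R A) ** B = c *\<^sub>R (A ** B)" for A :: "complex ^ 'n ^ 'n"
  by (simp add: vec_eq_iff matrix_matrix_mult_def scaleR_sum_right)

lemma scaleR_matrix_mult_right: "A ** (c *\<^sub>R B) = c *\<^sub>R (A ** B)" for A :: "complex ^ 'n ^ 'n"
  by (simp add: vec_eq_iff matrix_matrix_mult_def scaleR_sum_right)

lemma scaleR_matrix_vector_mult: "(c *\<^sub>R A) *v x = c *\<^sub>R (A *v x)" for A :: "complex ^ 'n ^ 'm"
  by (simp add: vec_eq_iff matrix_vector_mult_def scaleR_sum_right)

lemma sum_matrix_vector_mult: "(\<Sum>i\<in>I. A i) *v x = (\<Sum>i\<in>I. A i *v x)"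
  for A :: "'i \<Rightarrow> complex ^ 'n ^ 'm"
  by (induction I rule: infinite_finite_induct) (auto simp: matrix_vector_mult_add_rdistrib)

lemma accretive_sum:
  assumes "finite I" "\<And>i. i \<in> I \<Longrightarrow> 0 \<le> c i" "\<And>i. i \<in> I \<Longrightarrow> c i \<noteq> 0 \<Longrightarrow> accretive (Y i)"
    and "\<exists>i\<in>I. c i \<noteq> 0"
  shows "accretive (\<Sum>i\<in>I. c i *\<^sub>R Y i)"
  unfolding accretive_def
proof (intro allI impI)
  fix a :: "complex ^ 'b" assume "a \<noteq> 0"
  then have p: "0 < a \<bullet> (Y i *v a)" if "i \<in> I" "c i \<noteq> 0" for i
    using assms(3)[OF that] by (auto simp: accretive_def)
  have "0 < (\<Sum>i\<in>I. c i * (a \<bullet> (Y i *v a)))"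
  proof -
    obtain k where k: "k \<in> I" "c k \<noteq> 0" using assms(4) by blast
    have "0 \<le> c i * (a \<bullet> (Y i *v a))" if "i \<in> I" for i
      using p[OF that] assms(2)[OF that] by (cases "c i = 0") auto
    moreover have "0 < c k * (a \<bullet> (Y k *v a))" using p[OF k] assms(2)[OF k(1)] k(2) by simp
    ultimately show ?thesis using assms(1) k(1) by (intro sum_pos2[of I k]) auto
  qed
  then show "0 < a \<bullet> ((\<Sum>i\<in>I. c i *\<^sub>R Y i) *v a)"
    by (simp add: sum_matrix_vector_mult scaleR_matrix_vector_mult inner_sum_right)
qed

text \<open>For a kernel vector \<open>y\<close> the vectors \<open>wy + y\<close> and \<open>wy - y\<close> are orthogonal, as \<open>w\<close> is an isometry.\<close>

lemma accretive_det_nz: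
  assumes w: "w \<in> unitary_matrices" and Y: "accretive Y"
  shows "det (w - mat 1 + Y ** (w + mat 1)) \<noteq> 0"
  unfolding det_nz_iff_kernel
proof (intro allI impI)
  fix y assume "(w - mat 1 + Y ** (w + mat 1)) *v y = 0"
  then have e: "(w *v y - y) + Y *v (w *v y + y) = 0"
    by (simp add: matrix_vector_mult_add_rdistrib matrix_vector_mult_diff_rdistrib
        matrix_vector_mul_assoc[symmetric] matrix_vector_right_distrib)
  let ?a = "w *v y + y"
  have "?a \<bullet> (w *v y - y) = 0"
    using unitary_norm[OF w, of y] by (simp add: inner_simps inner_commute dot_square_norm)
  then have "?a \<bullet> (Y *v ?a) = 0"
    using arg_cong[OF e, of "\<lambda>v. ?a \<bullet> v"] by (simp add: inner_add_right)
  then have a: "?a = 0" using Y unfolding accretive_def by (metis less_irrefl)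
  then have "w *v y - y = 0" using e by simp
  then have "2 *\<^sub>R y = 0" using a by (simp add: scaleR_2)
  then show "y = 0" by simp
qed

lemma twisted_det2_nz: "w \<in> unitary_matrices \<Longrightarrow> accretive Y \<Longrightarrow> twisted_det2 Y w \<noteq> 0"
  by (simp add: twisted_det2_def accretive_det_nz unitary_det_nz)

lemma tendsto_twisted_det2 [tendsto_intros]:
  assumes "(Y \<longlongrightarrow> Y0) F" "(w \<longlongrightarrow> w0) F" "det w0 \<noteq> 0"
  shows "((\<lambda>x. twisted_det2 (Y x) (w x)) \<longlongrightarrow> twisted_det2 Y0 w0) F"
  unfolding twisted_det2_def by (intro tendsto_intros assms)

text \<open>For the standard structure the matrix inside the determinant collapses to
  \<open>2 w\<close>. This is the link to \<open>Det2\<close>, and the factor is positive.\<close>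

lemma twisted_det2_mat_1: "twisted_det2 (mat 1) w = of_real (4 ^ CARD('n)) * det w"
  if "det w \<noteq> 0" for w :: "complex ^ 'n::finite ^ 'n"
proof -
  have "w - mat 1 + mat 1 ** (w + mat 1) = mat 2 ** w"
    by (simp add: vec_eq_iff mat_mult_left)
  moreover have "det (mat 2 :: complex ^ 'n ^ 'n) = 2 ^ CARD('n)"
    by (subst det_diagonal) (auto simp: mat_def)
  ultimately show ?thesis using that
    by (simp add: twisted_det2_def det_mul power2_eq_square power_mult_distrib[symmetric])
qed

section \<open>Symplectic maps and their action on Lagrangian subspaces\<close>

definition symplectic_map :: "('n::finite phase \<Rightarrow> 'n phase) \<Rightarrow> bool" where
  "symplectic_map M \<longleftrightarrow> linear M \<and> (\<forall>v w. std_form (M v) (M w) = std_form v w)"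

text \<open>The symplectic maps that preserve the vertical subspace; derivatives of changes of
  canonical coordinates are of this type.\<close>

definition vertical_map :: "('n::finite phase \<Rightarrow> 'n phase) \<Rightarrow> bool" where
  "vertical_map M \<longleftrightarrow> symplectic_map M \<and> (\<forall>b. fst (M (0, b)) = 0)"

lemma symplectic_map_inj: assumes "symplectic_map M" shows "inj M"
proof -
  have "v = 0" if "M v = 0" for v
  proof (rule std_form_nondegenerate)
    fix w
    have "std_form v w = std_form (M v) (M w)" using assms by (simp add: symplectic_map_def)
    then show "std_form v w = 0" by (simp add: that)
  qed
  then show ?thesis using assms by (auto simp: symplectic_map_def linear_injective_0)
qed

lemma symplectic_map_bij: assumes "symplectic_map M" shows "bij M"
  using symplectic_map_inj[OF assms] assms linear_injective_imp_surjective
  by (auto simp: symplectic_map_def bij_def)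

lemma symplectic_map_Lag: assumes M: "symplectic_map M" and W: "W \<in> Lag" shows "M ` W \<in> Lag"
proof (rule LagI)
  have pres: "std_form (M v) (M w) = std_form v w" for v w using M by (simp add: symplectic_map_def)
  show "std_form v w = 0" if "v \<in> M ` W" "w \<in> M ` W" for v w
    using that Lag_isotropic[OF W] by (auto simp: pres)
  fix v assume *: "\<And>w. w \<in> M ` W \<Longrightarrow> std_form v w = 0"
  obtain v' where v': "v = M v'" using symplectic_map_bij[OF M] by (metis bij_pointE)
  have "std_form v' w = 0" if "w \<in> W" for w
    using *[OF imageI[OF that]] by (simp add: v' pres)
  then have "v' \<in> W" by (rule Lag_maximal[OF W])
  then show "v \<in> M ` W" by (simp add: v')
qed

text \<open>A real basis of a Lagrangian subspace is a complex basis: in terms of a unitary frame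
  \<open>u\<close> of the subspace it is \<open>u ** R\<close> with \<open>R\<close> real and
  invertible.\<close>

lemma frame_det_nz:
  assumes W: "W \<in> Lag" and b: "\<And>j. b j \<in> W" and ind: "\<And>x. (\<Sum>j\<in>UNIV. x $ j *\<^sub>R b j) = 0 \<Longrightarrow> x = 0"
  shows "det (frame_matrix b) \<noteq> 0"
proof -
  obtain u where u: "u \<in> unitary_matrices" "unitary_image u = W" using Lag_unitary_image[OF W] .
  have "\<exists>x. complex_of_phase (b j) = u *v cvec x" for j
    using b[of j] u(2) mem_unitary_image by blast
  then obtain x where x: "\<And>j. complex_of_phase (b j) = u *v cvec (x j)" by metis
  define R where "R = (\<chi> i j. x j $ i)"
  have C: "frame_matrix b = u ** map_matrix of_real R"
    by (simp add: vec_eq_iff frame_matrix_def x matrix_matrix_mult_def matrix_vector_mult_def R_def)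
  have "y = 0" if "R *v y = 0" for y
  proof (rule ind)
    have "map_matrix of_real R *v cvec y = cvec (R *v y)"
      by (simp add: vec_eq_iff matrix_vector_mult_def)
    then have "frame_matrix b *v cvec y = 0"
      unfolding C matrix_vector_mul_assoc[symmetric]
      by (simp add: that zero_vec_def[symmetric])
    then show "(\<Sum>j\<in>UNIV. y $ j *\<^sub>R b j) = 0"
      unfolding frame_matrix_cvec by (metis complex_of_phase_inject linear_0 linear_complex_of_phase)
  qed
  then have "det R \<noteq> 0" by (simp add: det_nz_iff_kernel)
  then show ?thesis by (simp add: C det_mul unitary_det_nz[OF u(1)] det_map_matrix_of_real)
qed

lemma Lag_frame:
  fixes W :: "'n::finite phase set"
  assumes "W \<in> Lag"
  obtains b :: "'n \<Rightarrow> 'n phase" where "\<And>j. b j \<in> W" "\<And>x. (\<Sum>j\<in>UNIV. x $ j *\<^sub>R b j) = 0 \<Longrightarrow> x = 0"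
proof -
  obtain u where u: "u \<in> unitary_matrices" "unitary_image u = W" using Lag_unitary_image[OF assms] .
  obtain b :: "'n \<Rightarrow> 'n phase" where b: "u = frame_matrix b" "\<And>j. b j \<in> unitary_image u" using unitary_frame by blast
  have "x = 0" if "(\<Sum>j\<in>UNIV. x $ j *\<^sub>R b j) = 0" for x
  proof -
    have "u *v cvec x = 0" unfolding b(1) frame_matrix_cvec that by (simp add: linear_0 linear_complex_of_phase)
    then have "cvec x = 0" using unitary_det_nz[OF u(1)] det_nz_iff_kernel by blast
    then show "x = 0" by (simp add: vec_eq_iff)
  qed
  then show thesis using that[of b] b(2) u(2) by blast
qed

text \<open>A symplectic map preserving the vertical subspace is \<open>(a, b) \<mapsto> (J a, S a + G b)\<close>, where
  \<open>J\<^sup>T G = 1\<close> and \<open>J\<^sup>T S\<close> is symmetric.\<close>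

definition base_block where "base_block M = map_matrix complex_of_real (matrix (\<lambda>a. fst (M (a, 0 :: real ^ 'n::finite))))"
definition shear_block where "shear_block M = map_matrix complex_of_real (matrix (\<lambda>a. snd (M (a, 0 :: real ^ 'n::finite))))"
definition fibre_block where "fibre_block M = map_matrix complex_of_real (matrix (\<lambda>b. snd (M (0 :: real ^ 'n::finite, b))))"

text \<open>Chosen so that \<open>b - \<i> (pull_back M Y) a = J\<^sup>T (b' - \<i> Y a')\<close> for \<open>(a', b') = M (a, b)\<close>.\<close>

definition pull_back :: "('n::finite phase \<Rightarrow> 'n phase) \<Rightarrow> complex ^ 'n ^ 'n \<Rightarrow> complex ^ 'n ^ 'n" where
  "pull_back M Y = transpose (base_block M) ** Y ** base_block M
     + mat \<i> ** (transpose (base_block M) ** shear_block M)"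

text \<open>For a frame \<open>C\<close> of \<open>W\<close> with image frame \<open>C'\<close>,
  adding and subtracting the formulas for \<open>C' + cnj C'\<close> and \<open>C' - cnj C'\<close>
  gives \<open>2 C' = N cnj C\<close> and \<open>2 cnj C' = D cnj C\<close>, with \<open>N\<close>
  this matrix and \<open>D\<close> the next one. Hence \<open>lag_matrix\<close> of the image is the
  quotient of \<open>N\<close> by \<open>D\<close>: vertical maps act by fractional linear
  transformations.\<close>

definition action_numerator :: "('n::finite phase \<Rightarrow> 'n phase) \<Rightarrow> complex ^ 'n ^ 'n \<Rightarrow> complex ^ 'n ^ 'n" where
  "action_numerator M w = (base_block M + mat \<i> ** shear_block M) ** (w + mat 1) + fibre_block M ** (w - mat 1)"

definition action_denominator :: "('n::finite phase \<Rightarrow> 'n phase) \<Rightarrow> complex ^ 'n ^ 'n \<Rightarrow> complex ^ 'n ^ 'n" where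
  "action_denominator M w = (base_block M - mat \<i> ** shear_block M) ** (w + mat 1) - fibre_block M ** (w - mat 1)"

context
  fixes M :: "'n::finite phase \<Rightarrow> 'n phase"
  assumes M: "vertical_map M"
begin

lemma vertical_map_linear: "linear M"
  and vertical_map_pres: "std_form (M v) (M w) = std_form v w"
  and vertical_map_fst: "fst (M (0, b)) = 0"
  using M by (auto simp: vertical_map_def symplectic_map_def)

lemma linear_blocks:
  "linear (\<lambda>a. fst (M (a, 0)))" "linear (\<lambda>a. snd (M (a, 0)))" "linear (\<lambda>b. snd (M (0, b)))"
proof -
  have l1: "linear (\<lambda>a :: real ^ 'n. (a, 0 :: real ^ 'n))" "linear (\<lambda>b :: real ^ 'n. (0 :: real ^ 'n, b))"
    by (auto intro: linearI)
  have "linear (fst \<circ> M \<circ> (\<lambda>a. (a, 0)))" "linear (snd \<circ> M \<circ> (\<lambda>a. (a, 0)))" "linear (snd \<circ> M \<circ> (\<lambda>b. (0, b)))"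
    by (intro linear_compose l1 vertical_map_linear bounded_linear.linear bounded_linear_fst bounded_linear_snd)+
  then show "linear (\<lambda>a. fst (M (a, 0)))" "linear (\<lambda>a. snd (M (a, 0)))" "linear (\<lambda>b. snd (M (0, b)))"
    by (simp_all add: o_def)
qed

lemma block_apply:
  "base_block M *v cvec a = cvec (fst (M (a, 0)))"
  "shear_block M *v cvec a = cvec (snd (M (a, 0)))"
  "fibre_block M *v cvec b = cvec (snd (M (0, b)))"
proof -
  have *: "map_matrix of_real R *v cvec x = cvec (R *v x)" for R :: "real ^ 'n ^ 'n" and x
    by (simp add: vec_eq_iff matrix_vector_mult_def)
  show "base_block M *v cvec a = cvec (fst (M (a, 0)))"
    "shear_block M *v cvec a = cvec (snd (M (a, 0)))"
    "fibre_block M *v cvec b = cvec (snd (M (0, b)))"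
    unfolding base_block_def shear_block_def fibre_block_def * by (simp_all add: matrix_works linear_blocks)
qed

lemma vertical_map_split: "fst (M v) = fst (M (fst v, 0))" "snd (M v) = snd (M (fst v, 0)) + snd (M (0, snd v))"
proof -
  have "M v = M (fst v, 0) + M (0, snd v)"
    by (subst linear_add[OF vertical_map_linear, symmetric]) simp
  then show "fst (M v) = fst (M (fst v, 0))" "snd (M v) = snd (M (fst v, 0)) + snd (M (0, snd v))"
    using vertical_map_fst[of "snd v"] by simp_all
qed

text \<open>The sum with the conjugate is twice the position matrix, which vertical vectors do not
  influence.\<close>

lemma frame_matrix_plus:
  "frame_matrix (M \<circ> b) + map_matrix cnj (frame_matrix (M \<circ> b)) =
     base_block M ** (frame_matrix b + map_matrix cnj (frame_matrix b))"
proof -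
  have col: "(\<Sum>k\<in>UNIV. base_block M $ i $ k * complex_of_real (fst (b j) $ k)) = of_real (fst (M (b j)) $ i)" for i j
    using arg_cong[OF block_apply(1)[of "fst (b j)"], of "\<lambda>v. v $ i"] vertical_map_split(1)[of "b j"]
    by (simp add: matrix_vector_mult_def)
  have e: "complex_of_phase v $ i + cnj (complex_of_phase v $ i) = 2 * of_real (fst v $ i)" for v i
    by (simp add: complex_of_phase_def complex_eq_iff)
  show ?thesis
    by (simp add: vec_eq_iff frame_matrix_def matrix_matrix_mult_def e mult.left_commute[of _ 2] col
          sum_distrib_left[symmetric])
qed

text \<open>The difference is \<open>2 i\<close> times the momentum matrix, to which both the shear
  and the fibre block contribute; the factor \<open>i\<close> at the shear makes up for the real
  position matrix.\<close>

lemma frame_matrix_minus: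
  "frame_matrix (M \<circ> b) - map_matrix cnj (frame_matrix (M \<circ> b)) =
     mat \<i> ** shear_block M ** (frame_matrix b + map_matrix cnj (frame_matrix b)) +
     fibre_block M ** (frame_matrix b - map_matrix cnj (frame_matrix b))"
proof -
  have col: "(\<Sum>k\<in>UNIV. shear_block M $ i $ k * complex_of_real (fst (b j) $ k)) +
     (\<Sum>k\<in>UNIV. fibre_block M $ i $ k * complex_of_real (snd (b j) $ k)) = of_real (snd (M (b j)) $ i)" for i j
    using arg_cong[OF block_apply(2)[of "fst (b j)"], of "\<lambda>v. v $ i"]
      arg_cong[OF block_apply(3)[of "snd (b j)"], of "\<lambda>v. v $ i"] vertical_map_split(2)[of "b j"]
    by (simp add: matrix_vector_mult_def)
  have e: "complex_of_phase v $ i + cnj (complex_of_phase v $ i) = 2 * of_real (fst v $ i)"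
    "complex_of_phase v $ i - cnj (complex_of_phase v $ i) = 2 * \<i> * of_real (snd v $ i)" for v i
    by (simp_all add: complex_of_phase_def complex_eq_iff)
  have "2 * \<i> * of_real (snd (M (b j)) $ i) =
      (\<Sum>k\<in>UNIV. \<i> * shear_block M $ i $ k * (2 * of_real (fst (b j) $ k))) +
      (\<Sum>k\<in>UNIV. fibre_block M $ i $ k * (2 * \<i> * of_real (snd (b j) $ k)))" for i j
    unfolding col[of i j, symmetric] by (simp add: sum_distrib_left ring_distribs mult_ac)
  then show ?thesis
    by (simp add: vec_eq_iff frame_matrix_def matrix_matrix_mult_def[of "_ ** _"] matrix_matrix_mult_def[of "fibre_block M"] mat_mult_left e)
qed

text \<open>This is the pairing of vertical with horizontal basis vectors; the image of a vertical
  one has no position part.\<close>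

lemma block_transpose_fibre: "transpose (base_block M) ** fibre_block M = mat 1"
proof -
  have "(\<Sum>k\<in>UNIV. fst (M (axis i 1, 0)) $ k * snd (M (0, axis j 1)) $ k) = (if i = j then 1 else 0)" for i j
  proof -
    have "std_form (M (0, axis j 1)) (M (axis i 1, 0)) = std_form (0, axis j 1) (axis i 1, 0 :: real ^ 'n)"
      by (rule vertical_map_pres)
    then show ?thesis
      by (simp add: std_form_def vertical_map_fst inner_axis_axis)
        (auto simp: inner_vec_def mult.commute)
  qed
  then have "of_real (\<Sum>k\<in>UNIV. fst (M (axis i 1, 0)) $ k * snd (M (0, axis j 1)) $ k) = (if i = j then 1 else (0::complex))" for i j
    by simp
  then show ?thesis
    by (simp add: vec_eq_iff matrix_matrix_mult_def transpose_def base_block_def fibre_block_def matrix_def mat_def)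
qed

lemma block_transpose_shear:
  "transpose (transpose (base_block M) ** shear_block M) = transpose (base_block M) ** shear_block M"
proof -
  have "(\<Sum>k\<in>UNIV. fst (M (axis j 1, 0)) $ k * snd (M (axis i 1, 0)) $ k) =
        (\<Sum>k\<in>UNIV. fst (M (axis i 1, 0)) $ k * snd (M (axis j 1, 0)) $ k)" for i j
  proof -
    have "std_form (M (axis i 1, 0)) (M (axis j 1, 0)) = std_form (axis i 1, 0) (axis j 1, 0 :: real ^ 'n)"
      by (rule vertical_map_pres)
    then show ?thesis by (simp add: std_form_def inner_vec_def mult.commute)
  qed
  then have "complex_of_real (\<Sum>k\<in>UNIV. fst (M (axis j 1, 0)) $ k * snd (M (axis i 1, 0)) $ k) =
        of_real (\<Sum>k\<in>UNIV. fst (M (axis i 1, 0)) $ k * snd (M (axis j 1, 0)) $ k)" for i j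
    by simp
  then show ?thesis
    by (simp add: vec_eq_iff matrix_matrix_mult_def transpose_def base_block_def shear_block_def matrix_def)
qed

lemma cnj_blocks:
  "map_matrix cnj (base_block M) = base_block M" "map_matrix cnj (shear_block M) = shear_block M"
  by (simp_all add: base_block_def shear_block_def vec_eq_iff)

text \<open>What matters is that the determinant is real: its square is then positive, although its
  sign is unknown.\<close>

lemma det_base_block: obtains j where "det (base_block M) = of_real j" "j \<noteq> 0"
proof
  show "det (base_block M) = of_real (det (matrix (\<lambda>a. fst (M (a, 0)))))"
    by (simp add: base_block_def det_map_matrix_of_real)
  have "det (base_block M) * det (fibre_block M) = 1"
    using arg_cong[OF block_transpose_fibre, of det] by (simp add: det_mul)
  then have "det (base_block M) \<noteq> 0" by auto
  then show "det (matrix (\<lambda>a. fst (M (a, 0)))) \<noteq> 0"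
    by (auto simp: base_block_def det_map_matrix_of_real)
qed

text \<open>\<open>transpose J ** Y ** J\<close> with \<open>J\<close> real and invertible is a
  congruence, which keeps positivity. The shear term is \<open>i\<close> times a real symmetric
  matrix, hence skew-Hermitian and invisible to the real part.\<close>

lemma accretive_pull_back:
  assumes Y: "accretive Y" shows "accretive (pull_back M Y)"
  unfolding accretive_def
proof (intro allI impI)
  fix a :: "complex ^ 'n" assume a: "a \<noteq> 0"
  let ?J = "base_block M" and ?T = "transpose (base_block M) ** shear_block M"
  have "det ?J \<noteq> 0" using det_base_block by (metis of_real_eq_0_iff)
  then have "?J *v a \<noteq> 0" using a det_nz_iff_kernel by blast
  then have "0 < (?J *v a) \<bullet> (Y *v (?J *v a))" using Y by (simp add: accretive_def)
  also have "\<dots> = a \<bullet> ((transpose ?J ** Y ** ?J) *v a)"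
    by (simp add: complex_matrix_adjoint cnj_blocks matrix_vector_mul_assoc matrix_mul_assoc)
  finally have 1: "0 < a \<bullet> ((transpose ?J ** Y ** ?J) *v a)" .
  have T: "transpose (map_matrix cnj ?T) = ?T"
    by (simp add: map_matrix_cnj_mult map_matrix_cnj_transpose cnj_blocks block_transpose_shear)
  have ci: "transpose (map_matrix cnj (mat \<i> ** ?T)) = - (mat \<i> ** ?T)"
  proof -
    have "map_matrix cnj (mat \<i> ** ?T) = - (mat \<i> ** map_matrix cnj ?T)"
      by (simp add: vec_eq_iff mat_mult_left)
    then have "transpose (map_matrix cnj (mat \<i> ** ?T)) = - (transpose (map_matrix cnj ?T) ** mat \<i>)"
      by (simp add: vec_eq_iff transpose_def mat_mult_left mat_mult_commute[symmetric])
    then show ?thesis by (simp add: T mat_mult_commute)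
  qed
  have "a \<bullet> ((mat \<i> ** ?T) *v a) = - (a \<bullet> ((mat \<i> ** ?T) *v a))"
    using complex_matrix_adjoint[of "mat \<i> ** ?T" a a] unfolding ci
    by (simp add: inner_commute vec_eq_iff matrix_vector_mult_def sum_negf inner_vec_def)
  then have "a \<bullet> ((mat \<i> ** ?T) *v a) = 0" by linarith
  then show "0 < a \<bullet> (pull_back M Y *v a)"
    using 1 by (simp add: pull_back_def matrix_vector_mult_add_rdistrib inner_add_right)
qed

lemma lag_matrix_image_frames:
  assumes W: "W \<in> Lag"
  obtains C C' where "det C \<noteq> 0" "det C' \<noteq> 0"
    "lag_matrix W ** map_matrix cnj C = C" "lag_matrix (M ` W) ** map_matrix cnj C' = C'"
    "C' + map_matrix cnj C' = base_block M ** (C + map_matrix cnj C)"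
    "C' - map_matrix cnj C' = mat \<i> ** shear_block M ** (C + map_matrix cnj C) + fibre_block M ** (C - map_matrix cnj C)"
proof -
  have symp: "symplectic_map M" using M by (simp add: vertical_map_def)
  have W': "M ` W \<in> Lag" by (rule symplectic_map_Lag[OF symp W])
  obtain b :: "'n \<Rightarrow> 'n phase" where b: "\<And>j. b j \<in> W" "\<And>x. (\<Sum>j\<in>UNIV. x $ j *\<^sub>R b j) = 0 \<Longrightarrow> x = 0"
    using Lag_frame[OF W] by blast
  have "det (frame_matrix b) \<noteq> 0" by (rule frame_det_nz[OF W b])
  moreover have "det (frame_matrix (M \<circ> b)) \<noteq> 0"
  proof (rule frame_det_nz[OF W'])
    fix x assume "(\<Sum>j\<in>UNIV. x $ j *\<^sub>R (M \<circ> b) j) = 0"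
    then have "M (\<Sum>j\<in>UNIV. x $ j *\<^sub>R b j) = M 0"
      by (simp add: linear_sum[OF vertical_map_linear] linear_cmul[OF vertical_map_linear] linear_0[OF vertical_map_linear])
    then show "x = 0" using symplectic_map_inj[OF symp] b(2) by (meson injD)
  qed (use b in auto)
  moreover have "lag_matrix W ** map_matrix cnj (frame_matrix b) = frame_matrix b"
    by (rule lag_matrix_frame[OF W b(1)])
  moreover have "lag_matrix (M ` W) ** map_matrix cnj (frame_matrix (M \<circ> b)) = frame_matrix (M \<circ> b)"
    by (rule lag_matrix_frame[OF W']) (use b(1) in auto)
  ultimately show thesis using that frame_matrix_plus frame_matrix_minus by blast
qed

lemma lag_matrix_image:
  assumes W: "W \<in> Lag"
  defines "D \<equiv> action_denominator M (lag_matrix W)" and "N \<equiv> action_numerator M (lag_matrix W)"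
  shows "lag_matrix (M ` W) ** D = N" "det D \<noteq> 0"
proof -
  obtain C C' where C: "det C \<noteq> 0" "det C' \<noteq> 0" and w: "lag_matrix W ** map_matrix cnj C = C"
    and w': "lag_matrix (M ` W) ** map_matrix cnj C' = C'"
    and p: "C' + map_matrix cnj C' = base_block M ** (C + map_matrix cnj C)"
    and m: "C' - map_matrix cnj C' = mat \<i> ** shear_block M ** (C + map_matrix cnj C) + fibre_block M ** (C - map_matrix cnj C)"
    by (rule lag_matrix_image_frames[OF W])
  have wp: "(lag_matrix W + mat 1) ** map_matrix cnj C = C + map_matrix cnj C"
    and wm: "(lag_matrix W - mat 1) ** map_matrix cnj C = C - map_matrix cnj C"
    by (simp_all add: matrix_distribs w)
  have "D ** map_matrix cnj C = (C' + map_matrix cnj C') - (C' - map_matrix cnj C')"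
    unfolding D_def action_denominator_def matrix_diff_rdistrib p m matrix_mul_assoc[symmetric] wp wm by (simp add: w)
  then have D: "D ** map_matrix cnj C = mat 2 ** map_matrix cnj C'"
    by (simp add: vec_eq_iff mat_mult_left)
  have "N ** map_matrix cnj C = (C' + map_matrix cnj C') + (C' - map_matrix cnj C')"
    unfolding N_def action_numerator_def matrix_add_rdistrib p m matrix_mul_assoc[symmetric] wp wm by (simp add: w)
  then have N: "N ** map_matrix cnj C = mat 2 ** C'"
    by (simp add: vec_eq_iff mat_mult_left)
  have "lag_matrix (M ` W) ** D ** map_matrix cnj C = lag_matrix (M ` W) ** (map_matrix cnj C' ** mat 2)"
    using D by (metis mat_mult_commute matrix_mul_assoc)
  also have "\<dots> = C' ** mat 2" by (metis w' matrix_mul_assoc)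
  also have "\<dots> = N ** map_matrix cnj C" by (metis N mat_mult_commute)
  finally show "lag_matrix (M ` W) ** D = N"
    using matrix_mult_right_cancel[of "map_matrix cnj C"] C(1) by (simp add: det_map_matrix_cnj)
  have "det (mat 2 :: complex ^ 'n ^ 'n) \<noteq> 0"
    by (subst det_diagonal) (auto simp: mat_def)
  then have "det (D ** map_matrix cnj C) \<noteq> 0" unfolding D using C(2) by (simp add: det_mul det_map_matrix_cnj)
  then show "det D \<noteq> 0" by (simp add: det_mul)
qed

text \<open>Multiplied by \<open>cnj C\<close>, the matrix \<open>w - 1 + Y (w + 1)\<close> becomes
  \<open>(C - cnj C) + Y (C + cnj C)\<close>. For the image frame this expression, multiplied by
  \<open>transpose J\<close>, is the one for the pulled-back structure and the original
  frame.\<close>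

lemma twisted_det2_pull_back:
  assumes W: "W \<in> Lag"
  obtains r where "0 < r" "twisted_det2 Y (lag_matrix (M ` W)) = of_real r * twisted_det2 (pull_back M Y) (lag_matrix W)"
proof -
  let ?w = "lag_matrix W" and ?w' = "lag_matrix (M ` W)"
  obtain C C' where C: "det C \<noteq> 0" and C': "det C' \<noteq> 0" and w: "?w ** map_matrix cnj C = C"
    and w': "?w' ** map_matrix cnj C' = C'"
    and p: "C' + map_matrix cnj C' = base_block M ** (C + map_matrix cnj C)"
    and m: "C' - map_matrix cnj C' = mat \<i> ** shear_block M ** (C + map_matrix cnj C) + fibre_block M ** (C - map_matrix cnj C)"
    by (rule lag_matrix_image_frames[OF W])
  let ?J = "base_block M" and ?S = "shear_block M" and ?G = "fibre_block M"
  let ?N = "?w - mat 1 + pull_back M Y ** (?w + mat 1)" and ?N' = "?w' - mat 1 + Y ** (?w' + mat 1)"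
  have N: "?N ** map_matrix cnj C = (C - map_matrix cnj C) + pull_back M Y ** (C + map_matrix cnj C)"
    by (simp add: matrix_distribs w flip: matrix_mul_assoc)
  have N': "?N' ** map_matrix cnj C' = (C' - map_matrix cnj C') + Y ** (C' + map_matrix cnj C')"
    by (simp add: matrix_distribs w' flip: matrix_mul_assoc)
  have "transpose ?J ** (?N' ** map_matrix cnj C') =
      transpose ?J ** (mat \<i> ** ?S) ** (C + map_matrix cnj C) +
      (transpose ?J ** ?G) ** (C - map_matrix cnj C) + transpose ?J ** Y ** ?J ** (C + map_matrix cnj C)"
    unfolding N' p m
    by (simp only: matrix_add_ldistrib matrix_mul_assoc)
  also have "transpose ?J ** (mat \<i> ** ?S) = mat \<i> ** (transpose ?J ** ?S)"
    by (metis mat_mult_commute matrix_mul_assoc)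
  finally have "transpose ?J ** (?N' ** map_matrix cnj C') = ?N ** map_matrix cnj C"
    unfolding N unfolding block_transpose_fibre pull_back_def by (simp add: matrix_add_rdistrib algebra_simps)
  from arg_cong[OF this, of det] have dN: "det ?J * (det ?N' * cnj (det C')) = det ?N * cnj (det C)"
    by (simp only: det_mul det_map_matrix_cnj det_transpose)
  have dw: "det ?w * cnj (det C) = det C" "det ?w' * cnj (det C') = det C'"
    using arg_cong[OF w, of det] arg_cong[OF w', of det] by (simp_all add: det_mul det_map_matrix_cnj)
  obtain j where j: "det ?J = of_real j" "j \<noteq> 0" by (rule det_base_block)
  \<comment> \<open>From \<open>w cnj C = C\<close> each \<open>det w\<close> equals
    \<open>det C / cnj (det C)\<close>, so both sides are squares of determinants divided by phases;
    the moduli and the real factor \<open>j\<close> of \<open>dN\<close> combine to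
    \<open>r\<close>.\<close>
  define r where "r = (cmod (det C))\<^sup>2 / (j\<^sup>2 * (cmod (det C'))\<^sup>2)"
  show thesis
  proof
    show "0 < r" using C C' j by (simp add: r_def)
    have nz: "cnj (det C) \<noteq> 0" "cnj (det C') \<noteq> 0" using C C' by auto
    have e1: "det ?w = det C / cnj (det C)" "det ?w' = det C' / cnj (det C')"
      using dw nz by (auto simp: field_simps)
    have e2: "det ?N' = det ?N * cnj (det C) / (of_real j * cnj (det C'))"
      using dN nz j by (simp add: field_simps)
    have e3: "complex_of_real r = det C * cnj (det C) / ((of_real j)\<^sup>2 * (det C' * cnj (det C')))"
      unfolding r_def of_real_divide of_real_mult complex_norm_square by simp
    show "twisted_det2 Y ?w' = of_real r * twisted_det2 (pull_back M Y) ?w"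
      unfolding twisted_det2_def e1 e2 e3 using nz C C' j by (simp add: field_simps power2_eq_square)
  qed
qed

end

lemma vertical_map_comp: "vertical_map M \<Longrightarrow> vertical_map N \<Longrightarrow> vertical_map (M \<circ> N)"
  unfolding vertical_map_def symplectic_map_def
  by (auto intro: linear_compose) (metis prod.collapse)

text \<open>Functoriality is what makes structures carried through different charts consistent. The
  base blocks multiply, and in the shear term of the composition \<open>transpose J ** G\<close>
  cancels to the identity.\<close>

lemma pull_back_comp:
  fixes M N :: "'n::finite phase \<Rightarrow> 'n phase"
  assumes M: "vertical_map M" and N: "vertical_map N"
  shows "pull_back (M \<circ> N) Y = pull_back N (pull_back M Y)"
proof -
  have MN: "vertical_map (M \<circ> N)" by (rule vertical_map_comp[OF M N])
  \<comment> \<open>The blocks are known through their action on real vectors; the standard basis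
    vectors are real and determine a complex matrix.\<close>
  have real_eq: "A = B" if "\<And>x. A *v cvec x = B *v cvec x" for A B :: "complex ^ 'n ^ 'n"
  proof -
    have "column j A = column j B" for j
      using that[of "axis j 1"] by (simp add: vec_eq_iff matrix_vector_mult_def column_def axis_def if_distrib cong: if_cong)
    then show ?thesis by (simp add: vec_eq_iff column_def)
  qed
  have J: "base_block (M \<circ> N) = base_block M ** base_block N"
  proof (rule real_eq)
    fix x
    show "base_block (M \<circ> N) *v cvec x = (base_block M ** base_block N) *v cvec x"
      unfolding matrix_vector_mul_assoc[symmetric] block_apply[OF MN] block_apply[OF N] block_apply[OF M]
      using vertical_map_split(1)[OF M, of "N (x, 0)"] by simp
  qed
  have S: "shear_block (M \<circ> N) = shear_block M ** base_block N + fibre_block M ** shear_block N"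
  proof (rule real_eq)
    fix x
    show "shear_block (M \<circ> N) *v cvec x = (shear_block M ** base_block N + fibre_block M ** shear_block N) *v cvec x"
      unfolding matrix_vector_mult_add_rdistrib matrix_vector_mul_assoc[symmetric] block_apply[OF MN] block_apply[OF N] block_apply[OF M]
      using vertical_map_split(2)[OF M, of "N (x, 0)"] by (simp add: vec_eq_iff)
  qed
  let ?JM = "base_block M" and ?JN = "base_block N" and ?SM = "shear_block M" and ?SN = "shear_block N"
  have i: "A ** (mat \<i> ** B) = mat \<i> ** (A ** B)" for A B :: "complex ^ 'n ^ 'n"
    by (metis mat_mult_commute matrix_mul_assoc)
  have "transpose ?JN ** transpose ?JM ** (fibre_block M ** ?SN) = transpose ?JN ** (transpose ?JM ** fibre_block M) ** ?SN"
    by (simp add: matrix_mul_assoc)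
  then have *: "transpose ?JN ** transpose ?JM ** (fibre_block M ** ?SN) = transpose ?JN ** ?SN"
    by (simp add: block_transpose_fibre[OF M])
  show ?thesis
    unfolding pull_back_def J S matrix_transpose_mul matrix_add_ldistrib * matrix_add_rdistrib i
    by (simp only: matrix_mul_assoc matrix_add_rdistrib i add.assoc i[unfolded matrix_mul_assoc])
qed

text \<open>\<open>pull_back\<close> is affine rather than linear in \<open>Y\<close>: the constant
  shear term is reproduced exactly when the weights add up to 1.\<close>

lemma pull_back_sum:
  assumes "(\<Sum>i\<in>I. c i) = 1" "finite I"
  shows "pull_back M (\<Sum>i\<in>I. c i *\<^sub>R Y i) = (\<Sum>i\<in>I. c i *\<^sub>R pull_back M (Y i))"
proof -
  let ?J = "base_block M" and ?T = "mat \<i> ** (transpose (base_block M) ** shear_block M)"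
  have "transpose ?J ** (\<Sum>i\<in>I. c i *\<^sub>R Y i) ** ?J = (\<Sum>i\<in>I. c i *\<^sub>R (transpose ?J ** Y i ** ?J))"
    using assms(2) by (induction I rule: finite_induct)
      (simp_all add: matrix_distribs scaleR_matrix_mult_left scaleR_matrix_mult_right)
  moreover have "?T = (\<Sum>i\<in>I. c i *\<^sub>R ?T)" by (simp add: assms(1) flip: scaleR_sum_left)
  ultimately show ?thesis unfolding pull_back_def scaleR_right_distrib sum.distrib by metis
qed

section \<open>Symplectic maps and winding numbers\<close>

definition vertical_space :: "'n::finite phase set" where "vertical_space = {v. fst v = 0}"

lemma vertical_space_Lag: "vertical_space \<in> Lag"
proof (rule LagI)
  show "std_form v w = 0" if "v \<in> vertical_space" "w \<in> vertical_space" for v w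
    using that by (auto simp: vertical_space_def std_form_def)
  show "v \<in> vertical_space" if *: "\<And>w. w \<in> vertical_space \<Longrightarrow> std_form v w = 0" for v :: "'a phase"
    using *[of "(0, fst v)"] by (simp add: vertical_space_def std_form_def)
qed

definition rotation :: "complex ^ 'n ^ 'n \<Rightarrow> 'n::finite phase \<Rightarrow> 'n phase" where
  "rotation u v = phase_of_complex (u *v complex_of_phase v)"

lemma complex_of_phase_rotation [simp]: "complex_of_phase (rotation u v) = u *v complex_of_phase v"
  by (simp add: rotation_def)

lemma std_form_inner: "std_form v w = complex_of_phase v \<bullet> (\<i> *s complex_of_phase w)"
  by (simp add: std_form_Im complex_vec_inner)

text \<open>A unitary matrix preserves the real inner product and commutes with multiplication by
  \<open>i\<close>, and the symplectic form is built from these two.\<close>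

lemma symplectic_map_rotation: assumes "u \<in> unitary_matrices" shows "symplectic_map (rotation u)"
proof -
  have "linear (phase_of_complex \<circ> (\<lambda>z. u *v z) \<circ> complex_of_phase)"
    by (intro linear_compose linear_phase_of_complex linear_complex_of_phase matrix_vector_mul_linear)
  moreover have "(u *v x) \<bullet> (u *v y) = x \<bullet> y" for x y
    by (simp add: complex_matrix_adjoint matrix_vector_mul_assoc unitaryD(1)[OF assms])
  moreover have "rotation u = phase_of_complex \<circ> (\<lambda>z. u *v z) \<circ> complex_of_phase"
    by (simp add: fun_eq_iff rotation_def)
  ultimately show ?thesis
    by (simp add: symplectic_map_def std_form_inner flip: vector_scalar_commute)
qed

lemma symplectic_map_comp: "symplectic_map M \<Longrightarrow> symplectic_map N \<Longrightarrow> symplectic_map (M \<circ> N)"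
  unfolding symplectic_map_def by (auto intro: linear_compose)

lemma rotation_unitary_image: "rotation u ` unitary_image v = unitary_image (u ** v)"
proof -
  have "y \<in> rotation u ` unitary_image v \<longleftrightarrow> y \<in> unitary_image (u ** v)" for y
  proof
    assume "y \<in> rotation u ` unitary_image v"
    then obtain x where "y = rotation u x" "x \<in> unitary_image v" by blast
    then show "y \<in> unitary_image (u ** v)"
      unfolding mem_unitary_image by (metis complex_of_phase_rotation matrix_vector_mul_assoc)
  next
    assume "y \<in> unitary_image (u ** v)"
    then obtain x where "complex_of_phase y = (u ** v) *v cvec x" by (auto simp: mem_unitary_image)
    then have "y = rotation u (phase_of_complex (v *v cvec x))"
      by (metis complex_of_phase_inject complex_of_phase_of_complex complex_of_phase_rotation matrix_vector_mul_assoc)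
    moreover have "phase_of_complex (v *v cvec x) \<in> unitary_image v" by (auto simp: mem_unitary_image)
    ultimately show "y \<in> rotation u ` unitary_image v" by blast
  qed
  then show ?thesis by blast
qed

lemma rotation_mult: "rotation u (rotation v x) = rotation (u ** v) x"
  by (simp add: rotation_def matrix_vector_mul_assoc)

lemma rotation_1 [simp]: "rotation (mat 1) x = x" by (simp add: rotation_def)

lemma lag_matrix_rotation:
  assumes "u \<in> unitary_matrices" "W \<in> Lag"
  shows "lag_matrix (rotation u ` W) = u ** lag_matrix W ** transpose u"
proof -
  obtain v where v: "v \<in> unitary_matrices" "unitary_image v = W" using Lag_unitary_image[OF assms(2)] .
  show ?thesis
    unfolding v(2)[symmetric] rotation_unitary_image lag_matrix_unitary_image[OF v(1)]
      lag_matrix_unitary_image[OF unitary_mult[OF assms(1) v(1)]]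
    by (simp add: matrix_transpose_mul matrix_mul_assoc)
qed

text \<open>The unitary group is transitive on Lagrangian subspaces, so a rotation brings the image
  of the vertical subspace back; what remains of \<open>M\<close> is a vertical map.\<close>

lemma symplectic_map_decompose:
  fixes M :: "'n::finite phase \<Rightarrow> 'n phase"
  assumes M: "symplectic_map M"
  obtains u N where "u \<in> unitary_matrices" "vertical_map N" "M = rotation u \<circ> N"
proof -
  obtain v :: "complex ^ 'n ^ 'n" where v: "v \<in> unitary_matrices" "unitary_image v = vertical_space"
    using Lag_unitary_image[OF vertical_space_Lag] .
  obtain w where w: "w \<in> unitary_matrices" "unitary_image w = M ` vertical_space"
    using Lag_unitary_image[OF symplectic_map_Lag[OF M vertical_space_Lag]] .
  define v' w' where "v' = transpose (map_matrix cnj v)" and "w' = transpose (map_matrix cnj w)"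
  have vw': "v' \<in> unitary_matrices" "w' \<in> unitary_matrices" "v' ** v = mat 1" "w ** w' = mat 1" "w' ** w = mat 1"
    using unitaryD[OF v(1)] unitaryD[OF w(1)]
    by (auto simp: v'_def w'_def unitary_matrices_def map_matrix_cnj_transpose)
  define N where "N = rotation (v ** w') \<circ> M"
  show thesis
  proof
    show "w ** v' \<in> unitary_matrices" using unitary_mult w vw' by blast
    show "M = rotation (w ** v') \<circ> N"
    proof
      fix x
      have "w ** v' ** (v ** w') = w ** (v' ** v) ** w'" by (simp add: matrix_mul_assoc)
      then show "M x = (rotation (w ** v') \<circ> N) x"
        unfolding N_def by (simp add: rotation_mult vw')
    qed
    have "N ` vertical_space = unitary_image (v ** w' ** w)"
      unfolding N_def image_comp[symmetric] w(2)[symmetric] rotation_unitary_image ..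
    also have "\<dots> = vertical_space" using v(2) by (simp add: vw' flip: matrix_mul_assoc)
    finally have "N (0, b) \<in> vertical_space" for b by (auto simp: vertical_space_def)
    moreover have "symplectic_map N"
      unfolding N_def by (intro symplectic_map_comp symplectic_map_rotation unitary_mult v vw' M)
    ultimately show "vertical_map N" by (auto simp: vertical_map_def vertical_space_def)
  qed
qed

text \<open>The unitary factor of \<open>M\<close> multiplies \<open>Det2\<close> by the constant
  \<open>(det u)^2\<close>, and the vertical factor replaces the standard structure by its
  pull-back.\<close>

lemma det_lag_matrix_symplectic_image:
  fixes M :: "'n::finite phase \<Rightarrow> 'n phase"
  assumes M: "symplectic_map M"
  obtains k Y where "k \<noteq> 0" "accretive Y"
    "\<And>W. W \<in> Lag \<Longrightarrow> \<exists>r>0. det (lag_matrix (M ` W)) = k * of_real r * twisted_det2 Y (lag_matrix W)"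
proof -
  obtain u N where u: "u \<in> unitary_matrices" and N: "vertical_map N" and MN: "M = rotation u \<circ> N"
    using symplectic_map_decompose[OF M] .
  show thesis
  proof
    show "(det u)\<^sup>2 \<noteq> 0" using unitary_det_nz[OF u] by simp
    show "accretive (pull_back N (mat 1))" by (rule accretive_pull_back[OF N accretive_mat_1])
    fix W :: "'n phase set" assume W: "W \<in> Lag"
    have NW: "N ` W \<in> Lag" using symplectic_map_Lag W N unfolding vertical_map_def by blast
    obtain r where r: "0 < r"
      "twisted_det2 (mat 1) (lag_matrix (N ` W)) = of_real r * twisted_det2 (pull_back N (mat 1)) (lag_matrix W)"
      using twisted_det2_pull_back[OF N W] .
    have "det (lag_matrix (M ` W)) = (det u)\<^sup>2 * det (lag_matrix (N ` W))"
      unfolding MN image_comp[symmetric] lag_matrix_rotation[OF u NW] by (simp add: det_mul power2_eq_square)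
    also have "det (lag_matrix (N ` W)) = of_real (r / 4 ^ CARD('n)) * twisted_det2 (pull_back N (mat 1)) (lag_matrix W)"
      using r(2) twisted_det2_mat_1[OF unitary_det_nz[OF lag_matrix_unitary[OF NW]]] by (simp add: field_simps)
    finally show "\<exists>r>0. det (lag_matrix (M ` W)) =
        (det u)\<^sup>2 * of_real r * twisted_det2 (pull_back N (mat 1)) (lag_matrix W)"
      using r(1) by (intro exI[of _ "r / 4 ^ CARD('n)"]) simp
  qed
qed

section \<open>Winding numbers and continuity in the Grassmannian\<close>

lemma winding_number_homotopy:
  assumes h: "continuous_on ({0..1} \<times> {0..1}) h" and nz: "\<And>s t. s \<in> {0..1} \<Longrightarrow> t \<in> {0..1} \<Longrightarrow> h (s, t) \<noteq> z"
    and l: "\<And>s. s \<in> {0..1} \<Longrightarrow> h (s, 0) = h (s, 1 :: real)"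
  shows "winding_number (\<lambda>t. h (0 :: real, t)) z = winding_number (\<lambda>t. h (1, t)) z"
proof (rule winding_number_homotopic_loops)
  show "homotopic_loops (- {z}) (\<lambda>t. h (0, t)) (\<lambda>t. h (1, t))"
    unfolding homotopic_loops
  proof (intro exI[of _ h] conjI ballI)
    show "h \<in> {0..1} \<times> {0..1} \<rightarrow> - {z}" using nz by (intro Pi_I) (auto simp del: atLeastAtMost_iff)
  qed (use h l in \<open>auto simp: pathstart_def pathfinish_def\<close>)
qed

lemma winding_number_positive_multiple:
  assumes p: "continuous_on {0..1} p" "p 0 = p 1" and q: "continuous_on {0..1} q" "q 0 = q 1"
    and nz: "\<And>t. t \<in> {0..1} \<Longrightarrow> q t \<noteq> 0" and k: "k \<noteq> 0"
    and r: "\<And>t. t \<in> {0..1} \<Longrightarrow> \<exists>r>0. p t = k * of_real r * q t"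
  shows "winding_number p 0 = winding_number q 0"
proof -
  obtain c where c: "k = exp c" using k by (metis exp_Ln)
  \<comment> \<open>The constant \<open>k\<close> is rotated in through its logarithm, while the
    second factor moves along the segment from \<open>q t\<close> to \<open>p t / k\<close>; both
    ends lie on one ray from the origin, so 0 is avoided.\<close>
  let ?h = "\<lambda>(s, t). exp (of_real s * c) * (of_real (1 - s) * q t + of_real s * (p t / k))"
  have "continuous_on ({0..1} \<times> {0..1}) ?h"
    unfolding case_prod_unfold using k
    by (intro continuous_intros continuous_on_compose2[OF p(1)] continuous_on_compose2[OF q(1)]) auto
  moreover have "?h (s, t) \<noteq> 0" if st: "s \<in> {0..1}" "t \<in> {0..1}" for s t
  proof -
    obtain r where r: "r > 0" "p t = k * of_real r * q t" using r[OF st(2)] by blast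
    have "of_real (1 - s) * q t + of_real s * (p t / k) = of_real ((1 - s) + s * r) * q t"
      using k by (simp add: r(2) algebra_simps)
    moreover have "(1 - s) + s * r > 0"
      using st(1) r(1) by (cases "s = 0") (auto intro!: add_nonneg_pos)
    ultimately show ?thesis using nz[OF st(2)] by (metis (no_types, lifting) case_prod_conv exp_not_eq_zero less_irrefl mult_eq_0_iff of_real_eq_0_iff)
  qed
  ultimately have "winding_number (\<lambda>t. ?h (0, t)) 0 = winding_number (\<lambda>t. ?h (1, t)) 0"
    by (rule winding_number_homotopy) (simp_all only: prod.case p(2) q(2))
  moreover have "(\<lambda>t. ?h (1, t)) = p" using k by (simp add: c exp_not_eq_zero)
  ultimately show ?thesis by simp
qed

lemma continuous_on_twisted_det2:
  assumes "continuous_on S Y" "continuous_on S w" "\<And>x. x \<in> S \<Longrightarrow> det (w x) \<noteq> 0"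
  shows "continuous_on S (\<lambda>x. twisted_det2 (Y x) (w x))"
  using assms unfolding continuous_on_def by (auto intro!: tendsto_intros)

lemma eventually_atin_topspace: "\<forall>\<^sub>F y in atin X x. y \<in> topspace X"
  by (cases "x \<in> topspace X") (auto simp: eventually_atin)

lemma continuous_map_tendsto:
  "continuous_map X euclidean f \<longleftrightarrow> (\<forall>x\<in>topspace X. (f \<longlongrightarrow> f x) (atin X x))"
  by (simp add: continuous_map_atin)

text \<open>By the fractional linear formula, \<open>lag_matrix\<close> of the image is a quotient
  of matrices built from \<open>lag_matrix\<close> and the blocks. The entries of the blocks are
  coordinates of images of basis vectors, so pointwise continuity of \<open>M\<close> is
  enough.\<close>

lemma continuous_map_Lag_image:
  fixes M :: "'a \<Rightarrow> 'n::finite phase \<Rightarrow> 'n phase"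
  assumes M: "\<And>x. x \<in> topspace X \<Longrightarrow> vertical_map (M x)" "\<And>v. continuous_map X euclidean (\<lambda>x. M x v)"
    and W: "continuous_map X Lag_topology W"
  shows "continuous_map X Lag_topology (\<lambda>x. M x ` W x)"
proof (rule continuous_map_into_Lag_topology)
  have Lag: "W x \<in> Lag" if "x \<in> topspace X" for x using W that by (auto simp: continuous_map_def)
  show "M x ` W x \<in> Lag" if "x \<in> topspace X" for x
    using symplectic_map_Lag[OF _ Lag[OF that]] M(1)[OF that] by (simp add: vertical_map_def)
  show "continuous_map X euclidean (\<lambda>x. lag_matrix (M x ` W x))"
    unfolding continuous_map_tendsto
  proof
    fix x assume x: "x \<in> topspace X"
    have Mv: "((\<lambda>x. M x v) \<longlongrightarrow> M x v) (atin X x)" for v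
      using M(2) x unfolding continuous_map_tendsto by blast
    have w: "((\<lambda>x. lag_matrix (W x)) \<longlongrightarrow> lag_matrix (W x)) (atin X x)"
      using continuous_map_compose[OF W continuous_map_lag_matrix] x unfolding continuous_map_tendsto o_def by blast
    have blocks: "((\<lambda>x. base_block (M x)) \<longlongrightarrow> base_block (M x)) (atin X x)"
      "((\<lambda>x. shear_block (M x)) \<longlongrightarrow> shear_block (M x)) (atin X x)"
      "((\<lambda>x. fibre_block (M x)) \<longlongrightarrow> fibre_block (M x)) (atin X x)"
      unfolding base_block_def shear_block_def fibre_block_def matrix_def by (intro tendsto_intros Mv)+
    show "((\<lambda>x. lag_matrix (M x ` W x)) \<longlongrightarrow> lag_matrix (M x ` W x)) (atin X x)"
    proof (rule tendsto_matrix_quotient)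
      show "((\<lambda>t. action_denominator (M t) (lag_matrix (W t))) \<longlongrightarrow> action_denominator (M x) (lag_matrix (W x))) (atin X x)"
        "((\<lambda>t. action_numerator (M t) (lag_matrix (W t))) \<longlongrightarrow> action_numerator (M x) (lag_matrix (W x))) (atin X x)"
        unfolding action_denominator_def action_numerator_def by (intro tendsto_intros w blocks)+
      show "\<forall>\<^sub>F t in atin X x. lag_matrix (M t ` W t) ** action_denominator (M t) (lag_matrix (W t)) =
          action_numerator (M t) (lag_matrix (W t)) \<and> det (action_denominator (M t) (lag_matrix (W t))) \<noteq> 0"
        by (rule eventually_mono[OF eventually_atin_topspace]) (intro conjI lag_matrix_image M(1) Lag)
    qed (rule lag_matrix_image[OF M(1)[OF x] Lag[OF x]])+
  qed
qed

text \<open>\<open>M\<close> stands for any symplectic identification of a fibre with the standard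
  space and \<open>Y\<close> for the glued structure. The two loops are compared through the
  structure \<open>Z\<close> that \<open>M\<close> induces from the standard one.\<close>

lemma winding_number_Det2_symplectic:
  fixes M :: "'n::finite phase \<Rightarrow> 'n phase"
  assumes M: "symplectic_map M" and Y: "accretive Y"
    and \<alpha>: "pathin Lag_topology \<alpha>" "\<alpha> 0 = \<alpha> 1"
  shows "winding_number (Det2 \<circ> (\<lambda>t. M ` \<alpha> t)) 0 = winding_number (\<lambda>t. sgn (twisted_det2 Y (lag_matrix (\<alpha> t)))) 0"
    (is "winding_number ?p 0 = winding_number ?q 0")
proof -
  have Lag: "\<alpha> t \<in> Lag" if "t \<in> {0..1}" for t
    using \<alpha>(1) that by (auto simp: pathin_def continuous_map_def)
  let ?w = "\<lambda>t. lag_matrix (\<alpha> t)"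
  have w: "continuous_on {0..1} ?w"
    using continuous_map_compose[OF \<alpha>(1)[unfolded pathin_def] continuous_map_lag_matrix]
    by (simp add: o_def)
  have wu: "?w t \<in> unitary_matrices" if "t \<in> {0..1}" for t using lag_matrix_unitary Lag that by blast
  obtain k Z where k: "k \<noteq> 0" and Z: "accretive Z" and
    r: "\<And>W. W \<in> Lag \<Longrightarrow> \<exists>r>0. det (lag_matrix (M ` W)) = k * of_real r * twisted_det2 Z (lag_matrix W)"
    using det_lag_matrix_symplectic_image[OF M] by blast
  have pt: "?p t = det (lag_matrix (M ` \<alpha> t))" if "t \<in> {0..1}" for t
    using Det2_eq_det_lag_matrix[OF symplectic_map_Lag[OF M Lag[OF that]]] by simp
  \<comment> \<open>The segment from \<open>Z\<close> to \<open>Y\<close> stays in the convex set of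
    accretive matrices, on which the twisted determinant has no zeros.\<close>
  let ?h = "\<lambda>(s, t). twisted_det2 ((1 - s) *\<^sub>R Z + s *\<^sub>R Y) (?w t)"
  have acc: "accretive ((1 - s) *\<^sub>R Z + s *\<^sub>R Y)" if "s \<in> {0..1}" for s
    unfolding accretive_def
  proof (intro allI impI)
    fix a :: "complex ^ 'n" assume "a \<noteq> 0"
    then have "0 < a \<bullet> (Z *v a)" "0 < a \<bullet> (Y *v a)" using Y Z by (auto simp: accretive_def)
    then have "0 < (1 - s) * (a \<bullet> (Z *v a)) + s * (a \<bullet> (Y *v a))"
      using that by (cases "s = 0") (auto intro!: add_nonneg_pos)
    then show "0 < a \<bullet> (((1 - s) *\<^sub>R Z + s *\<^sub>R Y) *v a)"
      by (simp add: matrix_vector_mult_add_rdistrib scaleR_matrix_vector_mult inner_add_right)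
  qed
  have Qc: "continuous_on {0..1} (\<lambda>t. twisted_det2 X (?w t))" for X
    by (intro continuous_on_twisted_det2 continuous_intros w) (use wu unitary_det_nz in blast)
  have nz: "twisted_det2 X (?w t) \<noteq> 0" if "accretive X" "t \<in> {0..1}" for X t
    using twisted_det2_nz wu that by blast
  have "winding_number (\<lambda>t. ?h (0, t)) 0 = winding_number (\<lambda>t. ?h (1, t)) 0"
  proof (rule winding_number_homotopy)
    show "continuous_on ({0..1} \<times> {0..1}) ?h"
      unfolding case_prod_unfold
      by (intro continuous_on_twisted_det2 continuous_intros continuous_on_compose2[OF w])
         (use wu unitary_det_nz in force)+
  qed (use acc nz \<alpha>(2) in auto)
  then have h: "winding_number (\<lambda>t. twisted_det2 Z (?w t)) 0 = winding_number (\<lambda>t. twisted_det2 Y (?w t)) 0"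
    by simp
  let ?p' = "\<lambda>t. k * of_real (cmod (?p t / (k * twisted_det2 Z (?w t)))) * twisted_det2 Z (?w t)"
  have rr: "\<exists>r>0. ?p t = k * of_real r * twisted_det2 Z (?w t)" if "t \<in> {0..1}" for t
    using r[OF Lag[OF that]] pt[OF that] by metis
  \<comment> \<open>\<open>rr\<close> controls \<open>?p\<close> only pointwise, the positive factor
    depending on \<open>t\<close> in an unknown way; continuity is derived from the decomposition of
    \<open>M\<close>.\<close>
  have pc: "continuous_on {0..1} ?p"
  proof -
    obtain u N where u: "u \<in> unitary_matrices" and N: "vertical_map N" and MN: "M = rotation u \<circ> N"
      using symplectic_map_decompose[OF M] .
    have "continuous_map (top_of_set {0..1}) Lag_topology (\<lambda>t. N ` \<alpha> t)"
      by (rule continuous_map_Lag_image) (use N \<alpha>(1) in \<open>auto simp: pathin_def\<close>)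
    from continuous_map_compose[OF this continuous_map_lag_matrix]
    have "continuous_on {0..1} (\<lambda>t. lag_matrix (N ` \<alpha> t))" by (simp add: o_def)
    then have "continuous_on {0..1} (\<lambda>t. det (u ** lag_matrix (N ` \<alpha> t) ** transpose u))"
      unfolding continuous_on_def by (auto intro!: tendsto_intros)
    moreover have "det (u ** lag_matrix (N ` \<alpha> t) ** transpose u) = ?p t" if "t \<in> {0..1}" for t
    proof -
      have "N ` \<alpha> t \<in> Lag" using symplectic_map_Lag Lag[OF that] N unfolding vertical_map_def by blast
      from lag_matrix_rotation[OF u this] show ?thesis
        unfolding pt[OF that] unfolding MN image_comp[symmetric] by simp
    qed
    ultimately show ?thesis using continuous_on_cong by (metis (no_types, lifting))
  qed
  have p0: "?p 0 = ?p 1" using \<alpha>(2) by simp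
  have "winding_number ?p 0 = winding_number (\<lambda>t. twisted_det2 Z (?w t)) 0"
    by (rule winding_number_positive_multiple[OF pc p0 Qc _ _ k rr]) (use \<alpha>(2) nz[OF Z] in auto)
  moreover have "winding_number ?q 0 = winding_number (\<lambda>t. twisted_det2 Y (?w t)) 0"
  proof (rule winding_number_positive_multiple[where k=1])
    show "continuous_on {0..1} ?q" 
      unfolding sgn_div_norm divide_inverse
      by (intro continuous_intros Qc) (use nz[OF Y] in auto)
    show "\<exists>r>0. ?q t = 1 * of_real r * twisted_det2 Y (?w t)" if "t \<in> {0..1}" for t
      using nz[OF Y that] by (intro exI[of _ "inverse (cmod (twisted_det2 Y (?w t)))"])
        (simp add: sgn_div_norm scaleR_conv_of_real)
  qed (use \<alpha>(2) nz[OF Y] Qc in auto)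
  ultimately show ?thesis using h by simp
qed

section \<open>Symmetry of second derivatives\<close>

lemma smooth_onD:
  assumes "smooth_on S f"
  shows "x \<in> S \<Longrightarrow> f differentiable (at x)"
    and "continuous_on S (\<lambda>x. frechet_derivative f (at x) v)"
    and "x \<in> S \<Longrightarrow> (\<lambda>x. frechet_derivative f (at x) v) differentiable (at x)"
    and "continuous_on S (\<lambda>x. frechet_derivative (\<lambda>x. frechet_derivative f (at x) v) (at x) w)"
proof -
  have "Ck_on (Suc 0) S f" "Ck_on (Suc (Suc 0)) S f" using assms unfolding smooth_on_def by blast+
  then show "x \<in> S \<Longrightarrow> f differentiable (at x)"
    "continuous_on S (\<lambda>x. frechet_derivative f (at x) v)"
    "x \<in> S \<Longrightarrow> (\<lambda>x. frechet_derivative f (at x) v) differentiable (at x)"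
    "continuous_on S (\<lambda>x. frechet_derivative (\<lambda>x. frechet_derivative f (at x) v) (at x) w)"
    by auto
qed

text \<open>The mean value theorem in the direction \<open>u\<close> turns the second difference
  into a difference of first derivatives at points that differ by \<open>t v\<close>; linearizing
  this derivative at \<open>y\<close> leaves \<open>t^2 A v\<close>. The second difference is
  symmetric in \<open>u\<close> and \<open>v\<close>, whence the symmetry of second
  derivatives.\<close>

lemma second_difference_tendsto:
  fixes f :: "'a::euclidean_space \<Rightarrow> real"
  assumes S: "open S" "y \<in> S" and f: "\<And>x. x \<in> S \<Longrightarrow> f differentiable (at x)"
    and A: "((\<lambda>x. frechet_derivative f (at x) u) has_derivative A) (at y)"
  shows "((\<lambda>t. (f (y + t *\<^sub>R u + t *\<^sub>R v) - f (y + t *\<^sub>R u) - f (y + t *\<^sub>R v) + f y) / t\<^sup>2) \<longlongrightarrow> A v) (at_right 0)"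
proof -
  let ?F = "\<lambda>x. frechet_derivative f (at x) u"
  interpret A: bounded_linear A using A by (rule has_derivative_bounded_linear)
  have D: "(f has_derivative frechet_derivative f (at x)) (at x)" if "x \<in> S" for x
    using f[OF that] frechet_derivative_works by blast
  show ?thesis unfolding tendsto_iff
  proof (intro allI impI)
    fix e :: real assume "0 < e"
    \<comment> \<open>Chosen so that all displacements \<open>s u + t' v\<close> with
      \<open>s\<close> and \<open>t'\<close> in \<open>{0..t}\<close> have norm at most
      \<open>t * K / 2\<close>; the summand 1 keeps \<open>K\<close> positive.\<close>
    define K where "K = 2 * (norm u + norm v) + 1"
    have K: "K > 0" by (simp add: K_def add_nonneg_pos)
    \<comment> \<open>Two linearization errors of at most \<open>e' * (t * K / 2)\<close>, times the
      outer factor \<open>t\<close>, add up to at most \<open>t^2 * e / 2\<close>.\<close>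
    define e' where "e' = e / (2 * K)"
    have e': "e' > 0" using \<open>0 < e\<close> K by (simp add: e'_def)
    obtain d where d: "d > 0" "\<And>x. norm (x - y) < d \<Longrightarrow> norm (?F x - ?F y - A (x - y)) \<le> e' * norm (x - y)"
      using A e' unfolding has_derivative_at_alt by blast
    obtain r where r: "r > 0" "ball y r \<subseteq> S" using S open_contains_ball by blast
    define b where "b = min d r / K"
    have b: "b > 0" using d r K by (simp add: b_def)
    have "dist ((f (y + t *\<^sub>R u + t *\<^sub>R v) - f (y + t *\<^sub>R u) - f (y + t *\<^sub>R v) + f y) / t\<^sup>2) (A v) < e"
      if t: "0 < t" "t < b" for t
    proof -
      have small: "norm (s *\<^sub>R u + t' *\<^sub>R v) \<le> t * K / 2 \<and> norm (s *\<^sub>R u + t' *\<^sub>R v) < min d r"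
        if "0 \<le> s" "s \<le> t" "0 \<le> t'" "t' \<le> t" for s t'
      proof -
        have "norm (s *\<^sub>R u + t' *\<^sub>R v) \<le> s * norm u + t' * norm v"
          using norm_triangle_ineq[of "s *\<^sub>R u" "t' *\<^sub>R v"] that by simp
        also have "\<dots> \<le> t * norm u + t * norm v"
          using that by (intro add_mono mult_right_mono) auto
        also have "\<dots> \<le> t * K / 2" using t by (simp add: K_def algebra_simps)
        finally have 1: "norm (s *\<^sub>R u + t' *\<^sub>R v) \<le> t * K / 2" .
        also have "\<dots> < t * K" using t K by simp
        also have "\<dots> < min d r" using t K by (simp add: b_def field_simps)
        finally show ?thesis using 1 by simp
      qed
      have inS: "y + s *\<^sub>R u + t' *\<^sub>R v \<in> S" if "0 \<le> s" "s \<le> t" "0 \<le> t'" "t' \<le> t" for s t'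
      proof -
        have "dist y (y + s *\<^sub>R u + t' *\<^sub>R v) = norm (s *\<^sub>R u + t' *\<^sub>R v)"
          by (metis add.assoc add_diff_cancel_left' dist_commute dist_norm)
        then show ?thesis using small[OF that] r(2) by (intro subsetD[OF r(2)]) simp
      qed
      define g where "g = (\<lambda>s. f (y + s *\<^sub>R u + t *\<^sub>R v) - f (y + s *\<^sub>R u))"
      have der: "(g has_derivative (\<lambda>h. h * (?F (y + s *\<^sub>R u + t *\<^sub>R v) - ?F (y + s *\<^sub>R u)))) (at s within {0..t})"
        if s: "s \<in> {0..t}" for s
      proof -
        have 1: "((\<lambda>s. f (y + s *\<^sub>R u + t *\<^sub>R v)) has_derivative
            (\<lambda>h. frechet_derivative f (at (y + s *\<^sub>R u + t *\<^sub>R v)) (h *\<^sub>R u))) (at s within {0..t})"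
          by (rule has_derivative_compose[OF _ D]) (use inS[of s t] s t in \<open>auto intro!: derivative_eq_intros\<close>)
        have 2: "((\<lambda>s. f (y + s *\<^sub>R u)) has_derivative
            (\<lambda>h. frechet_derivative f (at (y + s *\<^sub>R u)) (h *\<^sub>R u))) (at s within {0..t})"
          by (rule has_derivative_compose[OF _ D]) (use inS[of s 0] s t in \<open>auto intro!: derivative_eq_intros\<close>)
        have l: "frechet_derivative f (at x) (h *\<^sub>R u) = h * ?F x" if "x \<in> S" for x h
          using linear_cmul[OF linear_frechet_derivative[OF f[OF that]], of h u] by simp
        from has_derivative_diff[OF 1 2] show ?thesis
          unfolding g_def using inS[of s t] inS[of s 0] s t by (simp add: l algebra_simps)
      qed
      have "\<exists>s\<in>{0<..<t}. g t - g 0 = (t - 0) * (?F (y + s *\<^sub>R u + t *\<^sub>R v) - ?F (y + s *\<^sub>R u))"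
        by (rule mvt_simple[OF t(1) der]) auto
      then obtain s where s: "0 < s" "s < t" "g t - g 0 = t * (?F (y + s *\<^sub>R u + t *\<^sub>R v) - ?F (y + s *\<^sub>R u))"
        by auto
      have n1: "norm (?F (y + s *\<^sub>R u + t *\<^sub>R v) - ?F y - A (s *\<^sub>R u + t *\<^sub>R v)) \<le> e' * (t * K / 2)"
      proof -
        have "norm (?F (y + s *\<^sub>R u + t *\<^sub>R v) - ?F y - A (s *\<^sub>R u + t *\<^sub>R v)) \<le> e' * norm (s *\<^sub>R u + t *\<^sub>R v)"
          using d(2)[of "y + s *\<^sub>R u + t *\<^sub>R v"] small[of s t] s t by (simp add: add.assoc)
        also have "\<dots> \<le> e' * (t * K / 2)" using small[of s t] s t e' by (intro mult_left_mono) auto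
        finally show ?thesis .
      qed
      have n2: "norm (?F (y + s *\<^sub>R u) - ?F y - A (s *\<^sub>R u)) \<le> e' * (t * K / 2)"
      proof -
        have "norm (?F (y + s *\<^sub>R u) - ?F y - A (s *\<^sub>R u)) \<le> e' * norm (s *\<^sub>R u)"
          using d(2)[of "y + s *\<^sub>R u"] small[of s 0] s t by simp
        also have "\<dots> \<le> e' * (t * K / 2)" using small[of s 0] s t e' by (intro mult_left_mono) auto
        finally show ?thesis .
      qed
      have "norm (?F (y + s *\<^sub>R u + t *\<^sub>R v) - ?F (y + s *\<^sub>R u) - t * A v) \<le> e' * (t * K)"
        using n1 n2 unfolding A.add A.scaleR real_norm_def real_scaleR_def by argo
      then have "norm (t * (?F (y + s *\<^sub>R u + t *\<^sub>R v) - ?F (y + s *\<^sub>R u) - t * A v)) \<le> t * (e' * (t * K))"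
        using t unfolding norm_mult by (intro mult_mono) auto
      moreover have "g t - g 0 - t\<^sup>2 * A v = t * (?F (y + s *\<^sub>R u + t *\<^sub>R v) - ?F (y + s *\<^sub>R u) - t * A v)"
        unfolding s(3) by (simp add: power2_eq_square algebra_simps)
      ultimately have "norm (g t - g 0 - t\<^sup>2 * A v) \<le> t * (e' * (t * K))" by (simp only:)
      also have "\<dots> = t\<^sup>2 * (e / 2)" using K by (simp add: e'_def power2_eq_square)
      finally have "norm (g t - g 0 - t\<^sup>2 * A v) \<le> t\<^sup>2 * (e / 2)" .
      then have "norm ((g t - g 0) / t\<^sup>2 - A v) \<le> e / 2"
        using t by (simp add: field_simps abs_le_iff)
      then show ?thesis using \<open>0 < e\<close> by (simp add: dist_norm g_def algebra_simps)
    qed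
    then show "\<forall>\<^sub>F t in at_right 0. dist ((f (y + t *\<^sub>R u + t *\<^sub>R v) - f (y + t *\<^sub>R u) - f (y + t *\<^sub>R v) + f y) / t\<^sup>2) (A v) < e"
      unfolding eventually_at_right_field using b by (intro exI[of _ b]) auto
  qed
qed

lemma second_derivative_symmetric_real:
  fixes f :: "'a::euclidean_space \<Rightarrow> real"
  assumes "open S" "y \<in> S" "\<And>x. x \<in> S \<Longrightarrow> f differentiable (at x)"
    and "((\<lambda>x. frechet_derivative f (at x) u) has_derivative A) (at y)"
    and "((\<lambda>x. frechet_derivative f (at x) v) has_derivative B) (at y)"
  shows "A v = B u"
proof (rule tendsto_unique)
  show "((\<lambda>t. (f (y + t *\<^sub>R u + t *\<^sub>R v) - f (y + t *\<^sub>R u) - f (y + t *\<^sub>R v) + f y) / t\<^sup>2) \<longlongrightarrow> A v) (at_right 0)"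
    by (rule second_difference_tendsto[OF assms(1-4)])
  show "((\<lambda>t. (f (y + t *\<^sub>R u + t *\<^sub>R v) - f (y + t *\<^sub>R u) - f (y + t *\<^sub>R v) + f y) / t\<^sup>2) \<longlongrightarrow> B u) (at_right 0)"
    using second_difference_tendsto[OF assms(1-3) assms(5), of u] by (simp add: algebra_simps)
qed simp

lemma second_derivative_symmetric:
  fixes f :: "'a::euclidean_space \<Rightarrow> 'b::euclidean_space"
  assumes S: "open S" "y \<in> S" and f: "\<And>x. x \<in> S \<Longrightarrow> f differentiable (at x)"
    and A: "((\<lambda>x. frechet_derivative f (at x) u) has_derivative A) (at y)"
    and B: "((\<lambda>x. frechet_derivative f (at x) v) has_derivative B) (at y)"
  shows "A v = B u"
proof (rule euclidean_eqI)
  fix i :: 'b assume "i \<in> Basis"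
  have D: "((\<lambda>x. f x \<bullet> i) has_derivative (\<lambda>h. frechet_derivative f (at x) h \<bullet> i)) (at x)" if "x \<in> S" for x
    using f[OF that] frechet_derivative_works by (intro has_derivative_inner_left) blast
  have eq: "frechet_derivative f (at x) w \<bullet> i = frechet_derivative (\<lambda>x. f x \<bullet> i) (at x) w" if "x \<in> S" for x w
    using frechet_derivative_at[OF D[OF that]] by metis
  have t: "((\<lambda>x. frechet_derivative (\<lambda>x. f x \<bullet> i) (at x) w) has_derivative (\<lambda>h. C h \<bullet> i)) (at y)"
    if "((\<lambda>x. frechet_derivative f (at x) w) has_derivative C) (at y)" for w C
    by (rule has_derivative_transform_within_open[OF has_derivative_inner_left[OF that] S]) (rule eq)
  show "A v \<bullet> i = B u \<bullet> i"
    by (rule second_derivative_symmetric_real[OF S _ t[OF A] t[OF B]]) (use D differentiable_def in blast)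
qed

section \<open>Charts and tangent vectors\<close>

lemma chart_open: assumes "is_chart X c" shows "openin X (fst c)" "fst c \<subseteq> topspace X"
  using assms openin_subset by (auto simp: is_chart_def)

lemma chart_topspace: assumes "is_chart X c" shows "topspace (subtopology X (fst c)) = fst c"
  using chart_open(2)[OF assms] by auto

lemma chart_inj: assumes "is_chart X c" shows "inj_on (snd c) (fst c)"
  using assms chart_topspace[OF assms] homeomorphic_imp_injective_map unfolding is_chart_def by metis

lemma chart_inv [simp]: assumes "is_chart X c" "p \<in> fst c" shows "inv_into (fst c) (snd c) (snd c p) = p"
  using inv_into_f_f[OF chart_inj[OF assms(1)] assms(2)] .

lemma chart_continuous: assumes "is_chart X c" shows "continuous_map (subtopology X (fst c)) euclidean (snd c)"
  using assms homeomorphic_imp_continuous_map continuous_map_in_subtopology unfolding is_chart_def by blast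

lemma chart_open_image:
  assumes c: "is_chart X c" and V: "openin X V" shows "open (snd c ` (fst c \<inter> V))"
proof -
  have "open_map (subtopology X (fst c)) (top_of_set (snd c ` fst c)) (snd c)"
    using c homeomorphic_imp_open_map unfolding is_chart_def by blast
  moreover have "openin (subtopology X (fst c)) (fst c \<inter> V)"
    using V by (metis inf_commute openin_subtopology)
  ultimately have "openin (top_of_set (snd c ` fst c)) (snd c ` (fst c \<inter> V))" by (simp add: open_map_def)
  then show ?thesis using c by (meson is_chart_def openin_open_trans)
qed

lemma chart_open_image2:
  assumes "is_chart X c" "is_chart X d" shows "open (snd c ` (fst c \<inter> fst d))"
  by (rule chart_open_image[OF assms(1) chart_open(1)[OF assms(2)]])

lemma transition_apply: assumes "is_chart X c" "p \<in> fst c" shows "transition c d (snd c p) = snd d p"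
  using assms by (simp add: transition_def)

text \<open>The regularity shared by the given atlas and the canonical atlas of the cotangent
  bundle, whose transitions contain first derivatives of those of the base. Tangent vectors are
  treated once for both.\<close>

definition C1_atlas :: "'a topology \<Rightarrow> ('a, 'e::euclidean_space) chart set \<Rightarrow> bool" where
  "C1_atlas X B \<longleftrightarrow> (\<forall>c\<in>B. is_chart X c) \<and>
     (\<forall>c\<in>B. \<forall>d\<in>B. \<forall>p\<in>fst c \<inter> fst d. transition c d differentiable (at (snd c p)))"

abbreviation tderiv :: "('a, 'e::euclidean_space) chart \<Rightarrow> ('a, 'e) chart \<Rightarrow> 'a \<Rightarrow> 'e \<Rightarrow> 'e" where
  "tderiv c d p \<equiv> frechet_derivative (transition c d) (at (snd c p))"

lemma smoothly_compatible_differentiable: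
  assumes "smoothly_compatible c d" "p \<in> fst c" "p \<in> fst d"
  shows "transition c d differentiable (at (snd c p))" "transition d c differentiable (at (snd d p))"
proof -
  have p: "p \<in> fst c \<inter> fst d" using assms by blast
  have "smooth_on (snd c ` (fst c \<inter> fst d)) (transition c d)" "smooth_on (snd d ` (fst c \<inter> fst d)) (transition d c)"
    using assms(1) unfolding smoothly_compatible_def by simp_all
  then show "transition c d differentiable (at (snd c p))" "transition d c differentiable (at (snd d p))"
    using smooth_onD(1)[OF _ imageI[OF p]] by (blast, blast)
qed

lemma C1_atlas_smooth_atlas: assumes "smooth_atlas X A" shows "C1_atlas X A"
  unfolding C1_atlas_def
proof (intro conjI ballI)
  fix c d p assume "c \<in> A" "d \<in> A" "p \<in> fst c \<inter> fst d"
  moreover from this have "smoothly_compatible c d" using assms by (simp add: smooth_atlas_def)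
  ultimately show "transition c d differentiable (at (snd c p))"
    using smoothly_compatible_differentiable(1) by (metis IntE)
qed (use assms in \<open>simp add: smooth_atlas_def\<close>)

lemma transition_has_derivative:
  assumes "transition c d differentiable (at (snd c p))"
  shows "(transition c d has_derivative tderiv c d p) (at (snd c p))"
  using assms frechet_derivative_works by blast

text \<open>Formulated for charts rather than for members of an atlas, so as to cover the charts
  adapted to \<open>L\<close> as well.\<close>

lemma transition_chain:
  assumes c: "is_chart X c" "is_chart X d" "is_chart X e" and p: "p \<in> fst c" "p \<in> fst d" "p \<in> fst e"
    and diff: "transition c d differentiable (at (snd c p))" "transition d e differentiable (at (snd d p))"
  shows "(transition c e has_derivative tderiv d e p \<circ> tderiv c d p) (at (snd c p))"
proof -
  let ?S = "snd c ` (fst c \<inter> (fst d \<inter> fst e))"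
  have S: "open ?S" by (intro chart_open_image[OF c(1)] openin_Int chart_open(1) c)
  have "(transition d e has_derivative tderiv d e p) (at (transition c d (snd c p)))"
    using transition_has_derivative[OF diff(2)] by (simp add: transition_apply[OF c(1) p(1)])
  from diff_chain_at[OF transition_has_derivative[OF diff(1)] this]
  show ?thesis
    by (rule has_derivative_transform_within_open[OF _ S]) (use p c in \<open>auto simp: transition_apply\<close>)
qed

lemma transition_self_has_derivative:
  assumes c: "is_chart X c" "p \<in> fst c" shows "(transition c c has_derivative id) (at (snd c p))"
proof -
  have "open (snd c ` fst c)" using c(1) by (simp add: is_chart_def)
  then show ?thesis
    by (rule has_derivative_transform_within_open[OF has_derivative_id[unfolded id_def[symmetric]]])
       (use c in \<open>auto simp: transition_apply\<close>)
qed

context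
  fixes X :: "'a topology" and B :: "('a, 'e::euclidean_space) chart set"
  assumes B: "C1_atlas X B"
begin

lemma atlas_chart: "c \<in> B \<Longrightarrow> is_chart X c"
  and atlas_differentiable: "c \<in> B \<Longrightarrow> d \<in> B \<Longrightarrow> p \<in> fst c \<Longrightarrow> p \<in> fst d \<Longrightarrow> transition c d differentiable (at (snd c p))"
  using B by (auto simp: C1_atlas_def)

lemma tderiv_chain:
  assumes "c \<in> B" "d \<in> B" "e \<in> B" "p \<in> fst c" "p \<in> fst d" "p \<in> fst e"
  shows "tderiv d e p (tderiv c d p v) = tderiv c e p v"
  using frechet_derivative_at[OF transition_chain[of X c d e p]] assms atlas_chart atlas_differentiable
  by (metis comp_apply)

lemma tderiv_self: assumes "c \<in> B" "p \<in> fst c" shows "tderiv c c p v = v"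
  using frechet_derivative_at[OF transition_self_has_derivative[OF atlas_chart[OF assms(1)] assms(2)]]
  by (metis id_apply)

lemma tderiv_inverse:
  assumes "c \<in> B" "d \<in> B" "p \<in> fst c" "p \<in> fst d" shows "tderiv d c p (tderiv c d p v) = v"
  using tderiv_chain[of c d c] tderiv_self assms by simp

lemma linear_tderiv:
  assumes "c \<in> B" "d \<in> B" "p \<in> fst c" "p \<in> fst d" shows "linear (tderiv c d p)"
  by (rule linear_frechet_derivative[OF atlas_differentiable[OF assms]])

lemma coordinate_tangent_apply:
  assumes "d \<in> B" "p \<in> fst d" shows "coordinate_tangent B p c a d = tderiv c d p a"
  using assms by (simp add: coordinate_tangent_def)

lemma coordinate_tangent_mem:
  assumes "c \<in> B" "p \<in> fst c" shows "coordinate_tangent B p c a \<in> tangent_space B p"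
  using assms tderiv_chain[of c] by (auto simp: tangent_space_def coordinate_tangent_def)

lemma coordinate_tangent_self:
  assumes "c \<in> B" "p \<in> fst c" shows "coordinate_tangent B p c a c = a"
  using assms tderiv_self by (simp add: coordinate_tangent_def)

lemma tangent_transform:
  assumes "v \<in> tangent_space B p" "c \<in> B" "p \<in> fst c" "d \<in> B" "p \<in> fst d" shows "v d = tderiv c d p (v c)"
  using assms unfolding tangent_space_def by blast

lemma tangent_eq_coordinate_tangent:
  assumes "v \<in> tangent_space B p" "c \<in> B" "p \<in> fst c" shows "coordinate_tangent B p c (v c) = v"
proof
  fix d
  show "coordinate_tangent B p c (v c) d = v d"
  proof (cases "d \<in> B \<and> p \<in> fst d")
    case True
    then show ?thesis using tangent_transform[OF assms(1-3), of d] by (simp add: coordinate_tangent_apply)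
  next
    case False
    then have "v d = 0" using assms(1) unfolding tangent_space_def by blast
    then show ?thesis using False by (auto simp: coordinate_tangent_def)
  qed
qed

lemma coordinate_tangent_add:
  assumes "c \<in> B" "p \<in> fst c"
  shows "coordinate_tangent B p c (a + b) = (\<lambda>d. coordinate_tangent B p c a d + coordinate_tangent B p c b d)"
  using linear_add[OF linear_tderiv[of c]] assms by (auto simp: coordinate_tangent_def fun_eq_iff)

lemma coordinate_tangent_scaleR:
  assumes "c \<in> B" "p \<in> fst c"
  shows "coordinate_tangent B p c (r *\<^sub>R a) = (\<lambda>d. r *\<^sub>R coordinate_tangent B p c a d)"
  using linear_cmul[OF linear_tderiv[of c]] assms by (auto simp: coordinate_tangent_def fun_eq_iff)

lemma tangent_space_add:
  assumes "v \<in> tangent_space B p" "w \<in> tangent_space B p" "c \<in> B" "p \<in> fst c"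
  shows "(\<lambda>d. v d + w d) \<in> tangent_space B p"
  using coordinate_tangent_mem[OF assms(3,4), of "v c + w c"]
  unfolding coordinate_tangent_add[OF assms(3,4)]
  using tangent_eq_coordinate_tangent[OF assms(1,3,4)] tangent_eq_coordinate_tangent[OF assms(2,3,4)] by simp

lemma tangent_space_scaleR:
  assumes "v \<in> tangent_space B p" "c \<in> B" "p \<in> fst c"
  shows "(\<lambda>d. r *\<^sub>R v d) \<in> tangent_space B p"
  using coordinate_tangent_mem[OF assms(2,3), of "r *\<^sub>R v c"]
  unfolding coordinate_tangent_scaleR[OF assms(2,3)]
  using tangent_eq_coordinate_tangent[OF assms(1,2,3)] by simp

end

lemma linear_axis_expansion: "linear f \<Longrightarrow> f a = (\<Sum>j\<in>UNIV. a $ j *\<^sub>R f (axis j 1))" for a :: "real ^ 'n"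
  by (metis (mono_tags, lifting) basis_expansion linear_cmul linear_sum scalar_mult_eq_scaleR sum.cong)

lemma has_derivative_vec_lambda:
  fixes f :: "'n::finite \<Rightarrow> 'a::real_normed_vector \<Rightarrow> real"
  assumes "\<And>j. (f j has_derivative f' j) F"
  shows "((\<lambda>x. \<chi> j. f j x) has_derivative (\<lambda>h. \<chi> j. f' j h)) F"
proof -
  have e: "(\<chi> j. g j) = (\<Sum>j\<in>UNIV. g j *\<^sub>R axis j (1::real))" for g :: "'n \<Rightarrow> real"
    by (simp add: vec_eq_iff axis_def if_distrib cong: if_cong)
  show ?thesis unfolding e by (intro derivative_intros assms)
qed

section \<open>Canonical coordinates of the cotangent bundle\<close>

locale smooth_base =
  fixes X :: "'a topology" and A :: "('a, real ^ 'n::finite) chart set"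
  assumes atlas: "smooth_atlas X A"
begin

lemma C1: "C1_atlas X A" by (rule C1_atlas_smooth_atlas[OF atlas])

lemmas base_chart = atlas_chart[OF C1]

text \<open>The covector with components \<open>\<eta>\<close> in the chart \<open>c\<close>. The
  value 0 off the tangent space is the convention of \<open>cotangent_space\<close>, which makes the
  components determine the covector.\<close>

definition covector :: "('a, real ^ 'n) chart \<Rightarrow> 'a \<Rightarrow> real ^ 'n \<Rightarrow> ('a, 'n) covector" where
  "covector c x \<eta> = (\<lambda>v. if v \<in> tangent_space A x then \<eta> \<bullet> v c else 0)"

abbreviation hat where "hat c \<equiv> cotangent_chart A c"

lemma covector_mem:
  assumes "c \<in> A" "x \<in> fst c" shows "covector c x \<eta> \<in> cotangent_space A x"
  using tangent_space_add[OF C1 _ _ assms] tangent_space_scaleR[OF C1 _ assms]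
  by (auto simp: cotangent_space_def covector_def inner_add_right)

lemma covector_eq:
  assumes c: "c \<in> A" "x \<in> fst c" and \<xi>: "\<xi> \<in> cotangent_space A x"
  shows "covector c x (\<chi> j. \<xi> (coordinate_tangent A x c (axis j 1))) = \<xi>"
proof
  fix v
  show "covector c x (\<chi> j. \<xi> (coordinate_tangent A x c (axis j 1))) v = \<xi> v"
  proof (cases "v \<in> tangent_space A x")
    case True
    have "linear (\<lambda>a. \<xi> (coordinate_tangent A x c a))"
      using \<xi> coordinate_tangent_mem[OF C1 c]
      by (intro linearI) (simp_all add: coordinate_tangent_add[OF C1 c] coordinate_tangent_scaleR[OF C1 c] cotangent_space_def)
    from linear_axis_expansion[OF this, of "v c"]
    have "\<xi> v = (\<Sum>j\<in>UNIV. v c $ j * \<xi> (coordinate_tangent A x c (axis j 1)))"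
      using tangent_eq_coordinate_tangent[OF C1 True c] by simp
    then show ?thesis using True by (simp add: covector_def inner_vec_def mult.commute)
  next
    case False then show ?thesis using \<xi> by (simp add: covector_def cotangent_space_def)
  qed
qed

lemma fst_hat: "fst (hat c) = {\<nu> \<in> cotangent_bundle A. fst \<nu> \<in> fst c}"
  by (simp add: cotangent_chart_def)

lemma snd_hat: "snd (hat c) \<nu> = (snd c (fst \<nu>), \<chi> j. snd \<nu> (coordinate_tangent A (fst \<nu>) c (axis j 1)))"
  by (simp add: cotangent_chart_def)

lemma fst_snd_hat [simp]: "fst (snd (hat c) \<nu>) = snd c (fst \<nu>)" by (simp add: snd_hat)

lemma covector_point_mem:
  assumes "c \<in> A" "x \<in> fst c" "d \<in> A" "x \<in> fst d" shows "(x, covector c x \<eta>) \<in> fst (hat d)"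
  using assms covector_mem[OF assms(1,2)] by (auto simp: fst_hat cotangent_bundle_def)

lemma hat_covector_other:
  assumes c: "c \<in> A" "x \<in> fst c" and d: "d \<in> A" "x \<in> fst d"
  shows "snd (hat d) (x, covector c x \<eta>) = (snd d x, \<chi> j. \<eta> \<bullet> tderiv d c x (axis j 1))"
  using coordinate_tangent_mem[OF C1 d] c
  by (simp add: snd_hat covector_def coordinate_tangent_apply[OF C1])

lemma hat_covector:
  assumes c: "c \<in> A" "x \<in> fst c" shows "snd (hat c) (x, covector c x \<eta>) = (snd c x, \<eta>)"
  unfolding hat_covector_other[OF c c] by (simp add: tderiv_self[OF C1 c] inner_axis vec_eq_iff)

lemma point_eq_covector:
  assumes "c \<in> A" "\<nu> \<in> fst (hat c)" shows "\<nu> = (fst \<nu>, covector c (fst \<nu>) (snd (snd (hat c) \<nu>)))"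
  using covector_eq[of c "fst \<nu>" "snd \<nu>"] assms
  by (cases \<nu>) (simp add: fst_hat snd_hat cotangent_bundle_def)

lemma hat_inj: assumes c: "c \<in> A" shows "inj_on (snd (hat c)) (fst (hat c))"
proof (rule inj_onI)
  fix \<nu> \<nu>' assume *: "\<nu> \<in> fst (hat c)" "\<nu>' \<in> fst (hat c)" "snd (hat c) \<nu> = snd (hat c) \<nu>'"
  have "fst \<nu> = fst \<nu>'"
    using * chart_inj[OF base_chart[OF c]] by (auto simp: fst_hat snd_hat inj_on_def)
  then show "\<nu> = \<nu>'" using point_eq_covector[OF c] * by metis
qed

lemma hat_image: assumes c: "c \<in> A" "d \<in> A"
  shows "snd (hat c) ` (fst (hat c) \<inter> fst (hat d)) = snd c ` (fst c \<inter> fst d) \<times> UNIV"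
proof
  show "snd (hat c) ` (fst (hat c) \<inter> fst (hat d)) \<subseteq> snd c ` (fst c \<inter> fst d) \<times> UNIV"
    by (auto simp: fst_hat snd_hat)
  show "snd c ` (fst c \<inter> fst d) \<times> UNIV \<subseteq> snd (hat c) ` (fst (hat c) \<inter> fst (hat d))"
  proof
    fix z assume "z \<in> snd c ` (fst c \<inter> fst d) \<times> (UNIV :: (real ^ 'n) set)"
    then obtain x \<eta> where x: "x \<in> fst c" "x \<in> fst d" "z = (snd c x, \<eta>)" by auto
    then have "z = snd (hat c) (x, covector c x \<eta>)" using hat_covector[OF c(1)] by simp
    then show "z \<in> snd (hat c) ` (fst (hat c) \<inter> fst (hat d))"
      using covector_point_mem x c by blast
  qed
qed

lemma inv_hat: assumes "c \<in> A" "x \<in> fst c"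
  shows "inv_into (fst (hat c)) (snd (hat c)) (snd c x, \<eta>) = (x, covector c x \<eta>)"
  using inv_into_f_f[OF hat_inj[OF assms(1)] covector_point_mem[OF assms assms]] hat_covector[OF assms] by simp

lemma transition_hat: assumes "c \<in> A" "x \<in> fst c" "d \<in> A" "x \<in> fst d"
  shows "transition (hat c) (hat d) (snd c x, \<eta>) = (snd d x, \<chi> j. \<eta> \<bullet> tderiv d c x (axis j 1))"
  by (simp add: transition_def inv_hat assms hat_covector_other)

lemma smooth_transition: assumes "c \<in> A" "d \<in> A"
  shows "smooth_on (snd c ` (fst c \<inter> fst d)) (transition c d)"
  using atlas assms by (auto simp: smooth_atlas_def smoothly_compatible_def)

abbreviation second_deriv where
  "second_deriv c d x v w \<equiv> frechet_derivative (\<lambda>z. frechet_derivative (transition c d) (at z) v) (at (snd c x)) w"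

lemma second_deriv_has_derivative:
  assumes "c \<in> A" "x \<in> fst c" "d \<in> A" "x \<in> fst d"
  shows "((\<lambda>z. frechet_derivative (transition c d) (at z) v) has_derivative second_deriv c d x v) (at (snd c x))"
  unfolding frechet_derivative_works[symmetric]
  by (rule smooth_onD(3)[OF smooth_transition[OF assms(1,3)]]) (use assms in blast)

lemma second_deriv_symmetric:
  assumes c: "c \<in> A" "x \<in> fst c" "d \<in> A" "x \<in> fst d"
  shows "second_deriv c d x v w = second_deriv c d x w v"
proof (rule second_derivative_symmetric[OF _ _ _ second_deriv_has_derivative[OF c] second_deriv_has_derivative[OF c]])
  show "open (snd c ` (fst c \<inter> fst d))" by (rule chart_open_image2[OF base_chart[OF c(1)] base_chart[OF c(3)]])
  show "\<And>z. z \<in> snd c ` (fst c \<inter> fst d) \<Longrightarrow> transition c d differentiable at z"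
    by (rule smooth_onD(1)[OF smooth_transition[OF c(1,3)]])
qed (use c in auto)

text \<open>Linearity in the second slot belongs to the derivative; in the first slot it is
  inherited through symmetry.\<close>

lemma second_deriv_expand:
  assumes c: "c \<in> A" "x \<in> fst c" "d \<in> A" "x \<in> fst d"
  shows "(\<Sum>j\<in>UNIV. u $ j *\<^sub>R second_deriv c d x (axis j 1) w) = second_deriv c d x u w"
    "(\<Sum>k\<in>UNIV. w $ k *\<^sub>R second_deriv c d x u (axis k 1)) = second_deriv c d x u w"
proof -
  show 2: "(\<Sum>k\<in>UNIV. w $ k *\<^sub>R second_deriv c d x u (axis k 1)) = second_deriv c d x u w" for u w
    by (rule linear_axis_expansion[OF has_derivative_linear[OF second_deriv_has_derivative[OF c]], symmetric])
  show "(\<Sum>j\<in>UNIV. u $ j *\<^sub>R second_deriv c d x (axis j 1) w) = second_deriv c d x u w"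
  proof -
    have e: "second_deriv c d x (axis j 1) w = second_deriv c d x w (axis j 1)" for j
      by (rule second_deriv_symmetric[OF c])
    show ?thesis unfolding e 2 by (rule second_deriv_symmetric[OF c])
  qed
qed

text \<open>The derivative of the transition formula at base point \<open>x\<close> and momentum
  \<open>\<eta>\<close>. The second summand of the momentum part is the shear: it differentiates the
  coefficients with which \<open>\<eta>\<close> is transformed.\<close>

definition hat_deriv where
  "hat_deriv c d x \<eta> = (\<lambda>v. (tderiv c d x (fst v), \<chi> j. snd v \<bullet> tderiv d c x (axis j 1) +
      \<eta> \<bullet> second_deriv d c x (axis j 1) (tderiv c d x (fst v))))"

lemma transition_hat_has_derivative:
  assumes c: "c \<in> A" "x \<in> fst c" and d: "d \<in> A" "x \<in> fst d"
  shows "(transition (hat c) (hat d) has_derivative hat_deriv c d x \<eta>) (at (snd c x, \<eta>))"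
proof -
  let ?\<tau> = "transition c d" and ?\<sigma> = "\<lambda>j z. frechet_derivative (transition d c) (at z) (axis j 1)"
  have \<tau>: "?\<tau> (snd c x) = snd d x" by (rule transition_apply[OF base_chart[OF c(1)] c(2)])
  have "((\<lambda>v. ?\<tau> (fst v)) has_derivative (\<lambda>v. tderiv c d x (fst v))) (at (snd c x, \<eta>))"
    by (rule has_derivative_compose[OF has_derivative_fst[OF has_derivative_ident]])
       (simp add: transition_has_derivative atlas_differentiable[OF C1] c d)
  moreover have "((\<lambda>v. \<chi> j. snd v \<bullet> ?\<sigma> j (?\<tau> (fst v))) has_derivative
      (\<lambda>v. \<chi> j. \<eta> \<bullet> second_deriv d c x (axis j 1) (tderiv c d x (fst v)) + snd v \<bullet> ?\<sigma> j (?\<tau> (snd c x)))) (at (snd c x, \<eta>))"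
  proof (rule has_derivative_vec_lambda)
    fix j
    have "((\<lambda>v. ?\<sigma> j (?\<tau> (fst v))) has_derivative (\<lambda>v. second_deriv d c x (axis j 1) (tderiv c d x (fst v)))) (at (snd c x, \<eta>))"
      by (rule has_derivative_compose[OF calculation]) (simp add: \<tau> second_deriv_has_derivative c d)
    from has_derivative_inner[OF has_derivative_snd[OF has_derivative_ident] this]
    show "((\<lambda>v. snd v \<bullet> ?\<sigma> j (?\<tau> (fst v))) has_derivative
      (\<lambda>v. \<eta> \<bullet> second_deriv d c x (axis j 1) (tderiv c d x (fst v)) + snd v \<bullet> ?\<sigma> j (?\<tau> (snd c x)))) (at (snd c x, \<eta>))"
      by simp
  qed
  ultimately have "((\<lambda>v. (?\<tau> (fst v), \<chi> j. snd v \<bullet> ?\<sigma> j (?\<tau> (fst v)))) has_derivative hat_deriv c d x \<eta>) (at (snd c x, \<eta>))"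
    unfolding hat_deriv_def \<tau> by (auto intro!: has_derivative_Pair simp: add.commute)
  then show ?thesis
  proof (rule has_derivative_transform_within_open)
    show "open (snd c ` (fst c \<inter> fst d) \<times> (UNIV :: (real ^ 'n) set))"
      by (intro open_Times chart_open_image2[OF base_chart[OF c(1)] base_chart[OF d(1)]] open_UNIV)
  qed (use c d in \<open>auto simp: transition_hat transition_apply[OF base_chart[OF c(1)]]\<close>)
qed

lemma tderiv_hat:
  assumes "c \<in> A" "\<nu> \<in> fst (hat c)" "d \<in> A" "\<nu> \<in> fst (hat d)"
  shows "transition (hat c) (hat d) differentiable (at (snd (hat c) \<nu>))"
    "tderiv (hat c) (hat d) \<nu> = hat_deriv c d (fst \<nu>) (snd (snd (hat c) \<nu>))"
proof -
  have x: "fst \<nu> \<in> fst c" "fst \<nu> \<in> fst d" using assms by (auto simp: fst_hat)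
  have e: "snd (hat c) \<nu> = (snd c (fst \<nu>), snd (snd (hat c) \<nu>))" by (simp add: prod_eq_iff)
  note * = transition_hat_has_derivative[OF assms(1) x(1) assms(3) x(2), of "snd (snd (hat c) \<nu>)", folded e]
  show "transition (hat c) (hat d) differentiable (at (snd (hat c) \<nu>))" using * differentiable_def by blast
  show "tderiv (hat c) (hat d) \<nu> = hat_deriv c d (fst \<nu>) (snd (snd (hat c) \<nu>))"
    using frechet_derivative_at[OF *] by metis
qed

text \<open>In \<open>key\<close> the linear part of the momentum gives the original pairing,
  because covectors move by the inverse transpose. The rest is a second derivative contracted with
  \<open>\<eta>\<close>; being symmetric, it cancels in the alternating form.\<close>

lemma hat_deriv_vertical_map:
  assumes c: "c \<in> A" "x \<in> fst c" and d: "d \<in> A" "x \<in> fst d"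
  shows "vertical_map (hat_deriv c d x \<eta>)"
  unfolding vertical_map_def symplectic_map_def
proof (intro conjI allI)
  show "linear (hat_deriv c d x \<eta>)"
    by (rule has_derivative_linear[OF transition_hat_has_derivative[OF c d]])
  show "fst (hat_deriv c d x \<eta> (0, b)) = 0" for b
    using linear_0[OF linear_tderiv[OF C1 c(1) d(1) c(2) d(2)]] by (simp add: hat_deriv_def)
  let ?D = "tderiv c d x"
  have key: "snd (hat_deriv c d x \<eta> v) \<bullet> ?D a = snd v \<bullet> a + \<eta> \<bullet> second_deriv d c x (?D a) (?D (fst v))" for v a
  proof -
    have "snd (hat_deriv c d x \<eta> v) \<bullet> ?D a =
      snd v \<bullet> (\<Sum>j\<in>UNIV. ?D a $ j *\<^sub>R tderiv d c x (axis j 1)) +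
      \<eta> \<bullet> (\<Sum>j\<in>UNIV. ?D a $ j *\<^sub>R second_deriv d c x (axis j 1) (?D (fst v)))"
      by (simp add: hat_deriv_def inner_vec_def[of "vec_lambda _"] inner_sum_right sum.distrib algebra_simps)
    also have "(\<Sum>j\<in>UNIV. ?D a $ j *\<^sub>R tderiv d c x (axis j 1)) = tderiv d c x (?D a)"
      using linear_axis_expansion[OF linear_tderiv[OF C1 d(1) c(1) d(2) c(2)]] by metis
    also have "\<dots> = a" by (rule tderiv_inverse[OF C1 c(1) d(1) c(2) d(2)])
    also have "(\<Sum>j\<in>UNIV. ?D a $ j *\<^sub>R second_deriv d c x (axis j 1) (?D (fst v))) = second_deriv d c x (?D a) (?D (fst v))"
      by (rule second_deriv_expand(1)[OF d c])
    finally show ?thesis .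
  qed
  have fst: "fst (hat_deriv c d x \<eta> v) = ?D (fst v)" for v by (simp add: hat_deriv_def)
  show "std_form (hat_deriv c d x \<eta> v) (hat_deriv c d x \<eta> w) = std_form v w" for v w
    unfolding std_form_def fst inner_commute[of "?D (fst v)"] key
    using second_deriv_symmetric[OF d c, of "?D (fst v)" "?D (fst w)"] by (simp add: inner_commute)
qed

lemma tderiv_hat_vertical_map:
  assumes "c \<in> A" "\<nu> \<in> fst (hat c)" "d \<in> A" "\<nu> \<in> fst (hat d)"
  shows "vertical_map (tderiv (hat c) (hat d) \<nu>)"
  unfolding tderiv_hat(2)[OF assms] using assms by (intro hat_deriv_vertical_map) (auto simp: fst_hat)

end

section \<open>The topology of the cotangent bundle\<close>

lemma continuous_map_compose_on:
  assumes "continuous_map Y euclidean f" "\<And>y. y \<in> topspace Y \<Longrightarrow> f y \<in> S" "continuous_on S h"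
  shows "continuous_map Y euclidean (\<lambda>y. h (f y))"
proof -
  have "continuous_map Y (top_of_set S) f" using assms by (auto simp: continuous_map_in_subtopology)
  moreover have "continuous_map (top_of_set S) euclidean h" using assms(3) by simp
  ultimately show ?thesis using continuous_map_compose unfolding o_def by blast
qed

text \<open>Openness is tested point by point in whichever local coordinates are at hand; the map
  and its target may change with the point.\<close>

lemma continuous_map_openin_locally:
  fixes Y :: "'a topology"
  assumes "\<And>y. y \<in> P \<Longrightarrow> \<exists>V (f :: 'a \<Rightarrow> 'b) Z T. openin Y V \<and> y \<in> V \<and> continuous_map (subtopology Y V) Z f \<and> openin Z T \<and>
     f y \<in> T \<and> {x \<in> V. f x \<in> T} \<subseteq> P"
  shows "openin Y P"
proof (subst openin_subopen, intro ballI)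
  fix y assume "y \<in> P"
  from assms[OF this] obtain V and f :: "'a \<Rightarrow> 'b" and Z T where *: "openin Y V" "y \<in> V" "continuous_map (subtopology Y V) Z f" "openin Z T"
     "f y \<in> T" "{x \<in> V. f x \<in> T} \<subseteq> P" by (elim exE conjE)
  have V: "V \<subseteq> topspace Y" by (rule openin_subset[OF *(1)])
  have "openin (subtopology Y V) {x \<in> topspace (subtopology Y V). f x \<in> T}"
    by (rule openin_continuous_map_preimage[OF *(3,4)])
  then have "openin Y {x \<in> topspace (subtopology Y V). f x \<in> T}" using openin_trans_full *(1) by blast
  moreover have "{x \<in> topspace (subtopology Y V). f x \<in> T} = {x \<in> V. f x \<in> T}" using V by auto
  ultimately show "\<exists>T. openin Y T \<and> y \<in> T \<and> T \<subseteq> P" using * by (metis (mono_tags, lifting) mem_Collect_eq)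
qed

context smooth_base begin

abbreviation TX where "TX \<equiv> cotangent_topology A"
abbreviation hats where "hats \<equiv> cotangent_atlas A"

lemma openin_hat: "c \<in> A \<Longrightarrow> open S \<Longrightarrow> openin TX {\<nu> \<in> fst (hat c). snd (hat c) \<nu> \<in> S}"
  unfolding cotangent_topology_def atlas_topology_def cotangent_atlas_def
  by (rule topology_generated_by_Basis) blast

lemma openin_hat_domain: assumes "c \<in> A" shows "openin TX (fst (hat c))"
  using openin_hat[OF assms open_UNIV] by simp

lemma topspace_TX: "topspace TX = cotangent_bundle A"
proof
  show "topspace TX \<subseteq> cotangent_bundle A"
    unfolding cotangent_topology_def atlas_topology_def topology_generated_by_topspace
    by (auto simp: cotangent_atlas_def fst_hat)
  show "cotangent_bundle A \<subseteq> topspace TX"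
  proof
    fix \<nu> assume "\<nu> \<in> cotangent_bundle A"
    then obtain c where "c \<in> A" "\<nu> \<in> fst (hat c)" by (auto simp: fst_hat cotangent_bundle_def)
    then show "\<nu> \<in> topspace TX" using openin_subset[OF openin_hat_domain] by blast
  qed
qed

lemma hat_cover: assumes "\<nu> \<in> topspace TX" obtains c where "c \<in> A" "\<nu> \<in> fst (hat c)"
  using assms unfolding topspace_TX by (auto simp: fst_hat cotangent_bundle_def)

lemma hat_continuous: assumes "c \<in> A" shows "continuous_map (subtopology TX (fst (hat c))) euclidean (snd (hat c))"
  unfolding continuous_map_def
proof (intro conjI allI impI)
  fix S :: "'n phase set" assume "openin euclidean S"
  then have "openin TX {\<nu> \<in> fst (hat c). snd (hat c) \<nu> \<in> S}" using openin_hat[OF assms] by simp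
  moreover have "{\<nu> \<in> topspace (subtopology TX (fst (hat c))). snd (hat c) \<nu> \<in> S} = {\<nu> \<in> fst (hat c). snd (hat c) \<nu> \<in> S}"
    using openin_subset[OF openin_hat_domain[OF assms]] by auto
  ultimately show "openin (subtopology TX (fst (hat c))) {\<nu> \<in> topspace (subtopology TX (fst (hat c))). snd (hat c) \<nu> \<in> S}"
    using openin_hat_domain[OF assms] by (simp add: openin_open_subtopology)
qed auto

lemma hat_image_self: assumes "c \<in> A" shows "snd (hat c) ` fst (hat c) = snd c ` fst c \<times> UNIV"
  using hat_image[OF assms assms] by simp

text \<open>The cotangent topology is generated by all canonical charts, so continuity of the
  inverse of one chart means continuity of its transitions to the others.\<close>

lemma inv_hat_continuous:
  assumes c: "c \<in> A"
  shows "continuous_map (top_of_set (snd (hat c) ` fst (hat c))) TX (inv_into (fst (hat c)) (snd (hat c)))"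
  unfolding cotangent_topology_def atlas_topology_def
proof (rule continuous_on_generated_topo)
  let ?i = "inv_into (fst (hat c)) (snd (hat c))" and ?I = "snd (hat c) ` fst (hat c)"
  show "?i ` topspace (top_of_set ?I) \<subseteq> \<Union>{{p \<in> fst c. snd c p \<in> S} |c S. c \<in> hats \<and> open S}"
  proof -
    have "?i z \<in> fst (hat c)" if "z \<in> ?I" for z using inv_into_into that by metis
    moreover have "{p \<in> fst (hat c). snd (hat c) p \<in> UNIV} \<in> {{p \<in> fst c. snd c p \<in> S} |c S. c \<in> hats \<and> open S}"
      using c unfolding cotangent_atlas_def by blast
    ultimately show ?thesis by (intro image_subsetI UnionI) auto
  qed
  fix U assume "U \<in> {{p \<in> fst c. snd c p \<in> S} |c S. c \<in> hats \<and> open S}"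
  then obtain d S where d: "d \<in> A" "open S" "U = {p \<in> fst (hat d). snd (hat d) p \<in> S}"
    by (auto simp: cotangent_atlas_def)
  let ?J = "snd (hat c) ` (fst (hat c) \<inter> fst (hat d))"
  have J: "open ?J" unfolding hat_image[OF c d(1)]
    by (intro open_Times chart_open_image2[OF base_chart[OF c] base_chart[OF d(1)]] open_UNIV)
  have "continuous_on ?J (transition (hat c) (hat d))"
  proof (rule differentiable_imp_continuous_on, unfold differentiable_on_def, rule ballI)
    fix z assume "z \<in> ?J"
    then show "transition (hat c) (hat d) differentiable at z within ?J"
      using tderiv_hat(1)[OF c _ d(1)] differentiable_at_withinI by blast
  qed
  then have "open (?J \<inter> transition (hat c) (hat d) -` S)"
    using J d(2) by (simp add: continuous_on_open_vimage[OF J] Int_commute)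
  moreover have "?i -` U \<inter> topspace (top_of_set ?I) = ?J \<inter> transition (hat c) (hat d) -` S"
    by (auto simp: d(3) transition_def inv_into_f_f[OF hat_inj[OF c]])
  ultimately show "openin (top_of_set ?I) (?i -` U \<inter> topspace (top_of_set ?I))"
    by (metis Int_lower2 open_openin openin_subtopology_self open_subset topspace_euclidean_subtopology)
qed

lemma is_chart_hat: assumes c: "c \<in> A" shows "is_chart TX (hat c)"
  unfolding is_chart_def
proof (intro conjI openin_hat_domain c)
  let ?i = "inv_into (fst (hat c)) (snd (hat c))"
  show "open (snd (hat c) ` fst (hat c))"
    unfolding hat_image_self[OF c] using base_chart[OF c] by (intro open_Times) (auto simp: is_chart_def)
  have "homeomorphic_maps (subtopology TX (fst (hat c))) (top_of_set (snd (hat c) ` fst (hat c))) (snd (hat c)) ?i"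
    unfolding homeomorphic_maps_def
    using hat_continuous[OF c] inv_hat_continuous[OF c] inv_into_into[of _ "snd (hat c)" "fst (hat c)"]
    by (auto simp: continuous_map_in_subtopology inv_into_f_f[OF hat_inj[OF c]] f_inv_into_f)
  then show "homeomorphic_map (subtopology TX (fst (hat c))) (top_of_set (snd (hat c) ` fst (hat c))) (snd (hat c))"
    unfolding homeomorphic_map_maps by blast
qed

lemma C1_hats: "C1_atlas TX hats"
  unfolding C1_atlas_def cotangent_atlas_def using is_chart_hat tderiv_hat(1) by auto

lemma hat_mem: "c \<in> A \<Longrightarrow> hat c \<in> hats" by (simp add: cotangent_atlas_def)

lemma continuous_map_base_coord:
  assumes "c \<in> A" shows "continuous_map (subtopology TX (fst (hat c))) euclidean (\<lambda>\<nu>. snd c (fst \<nu>))"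
proof -
  have "continuous_map (subtopology TX (fst (hat c))) euclidean (\<lambda>\<nu>. fst (snd (hat c) \<nu>))"
    by (rule continuous_map_compose_on[OF hat_continuous[OF assms], of UNIV fst]) (auto intro: continuous_intros)
  then show ?thesis by simp
qed

lemma tderiv_hat_continuous:
  assumes c: "c \<in> A" and d: "d \<in> A"
  shows "continuous_map (subtopology TX (fst (hat c) \<inter> fst (hat d))) euclidean (\<lambda>\<nu>. tderiv (hat c) (hat d) \<nu> v)"
proof -
  let ?Y = "subtopology TX (fst (hat c) \<inter> fst (hat d))"
  have top: "\<nu> \<in> fst (hat c)" "\<nu> \<in> fst (hat d)" "fst \<nu> \<in> fst c" "fst \<nu> \<in> fst d" if "\<nu> \<in> topspace ?Y" for \<nu>
    using that by (auto simp: fst_hat)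
  have cc: "continuous_map ?Y euclidean (\<lambda>\<nu>. snd c (fst \<nu>))" "continuous_map ?Y euclidean (\<lambda>\<nu>. snd d (fst \<nu>))"
    using continuous_map_from_subtopology[OF continuous_map_base_coord[OF c], of "fst (hat d)"]
      continuous_map_from_subtopology[OF continuous_map_base_coord[OF d], of "fst (hat c)"]
    by (simp_all add: subtopology_subtopology Int_commute)
  have sn: "continuous_map ?Y euclidean (\<lambda>\<nu>. snd (snd (hat c) \<nu>))"
    using continuous_map_from_subtopology[OF hat_continuous[OF c], of "fst (hat d)"]
    by (intro continuous_map_compose_on[of ?Y "snd (hat c)" UNIV snd])
       (auto simp: subtopology_subtopology intro: continuous_intros)
  have D1: "continuous_map ?Y euclidean (\<lambda>\<nu>. tderiv c d (fst \<nu>) w)" for w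
    by (rule continuous_map_compose_on[OF cc(1) _ smooth_onD(2)[OF smooth_transition[OF c d]]]) (use top in blast)
  have D2: "continuous_map ?Y euclidean (\<lambda>\<nu>. tderiv d c (fst \<nu>) w)" for w
    by (rule continuous_map_compose_on[OF cc(2) _ smooth_onD(2)[OF smooth_transition[OF d c]]]) (use top in blast)
  have D3: "continuous_map ?Y euclidean (\<lambda>\<nu>. second_deriv d c (fst \<nu>) u w)" for u w
    by (rule continuous_map_compose_on[OF cc(2) _ smooth_onD(4)[OF smooth_transition[OF d c]]]) (use top in blast)
  define e where "e = (\<lambda>\<nu>. snd (snd (hat c) \<nu>))"
  \<comment> \<open>Smoothness gives continuity of second derivatives in fixed directions, so the
    moving direction \<open>tderiv c d (fst \<nu>) (fst v)\<close> is expanded in the standard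
    basis.\<close>
  let ?f = "\<lambda>\<nu>. (tderiv c d (fst \<nu>) (fst v), \<chi> j. snd v \<bullet> tderiv d c (fst \<nu>) (axis j 1) +
      e \<nu> \<bullet> (\<Sum>k\<in>UNIV. tderiv c d (fst \<nu>) (fst v) $ k *\<^sub>R second_deriv d c (fst \<nu>) (axis j 1) (axis k 1)))"
  have "continuous_map ?Y euclidean ?f"
    unfolding continuous_map_tendsto
    by (intro ballI tendsto_intros) (use D1 D2 D3 sn[folded e_def] in \<open>auto simp: continuous_map_tendsto\<close>)
  then show ?thesis
  proof (rule continuous_map_eq)
    fix \<nu> assume "\<nu> \<in> topspace ?Y"
    note t = top[OF this]
    show "?f \<nu> = tderiv (hat c) (hat d) \<nu> v"
      unfolding tderiv_hat(2)[OF c t(1) d t(2)] second_deriv_expand(2)[OF d t(4) c t(3)] hat_deriv_def e_def ..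
  qed
qed

text \<open>The defining description is consistent because changes of canonical coordinates are
  symplectic.\<close>

lemma canonical_form_eq:
  assumes c: "c \<in> A" "\<nu> \<in> fst (hat c)" and v: "v \<in> tangent_space hats \<nu>" and w: "w \<in> tangent_space hats \<nu>"
  shows "canonical_form A \<nu> v w = std_form (v (hat c)) (w (hat c))"
  unfolding canonical_form_def
proof (rule the_equality)
  show "\<forall>d\<in>A. fst \<nu> \<in> fst d \<longrightarrow> std_form (v (hat c)) (w (hat c)) = std_form (v (hat d)) (w (hat d))"
  proof (intro ballI impI)
    fix d assume d: "d \<in> A" "fst \<nu> \<in> fst d"
    then have d': "\<nu> \<in> fst (hat d)" using c by (simp add: fst_hat)
    note t = tangent_transform[OF C1_hats _ hat_mem[OF c(1)] c(2) hat_mem[OF d(1)] d']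
    show "std_form (v (hat c)) (w (hat c)) = std_form (v (hat d)) (w (hat d))"
      unfolding t[OF v] t[OF w]
      using tderiv_hat_vertical_map[OF c d(1) d'] by (simp add: vertical_map_def symplectic_map_def)
  qed
  fix r assume "\<forall>d\<in>A. fst \<nu> \<in> fst d \<longrightarrow> r = std_form (v (hat d)) (w (hat d))"
  then show "r = std_form (v (hat c)) (w (hat c))" using c by (simp add: fst_hat)
qed

section \<open>Lagrangian subspaces in canonical coordinates\<close>

definition coords where "coords c W = (\<lambda>w. w (hat c)) ` W"

text \<open>Keeping \<open>\<Lambda>\<close> fixed while \<open>\<nu>\<close> moves is the local
  parallel transport used in \<open>retract_step\<close>.\<close>

definition lift where "lift c \<nu> \<Lambda> = coordinate_tangent hats \<nu> (hat c) ` \<Lambda>"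

lemma lagrangians_at_subset: "W \<in> lagrangians_at A \<nu> \<Longrightarrow> W \<subseteq> tangent_space hats \<nu>"
  by (auto simp: lagrangians_at_def lagrangian_subspaces_def)

context
  fixes c \<nu> assumes c: "c \<in> A" "\<nu> \<in> fst (hat c)"
begin

lemma coords_lift: "coords c (lift c \<nu> \<Lambda>) = \<Lambda>"
  unfolding coords_def lift_def image_image coordinate_tangent_self[OF C1_hats hat_mem[OF c(1)] c(2)] by simp

lemma lift_coords: assumes "W \<subseteq> tangent_space hats \<nu>" shows "lift c \<nu> (coords c W) = W"
proof -
  have "coordinate_tangent hats \<nu> (hat c) (w (hat c)) = w" if "w \<in> W" for w
    using tangent_eq_coordinate_tangent[OF C1_hats _ hat_mem[OF c(1)] c(2)] assms that by blast
  then show ?thesis unfolding coords_def lift_def image_image by simp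
qed

lemma lagrangians_at_iff:
  assumes "W \<subseteq> tangent_space hats \<nu>" shows "W \<in> lagrangians_at A \<nu> \<longleftrightarrow> coords c W \<in> Lag"
proof -
  let ?T = "tangent_space hats \<nu>" and ?k = "coordinate_tangent hats \<nu> (hat c)"
  have k: "?k a \<in> ?T" "?k a (hat c) = a" for a
    using coordinate_tangent_mem[OF C1_hats hat_mem[OF c(1)] c(2)] coordinate_tangent_self[OF C1_hats hat_mem[OF c(1)] c(2)] by auto
  have kv: "?k (v (hat c)) = v" if "v \<in> ?T" for v
    by (rule tangent_eq_coordinate_tangent[OF C1_hats that hat_mem[OF c(1)] c(2)])
  have mem: "v \<in> W \<longleftrightarrow> v (hat c) \<in> coords c W" if "v \<in> ?T" for v
  proof
    assume "v (hat c) \<in> coords c W"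
    then obtain w where w: "w \<in> W" "v (hat c) = w (hat c)" unfolding coords_def by blast
    have "w \<in> ?T" using assms w(1) by (rule subsetD)
    have "v = ?k (v (hat c))" by (rule kv[OF that, symmetric])
    also have "\<dots> = w" unfolding w(2) by (rule kv[OF \<open>w \<in> ?T\<close>])
    finally show "v \<in> W" using w(1) by (simp only:)
  qed (auto simp: coords_def)
  \<comment> \<open>Every phase vector is the coordinate vector of a tangent vector, so quantifying
    over the tangent space amounts to quantifying over coordinates.\<close>
  have gen: "(\<forall>v\<in>?T. Q (v (hat c))) \<longleftrightarrow> (\<forall>a. Q a)" for Q
  proof (intro iffI allI ballI)
    fix a assume "\<forall>v\<in>?T. Q (v (hat c))"
    from bspec[OF this k(1)[of a]] show "Q a" by (simp only: k(2))
  qed blast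
  have perp: "(\<forall>w\<in>W. canonical_form A \<nu> v w = 0) \<longleftrightarrow> (\<forall>b\<in>coords c W. std_form (v (hat c)) b = 0)" if "v \<in> ?T" for v
    using canonical_form_eq[OF c that] assms by (auto simp: coords_def subset_iff)
  have "W \<in> lagrangians_at A \<nu> \<longleftrightarrow> (\<forall>v\<in>?T. v \<in> W \<longleftrightarrow> (\<forall>w\<in>W. canonical_form A \<nu> v w = 0))"
    unfolding lagrangians_at_def lagrangian_subspaces_def using assms by blast
  also have "\<dots> \<longleftrightarrow> (\<forall>v\<in>?T. v (hat c) \<in> coords c W \<longleftrightarrow> (\<forall>b\<in>coords c W. std_form (v (hat c)) b = 0))"
    using mem perp by simp
  also have "\<dots> \<longleftrightarrow> (\<forall>a. a \<in> coords c W \<longleftrightarrow> (\<forall>b\<in>coords c W. std_form a b = 0))"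
    by (rule gen)
  finally show ?thesis unfolding Lag_iff .
qed

lemma coords_Lag: "W \<in> lagrangians_at A \<nu> \<Longrightarrow> coords c W \<in> Lag"
  using lagrangians_at_iff lagrangians_at_subset by blast

lemma lift_lagrangian: assumes "\<Lambda> \<in> Lag" shows "lift c \<nu> \<Lambda> \<in> lagrangians_at A \<nu>"
proof -
  have "lift c \<nu> \<Lambda> \<subseteq> tangent_space hats \<nu>"
    using coordinate_tangent_mem[OF C1_hats hat_mem[OF c(1)] c(2)] by (auto simp: lift_def)
  then show ?thesis using lagrangians_at_iff assms coords_lift by metis
qed

lemma coords_transform:
  assumes d: "d \<in> A" "\<nu> \<in> fst (hat d)" and W: "W \<subseteq> tangent_space hats \<nu>"
  shows "coords d W = tderiv (hat c) (hat d) \<nu> ` coords c W"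
proof -
  have "v (hat d) = tderiv (hat c) (hat d) \<nu> (v (hat c))" if "v \<in> W" for v
    using tangent_transform[OF C1_hats _ hat_mem[OF c(1)] c(2) hat_mem[OF d(1)] d(2)] W that by blast
  then show ?thesis unfolding coords_def image_image by simp
qed

end

end

section \<open>The bundle of Lagrangian Grassmannians and its sections\<close>

lemma Ck_on_cong:
  assumes "open S" "\<And>x. x \<in> S \<Longrightarrow> f x = g x" "Ck_on k S f" shows "Ck_on k S g"
  using assms(2,3)
proof (induction k arbitrary: f g)
  case 0
  then show ?case using continuous_on_cong by (metis Ck_on.simps(1))
next
  case (Suc k)
  have d: "(g has_derivative frechet_derivative f (at x)) (at x)" if "x \<in> S" for x
    by (rule has_derivative_transform_within_open[OF iffD1[OF frechet_derivative_works] assms(1) that])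
       (use Suc.prems that in auto)
  have e: "frechet_derivative f (at x) = frechet_derivative g (at x)" if "x \<in> S" for x
    by (rule frechet_derivative_at[OF d[OF that]])
  have "Ck_on k S (\<lambda>x. frechet_derivative g (at x) v)" for v
    by (rule Suc.IH[of "\<lambda>x. frechet_derivative f (at x) v"]) (use e Suc.prems in auto)
  then show ?case using d by (auto simp: differentiable_def)
qed

text \<open>The factor \<open>r\<close> makes the induction close: differentiating in the direction
  \<open>v\<close> replaces \<open>h\<close> by its derivative along \<open>k\<close> and
  \<open>r\<close> by \<open>r * v\<close>.\<close>

lemma Ck_on_affine:
  fixes h :: "'a::euclidean_space \<Rightarrow> 'b::euclidean_space"
  assumes I: "open (I :: real set)" and S: "\<And>t. t \<in> I \<Longrightarrow> y + t *\<^sub>R k \<in> S" and h: "Ck_on m S h"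
  shows "Ck_on m I (\<lambda>t. r *\<^sub>R h (y + t *\<^sub>R k))"
  using h
proof (induction m arbitrary: h r)
  case 0
  then have "continuous_on S h" by simp
  then have "continuous_on I (\<lambda>t. h (y + t *\<^sub>R k))"
    by (rule continuous_on_compose2) (auto intro!: continuous_intros S)
  then show ?case by (auto intro!: continuous_intros)
next
  case (Suc m)
  have d: "((\<lambda>t. r *\<^sub>R h (y + t *\<^sub>R k)) has_derivative (\<lambda>v. (r * v) *\<^sub>R frechet_derivative h (at (y + t *\<^sub>R k)) k)) (at t)"
    if t: "t \<in> I" for t
  proof -
    have D: "h differentiable (at (y + t *\<^sub>R k))" using Suc.prems S[OF t] by simp
    have "((\<lambda>t. h (y + t *\<^sub>R k)) has_derivative (\<lambda>v. frechet_derivative h (at (y + t *\<^sub>R k)) (v *\<^sub>R k))) (at t)"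
      by (rule has_derivative_compose[where f = "\<lambda>t. y + t *\<^sub>R k"])
         (auto intro!: derivative_eq_intros D[unfolded frechet_derivative_works])
    from has_derivative_scaleR_right[OF this, of r] show ?thesis
      by (simp add: linear_cmul[OF linear_frechet_derivative[OF D]])
  qed
  have "Ck_on m I (\<lambda>t. frechet_derivative (\<lambda>t. r *\<^sub>R h (y + t *\<^sub>R k)) (at t) v)" for v
  proof (rule Ck_on_cong[OF I])
    show "Ck_on m I (\<lambda>t. (r * v) *\<^sub>R frechet_derivative h (at (y + t *\<^sub>R k)) k)"
      by (rule Suc.IH) (use Suc.prems in simp)
    show "(r * v) *\<^sub>R frechet_derivative h (at (y + t *\<^sub>R k)) k = frechet_derivative (\<lambda>t. r *\<^sub>R h (y + t *\<^sub>R k)) (at t) v"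
      if "t \<in> I" for t using frechet_derivative_at[OF d[OF that]] by metis
  qed
  then show ?case using d by (auto simp: differentiable_def)
qed

lemma smooth_on_affine:
  assumes "open (I :: real set)" "\<And>t. t \<in> I \<Longrightarrow> y + t *\<^sub>R k \<in> S" "smooth_on S h"
  shows "smooth_on I (\<lambda>t. h (y + t *\<^sub>R k))"
  using Ck_on_affine[OF assms(1,2), where h = h and r = 1] assms(3) by (simp add: smooth_on_def)

lemma smooth_on_cong:
  assumes "open S" "\<And>x. x \<in> S \<Longrightarrow> f x = g x" "smooth_on S f" shows "smooth_on S g"
  using Ck_on_cong[of S f g] assms by (auto simp: smooth_on_def)

text \<open>The difference quotients lie in \<open>K\<close>, and subspaces of a Euclidean space are
  closed.\<close>

lemma vector_derivative_in_subspace: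
  fixes K :: "'a::euclidean_space set"
  assumes K: "subspace K" and h: "(h has_vector_derivative k) (at 0)" and e: "e > 0" "\<And>t. \<bar>t\<bar> < e \<Longrightarrow> h t \<in> K"
  shows "k \<in> K"
proof (rule Lim_in_closed_set[OF closed_subspace[OF K]])
  have "((\<lambda>t. norm (h t - h 0 - t *\<^sub>R k) / norm t) \<longlongrightarrow> 0) (at 0)"
    using h by (simp add: has_vector_derivative_def has_derivative_iff_norm)
  moreover have "norm ((h t - h 0) /\<^sub>R t - k) = norm (h t - h 0 - t *\<^sub>R k) / norm t" if "t \<noteq> 0" for t
  proof -
    have "(h t - h 0) /\<^sub>R t - k = (h t - h 0 - t *\<^sub>R k) /\<^sub>R t" using that by (simp add: scaleR_diff_right)
    then show ?thesis by (simp add: divide_inverse)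
  qed
  ultimately have "((\<lambda>t. norm ((h t - h 0) /\<^sub>R t - k)) \<longlongrightarrow> 0) (at 0)"
    by (subst Lim_cong_within[where g = "\<lambda>t. norm (h t - h 0 - t *\<^sub>R k) / norm t"]) auto
  then show "((\<lambda>t. (h t - h 0) /\<^sub>R t) \<longlongrightarrow> k) (at 0)"
    by (simp add: LIM_zero_iff tendsto_norm_zero_iff)
  show "\<forall>\<^sub>F t in at 0. (h t - h 0) /\<^sub>R t \<in> K"
    unfolding eventually_at using e K by (intro exI[of _ e]) (auto intro!: subspace_scale subspace_diff)
qed simp

section \<open>The bundle projection and the vertical subspaces\<close>

context smooth_base begin

lemma fst_continuous: "continuous_map TX X fst"
  unfolding continuous_map_def
proof (intro conjI allI impI)
  show "fst \<in> topspace TX \<rightarrow> topspace X"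
    using atlas by (auto simp: topspace_TX cotangent_bundle_def smooth_atlas_def)
  fix U assume U: "openin X U"
  show "openin TX {\<nu> \<in> topspace TX. fst \<nu> \<in> U}"
  proof (rule continuous_map_openin_locally)
    fix \<nu> assume \<nu>: "\<nu> \<in> {\<nu> \<in> topspace TX. fst \<nu> \<in> U}"
    then obtain c where c: "c \<in> A" "\<nu> \<in> fst (hat c)" using hat_cover by blast
    have "{\<mu> \<in> fst (hat c). snd c (fst \<mu>) \<in> snd c ` (fst c \<inter> U)} \<subseteq> {\<nu> \<in> topspace TX. fst \<nu> \<in> U}"
      using chart_inj[OF base_chart[OF c(1)]] by (auto simp: topspace_TX fst_hat inj_on_def)
    moreover have "open (snd c ` (fst c \<inter> U))" by (rule chart_open_image[OF base_chart[OF c(1)] U])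
    moreover have "snd c (fst \<nu>) \<in> snd c ` (fst c \<inter> U)" using \<nu> c by (auto simp: fst_hat)
    ultimately show "\<exists>V (f :: _ \<Rightarrow> real ^ 'n) Z T. openin TX V \<and> \<nu> \<in> V \<and> continuous_map (subtopology TX V) Z f \<and> openin Z T \<and>
        f \<nu> \<in> T \<and> {x \<in> V. f x \<in> T} \<subseteq> {\<nu> \<in> topspace TX. fst \<nu> \<in> U}"
      using continuous_map_base_coord[OF c(1)] openin_hat_domain[OF c(1)] c
      by (intro exI[of _ "fst (hat c)"] exI[of _ "\<lambda>\<nu>. snd c (fst \<nu>)"] exI[of _ euclidean]
            exI[of _ "snd c ` (fst c \<inter> U)"] conjI) (simp_all only: open_openin)
  qed
qed

lemma vertical_fibre:
  assumes c: "c \<in> A" "\<nu> \<in> fst (hat c)" and v: "v \<in> tangent_space hats \<nu>"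
  shows "differential hats A fst \<nu> v = (\<lambda>_. 0) \<longleftrightarrow> fst (v (hat c)) = 0"
proof -
  \<comment> \<open>\<open>h\<close> is the chart that \<open>differential\<close> selects, which
    may differ from \<open>hat c\<close>.\<close>
  define h where "h = (SOME h. h \<in> hats \<and> \<nu> \<in> fst h)"
  have "h \<in> hats \<and> \<nu> \<in> fst h" unfolding h_def by (rule someI[of _ "hat c"]) (simp add: c hat_mem)
  then obtain c' where c': "c' \<in> A" "\<nu> \<in> fst (hat c')" "h = hat c'" by (auto simp: cotangent_atlas_def)
  have x: "fst \<nu> \<in> fst c'" using c' by (simp add: fst_hat)
  have D: "frechet_derivative (snd d \<circ> fst \<circ> inv_into (fst h) (snd h)) (at (snd h \<nu>)) w = tderiv c' d (fst \<nu>) (fst w)"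
    if d: "d \<in> A" "fst \<nu> \<in> fst d" for d w
  proof -
    have "((\<lambda>z. transition c' d (fst z)) has_derivative (\<lambda>w. tderiv c' d (fst \<nu>) (fst w))) (at (snd h \<nu>))"
      by (rule has_derivative_compose[OF has_derivative_fst[OF has_derivative_ident]])
         (simp add: c'(3) transition_has_derivative atlas_differentiable[OF C1 c'(1) d(1) x d(2)])
    then have "((snd d \<circ> fst \<circ> inv_into (fst h) (snd h)) has_derivative (\<lambda>w. tderiv c' d (fst \<nu>) (fst w))) (at (snd h \<nu>))"
    proof (rule has_derivative_transform_within_open)
      show "open (snd c' ` (fst c' \<inter> fst d) \<times> (UNIV :: (real ^ 'n) set))"
        by (intro open_Times chart_open_image2[OF base_chart[OF c'(1)] base_chart[OF d(1)]] open_UNIV)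
    qed (use x d c' in \<open>auto simp: snd_hat inv_hat transition_apply[OF base_chart[OF c'(1)]]\<close>)
    from frechet_derivative_at[OF this] show ?thesis by metis
  qed
  have diff: "differential hats A fst \<nu> v = (\<lambda>d. if d \<in> A \<and> fst \<nu> \<in> fst d then tderiv c' d (fst \<nu>) (fst (v h)) else 0)"
    unfolding differential_def Let_def h_def[symmetric] by (rule ext) (simp add: D)
  \<comment> \<open>Transitions between canonical charts are vertical maps, so a position part that
    vanishes in one chart vanishes in all.\<close>
  have vert: "fst (v (hat d)) = 0" if "d \<in> A" "\<nu> \<in> fst (hat d)" "e \<in> A" "\<nu> \<in> fst (hat e)" "fst (v (hat e)) = 0" for d e
  proof -
    have "v (hat d) = tderiv (hat e) (hat d) \<nu> (0, snd (v (hat e)))"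
      using tangent_transform[OF C1_hats v hat_mem[OF that(3)] that(4) hat_mem[OF that(1)] that(2)] that(5)
      by (metis prod.collapse)
    then show ?thesis using tderiv_hat_vertical_map[OF that(3,4,1,2)] by (simp add: vertical_map_def)
  qed
  show ?thesis
  proof
    assume "differential hats A fst \<nu> v = (\<lambda>_. 0)"
    then have "tderiv c' c' (fst \<nu>) (fst (v h)) = 0"
      using diff c'(1) x by (metis (mono_tags, lifting))
    then have "fst (v (hat c')) = 0" by (simp add: tderiv_self[OF C1 c'(1) x] c'(3))
    then show "fst (v (hat c)) = 0" by (rule vert[OF c c'(1,2)])
  next
    assume "fst (v (hat c)) = 0"
    then have "fst (v h) = 0" unfolding c'(3) by (rule vert[OF c'(1,2) c])
    then show "differential hats A fst \<nu> v = (\<lambda>_. 0)"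
      unfolding diff using linear_0[OF linear_tderiv[OF C1 c'(1) _ x]] by auto
  qed
qed

lemma coords_vertical:
  assumes c: "c \<in> A" "\<nu> \<in> fst (hat c)" shows "coords c (snd (vertical_section A \<nu>)) = vertical_space"
proof -
  have k: "coordinate_tangent hats \<nu> (hat c) a \<in> tangent_space hats \<nu>" "coordinate_tangent hats \<nu> (hat c) a (hat c) = a" for a
    using coordinate_tangent_mem[OF C1_hats hat_mem[OF c(1)] c(2)] coordinate_tangent_self[OF C1_hats hat_mem[OF c(1)] c(2)] by auto
  have e: "snd (vertical_section A \<nu>) = {v \<in> tangent_space hats \<nu>. fst (v (hat c)) = 0}"
    unfolding vertical_section_def using vertical_fibre[OF c] by auto
  show ?thesis
  proof
    show "coords c (snd (vertical_section A \<nu>)) \<subseteq> vertical_space"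
      unfolding e by (auto simp: coords_def vertical_space_def)
    show "vertical_space \<subseteq> coords c (snd (vertical_section A \<nu>))"
    proof
      fix a :: "'n phase" assume "a \<in> vertical_space"
      then have "coordinate_tangent hats \<nu> (hat c) a \<in> snd (vertical_section A \<nu>)"
        unfolding e by (simp add: k vertical_space_def)
      then show "a \<in> coords c (snd (vertical_section A \<nu>))" unfolding coords_def by (rule image_eqI[where f = "\<lambda>w. w (hat c)" and x = "coordinate_tangent hats \<nu> (hat c) a", OF k(2)[of a, symmetric]])
    qed
  qed
qed

lemma vertical_lagrangian:
  assumes c: "c \<in> A" "\<nu> \<in> fst (hat c)" shows "snd (vertical_section A \<nu>) \<in> lagrangians_at A \<nu>"
  using lagrangians_at_iff[OF c, of "snd (vertical_section A \<nu>)"] coords_vertical[OF c] vertical_space_Lag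
  by (auto simp: vertical_section_def)

end

section \<open>The bundle of Lagrangian Grassmannians over \<open>L\<close>\<close>

locale lag_setting = smooth_base X A for X :: "'a topology" and A :: "('a, real ^ 'n::finite) chart set" +
  fixes L :: "('a, 'n) cotangent_point set"
  assumes L: "lagrangian_submanifold A L"
begin

abbreviation LT where "LT \<equiv> subtopology TX L"
abbreviation BT where "BT \<equiv> lag_bundle_topology A L"

lemma L_subset: "L \<subseteq> topspace TX"
  using L by (simp add: lagrangian_submanifold_def embedded_submanifold_def)

lemma topspace_LT: "topspace LT = L" using L_subset by auto

lemma L_cover: assumes "\<nu> \<in> L" obtains c where "c \<in> A" "\<nu> \<in> fst (hat c)"
  using hat_cover L_subset assms by blast

lemma openin_BT:
  assumes "c \<in> A" "openin LT S" "openin Lag_topology T"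
  shows "openin BT {(\<nu>, W) \<in> lag_bundle A L. fst \<nu> \<in> fst c \<and> \<nu> \<in> S \<and> coords c W \<in> T}"
  unfolding lag_bundle_topology_def coords_def by (rule topology_generated_by_Basis) (use assms in blast)

lemma BT_coord_domain:
  assumes c: "c \<in> A" and S: "openin LT S"
  shows "openin BT {p \<in> lag_bundle A L. fst p \<in> fst (hat c) \<inter> S}"
proof -
  have "{p \<in> lag_bundle A L. fst p \<in> fst (hat c) \<inter> S} =
     {(\<nu>, W) \<in> lag_bundle A L. fst \<nu> \<in> fst c \<and> \<nu> \<in> S \<and> coords c W \<in> topspace Lag_topology}"
    using L_subset coords_Lag[OF c] by (auto simp: lag_bundle_def fst_hat topspace_TX)
  then show ?thesis using openin_BT[OF c S openin_topspace] by simp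
qed

lemma topspace_BT: "topspace BT = lag_bundle A L"
proof
  show "topspace BT \<subseteq> lag_bundle A L"
    unfolding lag_bundle_topology_def topology_generated_by_topspace by auto
  show "lag_bundle A L \<subseteq> topspace BT"
  proof
    fix p assume p: "p \<in> lag_bundle A L"
    then have "fst p \<in> L" by (auto simp: lag_bundle_def)
    then obtain c where c: "c \<in> A" "fst p \<in> fst (hat c)" by (rule L_cover)
    have "p \<in> {p \<in> lag_bundle A L. fst p \<in> fst (hat c) \<inter> L}" using p c \<open>fst p \<in> L\<close> by simp
    moreover have "openin BT {p \<in> lag_bundle A L. fst p \<in> fst (hat c) \<inter> L}"
      by (rule BT_coord_domain[OF c(1)]) (metis openin_topspace topspace_LT)
    ultimately show "p \<in> topspace BT" using openin_subset by blast
  qed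
qed

lemma BT_point: assumes "q \<in> topspace BT" shows "fst q \<in> L" "snd q \<in> lagrangians_at A (fst q)"
  using assms by (auto simp: topspace_BT lag_bundle_def)

lemma BT_projection: "continuous_map BT LT fst"
  unfolding continuous_map_def
proof (intro conjI allI impI)
  show "fst \<in> topspace BT \<rightarrow> topspace LT" by (auto simp: topspace_BT lag_bundle_def intro: subsetD[OF L_subset])
  fix S assume S: "openin LT S"
  have "{p \<in> topspace BT. fst p \<in> S} = (\<Union>c\<in>A. {p \<in> lag_bundle A L. fst p \<in> fst (hat c) \<inter> S})"
    using L_cover by (auto simp: topspace_BT lag_bundle_def) metis
  also have "openin BT \<dots>" using BT_coord_domain[OF _ S] by blast
  finally show "openin BT {p \<in> topspace BT. fst p \<in> S}" .
qed

lemma openin_LT_hat: assumes "c \<in> A" shows "openin LT (L \<inter> fst (hat c))"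
  using openin_hat_domain[OF assms] unfolding openin_subtopology by blast

lemma openin_BT_over: assumes "c \<in> A" shows "openin BT {p \<in> topspace BT. fst p \<in> fst (hat c)}"
proof -
  from openin_continuous_map_preimage[OF BT_projection openin_LT_hat[OF assms]]
  have "openin BT {p \<in> topspace BT. fst p \<in> L \<inter> fst (hat c)}" .
  moreover have "{p \<in> topspace BT. fst p \<in> L \<inter> fst (hat c)} = {p \<in> topspace BT. fst p \<in> fst (hat c)}"
    by (auto simp: topspace_BT lag_bundle_def)
  ultimately show ?thesis by simp
qed

lemma BT_coords:
  assumes c: "c \<in> A"
  shows "continuous_map (subtopology BT {p. fst p \<in> fst (hat c)}) Lag_topology (\<lambda>p. coords c (snd p))"
  unfolding continuous_map_def
proof (intro conjI allI impI)
  show "(\<lambda>p. coords c (snd p)) \<in> topspace (subtopology BT {p. fst p \<in> fst (hat c)}) \<rightarrow> topspace Lag_topology"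
    using coords_Lag[OF c] by (auto simp: topspace_BT lag_bundle_def)
  fix T :: "'n phase set set" assume T: "openin Lag_topology T"
  have LT: "openin LT L" by (metis openin_topspace topspace_LT)
  have "{p \<in> topspace (subtopology BT {p. fst p \<in> fst (hat c)}). coords c (snd p) \<in> T} =
      {(\<nu>, W) \<in> lag_bundle A L. fst \<nu> \<in> fst c \<and> \<nu> \<in> L \<and> coords c W \<in> T} \<inter> {p. fst p \<in> fst (hat c)}"
    using L_subset by (auto simp: topspace_BT lag_bundle_def fst_hat topspace_TX)
  then show "openin (subtopology BT {p. fst p \<in> fst (hat c)}) {p \<in> topspace (subtopology BT {p. fst p \<in> fst (hat c)}). coords c (snd p) \<in> T}"
    using openin_BT[OF c LT T] openin_subtopology by blast
qed

text \<open>The generators involve all canonical charts, but one chart around each point is enough: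
  the coordinates in a second chart are the images of those in the first under the vertical maps
  \<open>tderiv (hat c) (hat d)\<close>, which depend continuously on the base point.\<close>

lemma continuous_map_into_BT:
  assumes p: "continuous_map Y LT (\<lambda>y. fst (g y))"
    and W: "\<And>y. y \<in> topspace Y \<Longrightarrow> snd (g y) \<in> lagrangians_at A (fst (g y))"
    and loc: "\<And>y. y \<in> topspace Y \<Longrightarrow> \<exists>c\<in>A. \<exists>V. openin Y V \<and> y \<in> V \<and> (\<forall>z\<in>V. fst (g z) \<in> fst (hat c)) \<and>
        continuous_map (subtopology Y V) Lag_topology (\<lambda>z. coords c (snd (g z)))"
  shows "continuous_map Y BT g"
proof -
  have gL: "fst (g y) \<in> L" if "y \<in> topspace Y" for y
    using p that L_subset by (auto simp: continuous_map_def)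
  have gB: "g y \<in> lag_bundle A L" if "y \<in> topspace Y" for y
    using gL[OF that] W[OF that] by (cases "g y") (simp add: lag_bundle_def)
  show ?thesis
    unfolding lag_bundle_topology_def
  proof (rule continuous_on_generated_topo)
    let ?gen = "{{(\<nu>, W) \<in> lag_bundle A L. fst \<nu> \<in> fst c \<and> \<nu> \<in> S \<and> (\<lambda>w. w (hat c)) ` W \<in> T} |c S T.
        c \<in> A \<and> openin LT S \<and> openin Lag_topology T}"
    show "g ` topspace Y \<subseteq> \<Union>?gen"
      using gB topspace_BT unfolding lag_bundle_topology_def topology_generated_by_topspace by blast
    fix U assume "U \<in> ?gen"
    then obtain d S T where d: "d \<in> A" "openin LT S" "openin Lag_topology T"
      and U: "U = {(\<nu>, W) \<in> lag_bundle A L. fst \<nu> \<in> fst d \<and> \<nu> \<in> S \<and> coords d W \<in> T}"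
      unfolding coords_def by blast
    show "openin Y (g -` U \<inter> topspace Y)"
    proof (rule continuous_map_openin_locally)
      fix y assume "y \<in> g -` U \<inter> topspace Y"
      then have y: "y \<in> topspace Y" "g y \<in> U" by auto
      have gyd: "fst (g y) \<in> fst (hat d)"
        using y gL[OF y(1)] L_subset unfolding U by (auto simp: fst_hat topspace_TX)
      obtain c V where c: "c \<in> A" "openin Y V" "y \<in> V" "\<And>z. z \<in> V \<Longrightarrow> fst (g z) \<in> fst (hat c)"
        "continuous_map (subtopology Y V) Lag_topology (\<lambda>z. coords c (snd (g z)))"
        using loc[OF y(1)] by blast
      define V' where "V' = V \<inter> {z \<in> topspace Y. fst (g z) \<in> S \<inter> (L \<inter> fst (hat d))}"
      have V': "openin Y V'" unfolding V'_def
        by (rule openin_Int[OF c(2) openin_continuous_map_preimage[OF p openin_Int[OF d(2) openin_LT_hat[OF d(1)]]]])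
      have V'top: "topspace (subtopology Y V') = V'" using openin_subset[OF V'] by auto
      have V'D: "fst (g z) \<in> fst (hat c)" "fst (g z) \<in> fst (hat d)" "fst (g z) \<in> S" "z \<in> topspace Y" if "z \<in> V'" for z
        using that c(4) by (auto simp: V'_def)
      let ?f = "\<lambda>z. tderiv (hat c) (hat d) (fst (g z)) ` coords c (snd (g z))"
      have f: "coords d (snd (g z)) = ?f z" if "z \<in> V'" for z
        by (rule coords_transform[OF c(1) V'D(1)[OF that] d(1) V'D(2)[OF that] lagrangians_at_subset[OF W[OF V'D(4)[OF that]]]])
      have cont: "continuous_map (subtopology Y V') Lag_topology ?f"
      proof (rule continuous_map_Lag_image)
        show "vertical_map (tderiv (hat c) (hat d) (fst (g z)))" if "z \<in> topspace (subtopology Y V')" for z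
          using that V'D unfolding V'top by (intro tderiv_hat_vertical_map c(1) d(1)) auto
        have "continuous_map (subtopology Y V') (subtopology TX (fst (hat c) \<inter> fst (hat d))) (\<lambda>z. fst (g z))"
          using continuous_map_from_subtopology[OF p, of V'] V'D V'top
          by (auto simp: continuous_map_in_subtopology)
        from continuous_map_compose[OF this tderiv_hat_continuous[OF c(1) d(1)]]
        show "continuous_map (subtopology Y V') euclidean (\<lambda>z. tderiv (hat c) (hat d) (fst (g z)) v)" for v
          by (simp add: o_def)
        have "V \<inter> V' = V'" by (auto simp: V'_def)
        then show "continuous_map (subtopology Y V') Lag_topology (\<lambda>z. coords c (snd (g z)))"
          using continuous_map_from_subtopology[OF c(5), of V'] by (simp add: subtopology_subtopology)
      qed
      have yV': "y \<in> V'" using y c(3) gL[OF y(1)] gyd by (auto simp: V'_def U)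
      have fy: "?f y \<in> T" using f[OF yV'] y(2) by (auto simp: U)
      have sub: "{z \<in> V'. ?f z \<in> T} \<subseteq> g -` U \<inter> topspace Y"
      proof
        fix z assume "z \<in> {z \<in> V'. ?f z \<in> T}"
        then have z: "z \<in> V'" "coords d (snd (g z)) \<in> T" using f by auto
        have "fst (fst (g z)) \<in> fst d" using V'D(2)[OF z(1)] by (simp add: fst_hat)
        with z V'D[OF z(1)] gB[of z] show "z \<in> g -` U \<inter> topspace Y"
          unfolding U by (simp add: case_prod_unfold)
      qed
      show "\<exists>V (f :: _ \<Rightarrow> 'n phase set) Z T. openin Y V \<and> y \<in> V \<and> continuous_map (subtopology Y V) Z f \<and> openin Z T \<and>
          f y \<in> T \<and> {x \<in> V. f x \<in> T} \<subseteq> g -` U \<inter> topspace Y"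
        by (intro exI conjI) (rule V', rule yV', rule cont, rule d(3), rule fy, rule sub)
    qed
  qed
qed

text \<open>In every canonical chart this section is constant, with value
  \<open>vertical_space\<close>.\<close>

lemma vertical_section_continuous: "continuous_map LT BT (vertical_section A)"
proof (rule continuous_map_into_BT)
  show "continuous_map LT LT (\<lambda>y. fst (vertical_section A y))" by (simp add: vertical_section_def)
  fix \<nu> assume "\<nu> \<in> topspace LT"
  then have \<nu>: "\<nu> \<in> L" by simp
  then obtain c where c: "c \<in> A" "\<nu> \<in> fst (hat c)" by (rule L_cover)
  show "snd (vertical_section A \<nu>) \<in> lagrangians_at A (fst (vertical_section A \<nu>))"
    using vertical_lagrangian[OF c] by (simp add: vertical_section_def)
  have "continuous_map (subtopology LT (L \<inter> fst (hat c))) Lag_topology (\<lambda>z. coords c (snd (vertical_section A z)))"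
  proof (rule continuous_map_eq)
    show "continuous_map (subtopology LT (L \<inter> fst (hat c))) Lag_topology (\<lambda>z. vertical_space :: 'n phase set)"
      by (simp add: vertical_space_Lag)
  qed (use coords_vertical[OF c(1)] in auto)
  moreover note openin_LT_hat[OF c(1)]
  ultimately show "\<exists>c\<in>A. \<exists>V. openin LT V \<and> \<nu> \<in> V \<and> (\<forall>z\<in>V. fst (vertical_section A z) \<in> fst (hat c)) \<and>
      continuous_map (subtopology LT V) Lag_topology (\<lambda>z. coords c (snd (vertical_section A z)))"
    using c \<nu> by (intro bexI[of _ c] exI[of _ "L \<inter> fst (hat c)"]) (auto simp: vertical_section_def)
qed


section \<open>Tangent spaces of \<open>L\<close> in charts adapted to \<open>L\<close>\<close>

lemma adapted_chart:
  assumes "\<nu> \<in> L"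
  obtains f K where "is_chart TX f" "\<And>d. d \<in> A \<Longrightarrow> smoothly_compatible f (hat d)" "\<nu> \<in> fst f" "subspace K"
    "dim K = CARD('n)" "snd f ` (L \<inter> fst f) = snd f ` fst f \<inter> K"
proof -
  have "\<exists>f K. is_chart TX f \<and> (\<forall>d\<in>hats. smoothly_compatible f d) \<and> \<nu> \<in> fst f \<and>
        subspace K \<and> dim K = CARD('n) \<and> snd f ` (L \<inter> fst f) = snd f ` fst f \<inter> K"
    using L assms unfolding lagrangian_submanifold_def embedded_submanifold_def by blast
  then show thesis using that hat_mem by blast
qed

context
  fixes f :: "(('a, 'n) cotangent_point, 'n phase) chart" and K :: "'n phase set"
  assumes f: "is_chart TX f" and fd: "\<And>d. d \<in> A \<Longrightarrow> smoothly_compatible f (hat d)"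
    and K: "subspace K" "dim K = CARD('n)" and fL: "snd f ` (L \<inter> fst f) = snd f ` fst f \<inter> K"
begin

lemma adapted_differentiable:
  assumes "c \<in> A" "\<nu> \<in> fst f" "\<nu> \<in> fst (hat c)"
  shows "transition f (hat c) differentiable (at (snd f \<nu>))" "transition (hat c) f differentiable (at (snd (hat c) \<nu>))"
  using smoothly_compatible_differentiable[OF fd[OF assms(1)] assms(2,3)] by auto

lemma adapted_inverse:
  assumes c: "c \<in> A" "\<nu> \<in> fst (hat c)" and \<nu>: "\<nu> \<in> fst f"
  shows "tderiv f (hat c) \<nu> (tderiv (hat c) f \<nu> v) = v" "tderiv (hat c) f \<nu> (tderiv f (hat c) \<nu> v) = v"
proof -
  note d = adapted_differentiable[OF c(1) \<nu> c(2)] and ch = is_chart_hat[OF c(1)]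
  have "tderiv f (hat c) \<nu> \<circ> tderiv (hat c) f \<nu> = id"
    using has_derivative_unique[OF transition_chain[OF ch f ch c(2) \<nu> c(2) d(2,1)] transition_self_has_derivative[OF ch c(2)]] .
  then show "tderiv f (hat c) \<nu> (tderiv (hat c) f \<nu> v) = v" by (simp add: fun_eq_iff)
  have "tderiv (hat c) f \<nu> \<circ> tderiv f (hat c) \<nu> = id"
    using has_derivative_unique[OF transition_chain[OF f ch f \<nu> c(2) \<nu> d] transition_self_has_derivative[OF f \<nu>]] .
  then show "tderiv (hat c) f \<nu> (tderiv f (hat c) \<nu> v) = v" by (simp add: fun_eq_iff)
qed

lemma adapted_chain:
  assumes c: "c \<in> A" "\<nu> \<in> fst (hat c)" and d: "d \<in> A" "\<nu> \<in> fst (hat d)" and \<nu>: "\<nu> \<in> fst f"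
  shows "tderiv (hat c) (hat d) \<nu> (tderiv f (hat c) \<nu> v) = tderiv f (hat d) \<nu> v"
proof -
  note t = transition_chain[OF f is_chart_hat[OF c(1)] is_chart_hat[OF d(1)] \<nu> c(2) d(2)
      adapted_differentiable(1)[OF c(1) \<nu> c(2)] tderiv_hat(1)[OF c d]]
  show ?thesis using frechet_derivative_at[OF t] by (metis comp_apply)
qed

lemma linear_adapted:
  assumes "c \<in> A" "\<nu> \<in> fst f" "\<nu> \<in> fst (hat c)" shows "linear (tderiv f (hat c) \<nu>)"
  by (rule linear_frechet_derivative[OF adapted_differentiable(1)[OF assms]])

text \<open>In the adapted chart a curve in \<open>L\<close> runs inside the linear subspace
  \<open>K\<close>, and so its velocity lies in \<open>K\<close>.\<close>

lemma coords_tangent_subset: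
  assumes c: "c \<in> A" "\<nu> \<in> fst (hat c)" and \<nu>: "\<nu> \<in> fst f" and v: "v \<in> submanifold_tangent hats L \<nu>"
  shows "v (hat c) \<in> tderiv f (hat c) \<nu> ` K"
proof -
  let ?c = "hat c"
  have "\<exists>g :: real \<Rightarrow> _. range g \<subseteq> L \<and> g 0 = \<nu> \<and>
        (\<forall>c\<in>hats. \<nu> \<in> fst c \<longrightarrow>
           (\<exists>e>0. g ` {-e<..<e} \<subseteq> fst c \<and> smooth_on {-e<..<e} (snd c \<circ> g)) \<and>
           ((snd c \<circ> g) has_vector_derivative v c) (at 0))"
    using v unfolding submanifold_tangent_def by blast
  then obtain g :: "real \<Rightarrow> _" where g: "range g \<subseteq> L" "g 0 = \<nu>" and G: "\<forall>c\<in>hats. \<nu> \<in> fst c \<longrightarrow>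
           (\<exists>e>0. g ` {-e<..<e} \<subseteq> fst c \<and> smooth_on {-e<..<e} (snd c \<circ> g)) \<and>
           ((snd c \<circ> g) has_vector_derivative v c) (at 0)"
    by (elim exE conjE)
  from bspec[OF G hat_mem[OF c(1)]] c(2)
  have der: "((snd ?c \<circ> g) has_vector_derivative v ?c) (at 0)" and "\<exists>e>0. g ` {-e<..<e} \<subseteq> fst ?c"
    by blast+
  then obtain e where e: "e > 0" "g ` {-e<..<e} \<subseteq> fst ?c" by blast
  let ?O = "snd ?c ` (fst ?c \<inter> fst f)"
  have O: "open ?O" by (rule chart_open_image2[OF is_chart_hat[OF c(1)] f])
  have "isCont (snd ?c \<circ> g) 0" using der has_vector_derivative_continuous by blast
  moreover have "(snd ?c \<circ> g) 0 \<in> ?O" using g(2) c(2) \<nu> by simp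
  ultimately have "\<forall>\<^sub>F t in at 0. (snd ?c \<circ> g) t \<in> ?O"
    using O topological_tendstoD unfolding isCont_def by blast
  then obtain e' where e': "e' > 0" "\<And>t. t \<noteq> 0 \<Longrightarrow> \<bar>t\<bar> < e' \<Longrightarrow> snd ?c (g t) \<in> ?O"
    unfolding eventually_at by (auto simp: dist_real_def)
  \<comment> \<open>\<open>e\<close> keeps the curve in the domain of \<open>hat c\<close>,
    \<open>e'\<close> in that of \<open>f\<close>. The second bound comes from continuity, as
    \<open>submanifold_tangent\<close> speaks only of charts of the atlas.\<close>
  define e0 where "e0 = min e e'"
  have gf: "g t \<in> fst f" "g t \<in> fst ?c" if t: "\<bar>t\<bar> < e0" for t
  proof -
    have "t \<in> {-e<..<e}" using t by (auto simp: e0_def)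
    then show gc: "g t \<in> fst ?c" using e(2) by blast
    have "snd ?c (g t) \<in> ?O" using e'(2)[of t] t g(2) c(2) \<nu> by (cases "t = 0") (auto simp: e0_def)
    then show "g t \<in> fst f" using chart_inj[OF is_chart_hat[OF c(1)]] gc by (auto simp: inj_on_def)
  qed
  have k: "((snd f \<circ> g) has_vector_derivative tderiv ?c f \<nu> (v ?c)) (at 0)"
  proof -
    have "((transition ?c f \<circ> (snd ?c \<circ> g)) has_vector_derivative tderiv ?c f \<nu> (v ?c)) (at 0)"
      by (rule vector_derivative_diff_chain_within[OF der])
         (use transition_has_derivative[OF adapted_differentiable(2)[OF c(1) \<nu> c(2)]] g(2) in \<open>auto intro: has_derivative_at_withinI\<close>)
    then show ?thesis
    proof (rule has_vector_derivative_transform_within_open[of _ _ _ "{-e0<..<e0}"])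
      show "(0::real) \<in> {-e0<..<e0}" using e e' by (simp add: e0_def)
      fix t assume "t \<in> {-e0<..<e0}"
      then show "(transition ?c f \<circ> (snd ?c \<circ> g)) t = (snd f \<circ> g) t"
        using gf[of t] transition_apply[OF is_chart_hat[OF c(1)]] by (simp add: abs_less_iff)
    qed auto
  qed
  have "tderiv ?c f \<nu> (v ?c) \<in> K"
  proof (rule vector_derivative_in_subspace[OF K(1) k])
    show "0 < e0" using e e' by (simp add: e0_def)
    fix t assume "\<bar>t\<bar> < e0"
    then have "g t \<in> L \<inter> fst f" using gf g(1) by blast
    then show "(snd f \<circ> g) t \<in> K" using fL by auto
  qed
  then show ?thesis using adapted_inverse(1)[OF c \<nu>, of "v ?c"] by (metis imageI)
qed

text \<open>The required curve is the straight segment in the direction \<open>k\<close> in the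
  adapted chart, where \<open>L\<close> is a piece of \<open>K\<close>.\<close>

lemma coords_tangent_superset:
  assumes c: "c \<in> A" "\<nu> \<in> fst (hat c)" and \<nu>: "\<nu> \<in> fst f" "\<nu> \<in> L" and k: "k \<in> K"
  shows "coordinate_tangent hats \<nu> (hat c) (tderiv f (hat c) \<nu> k) \<in> submanifold_tangent hats L \<nu>"
proof -
  let ?v = "coordinate_tangent hats \<nu> (hat c) (tderiv f (hat c) \<nu> k)" and ?i = "inv_into (fst f) (snd f)"
  have line: "\<exists>e>0. \<forall>t. \<bar>t\<bar> < e \<longrightarrow> snd f \<nu> + t *\<^sub>R k \<in> U" if U: "open U" "snd f \<nu> \<in> U" for U
  proof -
    have "isCont (\<lambda>t. snd f \<nu> + t *\<^sub>R k) 0" by (intro continuous_intros)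
    then have "((\<lambda>t. snd f \<nu> + t *\<^sub>R k) \<longlongrightarrow> snd f \<nu>) (at 0)" by (simp add: isCont_def)
    from topological_tendstoD[OF this U] obtain e where "e > 0" "\<And>t. t \<noteq> 0 \<Longrightarrow> \<bar>t\<bar> < e \<Longrightarrow> snd f \<nu> + t *\<^sub>R k \<in> U"
      unfolding eventually_at by (auto simp: dist_real_def)
    then show ?thesis using U(2) by (intro exI[of _ e]) (metis add_0_right scaleR_zero_left)
  qed
  have "open (snd f ` fst f)" using f by (simp add: is_chart_def)
  then obtain e0 where e0: "e0 > 0" "\<And>t. \<bar>t\<bar> < e0 \<Longrightarrow> snd f \<nu> + t *\<^sub>R k \<in> snd f ` fst f"
    using line \<nu>(1) by blast
  have f\<nu>: "snd f \<nu> \<in> K" using fL \<nu> by blast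
  \<comment> \<open>\<open>submanifold_tangent\<close> asks for a curve on the whole real line with
    range in \<open>L\<close>; beyond the interval on which the segment stays in the chart, the
    curve is parked at \<open>\<nu>\<close>.\<close>
  define g where "g = (\<lambda>t. if \<bar>t\<bar> < e0 then ?i (snd f \<nu> + t *\<^sub>R k) else \<nu>)"
  have gL: "g t \<in> L \<and> g t \<in> fst f" for t
  proof (cases "\<bar>t\<bar> < e0")
    case True
    have "snd f \<nu> + t *\<^sub>R k \<in> snd f ` (L \<inter> fst f)"
      unfolding fL using e0(2)[OF True] f\<nu> k K(1) by (auto intro: subspace_add subspace_scale)
    then show ?thesis using True f by (auto simp: g_def)
  next
    case False then show ?thesis using \<nu> by (simp add: g_def)
  qed
  have fg: "snd f (g t) = snd f \<nu> + t *\<^sub>R k" if "\<bar>t\<bar> < e0" for t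
    using that e0(2)[OF that] by (simp add: g_def f_inv_into_f)
  have g0: "g 0 = \<nu>" using e0(1) f \<nu> by (simp add: g_def)
  have vd: "?v (hat d) = tderiv f (hat d) \<nu> k" if "d \<in> A" "\<nu> \<in> fst (hat d)" for d
    using adapted_chain[OF c that \<nu>(1)] by (simp add: coordinate_tangent_apply[OF C1_hats hat_mem[OF that(1)] that(2)])
  have "(\<exists>e>0. g ` {-e<..<e} \<subseteq> fst h \<and> smooth_on {-e<..<e} (snd h \<circ> g)) \<and>
           ((snd h \<circ> g) has_vector_derivative ?v h) (at 0)" if h: "h \<in> hats" "\<nu> \<in> fst h" for h
  proof -
    obtain d where d: "d \<in> A" "h = hat d" using h(1) by (auto simp: cotangent_atlas_def)
    let ?O = "snd f ` (fst f \<inter> fst h)"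
    have "open ?O" unfolding d(2) by (rule chart_open_image2[OF f is_chart_hat[OF d(1)]])
    then obtain e1 where e1: "e1 > 0" "\<And>t. \<bar>t\<bar> < e1 \<Longrightarrow> snd f \<nu> + t *\<^sub>R k \<in> ?O" using line \<nu>(1) h(2) by blast
    define e where "e = min e0 e1"
    have e: "e > 0" using e0 e1 by (simp add: e_def)
    have gh: "g t \<in> fst h" if t: "t \<in> {-e<..<e}" for t
    proof -
      have t': "\<bar>t\<bar> < e0" "\<bar>t\<bar> < e1" using t by (auto simp: e_def)
      then have "snd f (g t) \<in> ?O" using fg e1(2) by simp
      then obtain x where x: "snd f (g t) = snd f x" "x \<in> fst f" "x \<in> fst h" by blast
      then have "g t = x" using inj_onD[OF chart_inj[OF f] x(1)] gL by blast
      then show ?thesis using x by simp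
    qed
    have eq: "transition f h (snd f \<nu> + t *\<^sub>R k) = (snd h \<circ> g) t" if t: "t \<in> {-e<..<e}" for t
    proof -
      have "\<bar>t\<bar> < e0" using t by (auto simp: e_def)
      then show ?thesis using transition_apply[OF f, of "g t" h] gL fg by simp
    qed
    have "smooth_on {-e<..<e} (\<lambda>t. transition f h (snd f \<nu> + t *\<^sub>R k))"
    proof (rule smooth_on_affine)
      show "smooth_on ?O (transition f h)" using fd[OF d(1)] by (simp add: d(2) smoothly_compatible_def)
    qed (use e1(2) in \<open>auto simp: e_def\<close>)
    then have sm: "smooth_on {-e<..<e} (snd h \<circ> g)" by (rule smooth_on_cong[rotated 2]) (use eq in auto)
    have "((\<lambda>t. transition f h (snd f \<nu> + t *\<^sub>R k)) has_derivative (\<lambda>t. tderiv f h \<nu> (t *\<^sub>R k))) (at 0)"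
      by (rule has_derivative_compose[where f = "\<lambda>t. snd f \<nu> + t *\<^sub>R k"])
         (use transition_has_derivative[OF adapted_differentiable(1)[OF d(1) \<nu>(1)]] h d in \<open>auto intro!: derivative_eq_intros\<close>)
    then have "((\<lambda>t. transition f h (snd f \<nu> + t *\<^sub>R k)) has_vector_derivative tderiv f h \<nu> k) (at 0)"
      using linear_cmul[OF linear_adapted[OF d(1) \<nu>(1)]] h d by (simp add: has_vector_derivative_def)
    then have "((snd h \<circ> g) has_vector_derivative tderiv f h \<nu> k) (at 0)"
      by (rule has_vector_derivative_transform_within_open[of _ _ _ "{-e<..<e}"]) (use eq e in auto)
    then show ?thesis using e gh sm vd d h by auto
  qed
  then have "range g \<subseteq> L \<and> g 0 = \<nu> \<and> (\<forall>c\<in>hats. \<nu> \<in> fst c \<longrightarrow>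
           (\<exists>e>0. g ` {-e<..<e} \<subseteq> fst c \<and> smooth_on {-e<..<e} (snd c \<circ> g)) \<and>
           ((snd c \<circ> g) has_vector_derivative ?v c) (at 0))"
    using gL g0 by blast
  then show ?thesis
    unfolding submanifold_tangent_def using coordinate_tangent_mem[OF C1_hats hat_mem[OF c(1)] c(2)] by blast
qed

lemma coords_tangent:
  assumes c: "c \<in> A" "\<nu> \<in> fst (hat c)" and \<nu>: "\<nu> \<in> fst f" "\<nu> \<in> L"
  shows "coords c (submanifold_tangent hats L \<nu>) = tderiv f (hat c) \<nu> ` K"
proof
  show "coords c (submanifold_tangent hats L \<nu>) \<subseteq> tderiv f (hat c) \<nu> ` K"
    using coords_tangent_subset[OF c \<nu>(1)] by (auto simp: coords_def)
  show "tderiv f (hat c) \<nu> ` K \<subseteq> coords c (submanifold_tangent hats L \<nu>)"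
  proof
    fix a assume "a \<in> tderiv f (hat c) \<nu> ` K"
    then obtain k where "k \<in> K" "a = tderiv f (hat c) \<nu> k" by blast
    then have m: "coordinate_tangent hats \<nu> (hat c) a \<in> submanifold_tangent hats L \<nu>"
      using coords_tangent_superset[OF c \<nu>] by simp
    have "coordinate_tangent hats \<nu> (hat c) a (hat c) = a"
      by (rule coordinate_tangent_self[OF C1_hats hat_mem[OF c(1)] c(2)])
    then show "a \<in> coords c (submanifold_tangent hats L \<nu>)" unfolding coords_def using m by (metis imageI)
  qed
qed

text \<open>The injective linear image of \<open>K\<close> has dimension \<open>n\<close>, and an
  isotropic subspace of that dimension is Lagrangian.\<close>

lemma coords_tangent_Lag:
  assumes c: "c \<in> A" "\<nu> \<in> fst (hat c)" and \<nu>: "\<nu> \<in> fst f" "\<nu> \<in> L"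
  shows "coords c (submanifold_tangent hats L \<nu>) \<in> Lag"
proof (rule isotropic_Lag)
  let ?N = "tderiv f (hat c) \<nu>"
  have lin: "linear ?N" by (rule linear_adapted[OF c(1) \<nu>(1) c(2)])
  have inj: "inj ?N" using adapted_inverse(2)[OF c \<nu>(1)] by (metis injI)
  show "subspace (coords c (submanifold_tangent hats L \<nu>))"
    unfolding coords_tangent[OF c \<nu>] by (rule linear_subspace_image[OF lin K(1)])
  show "dim (coords c (submanifold_tangent hats L \<nu>)) = CARD('n)"
    unfolding coords_tangent[OF c \<nu>] K(2)[symmetric]
    by (rule dim_image_eq[OF lin inj_on_subset[OF inj subset_UNIV]])
  fix a b assume "a \<in> coords c (submanifold_tangent hats L \<nu>)" "b \<in> coords c (submanifold_tangent hats L \<nu>)"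
  then obtain v w where v: "v \<in> submanifold_tangent hats L \<nu>" "a = v (hat c)"
    and w: "w \<in> submanifold_tangent hats L \<nu>" "b = w (hat c)" by (auto simp: coords_def)
  have "v \<in> tangent_space hats \<nu>" "w \<in> tangent_space hats \<nu>"
    using v w by (auto simp: submanifold_tangent_def)
  from canonical_form_eq[OF c this] have "canonical_form A \<nu> v w = std_form a b" using v(2) w(2) by simp
  moreover have "canonical_form A \<nu> v w = 0"
    using L \<nu>(2) v(1) w(1) unfolding lagrangian_submanifold_def by blast
  ultimately show "std_form a b = 0" by simp
qed

lemma adapted_continuous:
  assumes c: "c \<in> A" and V: "V \<subseteq> fst f \<inter> fst (hat c)" 
  shows "continuous_map (subtopology LT V) euclidean (\<lambda>\<nu>. tderiv f (hat c) \<nu> v)"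
proof (rule continuous_map_compose_on[where f = "snd f" and S = "snd f ` (fst f \<inter> fst (hat c))"
      and h = "\<lambda>x. frechet_derivative (transition f (hat c)) (at x) v"])
  have "continuous_map (subtopology TX (fst f)) euclidean (snd f)" by (rule chart_continuous[OF f])
  from continuous_map_from_subtopology_mono[OF this, of "L \<inter> V"]
  show "continuous_map (subtopology LT V) euclidean (snd f)" using V by (auto simp: subtopology_subtopology)
  show "continuous_on (snd f ` (fst f \<inter> fst (hat c))) (\<lambda>x. frechet_derivative (transition f (hat c)) (at x) v)"
    using fd[OF c] smooth_onD(2) unfolding smoothly_compatible_def by blast
qed (use V in auto)

text \<open>A fixed orthonormal basis of \<open>K\<close>, moved by the derivative of the transition
  from the adapted chart, is a continuous frame; \<open>lag_matrix\<close> is the quotient of its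
  frame matrix by the conjugate.\<close>

lemma coords_tangent_continuous:
  assumes c: "c \<in> A" and V: "V \<subseteq> fst f \<inter> fst (hat c)"
  shows "continuous_map (subtopology LT V) Lag_topology (\<lambda>\<nu>. coords c (submanifold_tangent hats L \<nu>))"
proof (rule continuous_map_into_Lag_topology)
  let ?Y = "subtopology LT V" and ?W = "\<lambda>\<nu>. coords c (submanifold_tangent hats L \<nu>)"
  have top: "\<nu> \<in> fst f" "\<nu> \<in> fst (hat c)" "\<nu> \<in> L" if "\<nu> \<in> topspace ?Y" for \<nu>
    using that V by auto
  show Lag: "?W \<nu> \<in> Lag" if "\<nu> \<in> topspace ?Y" for \<nu>
    using coords_tangent_Lag[OF c] top[OF that] by blast
  obtain b :: "'n \<Rightarrow> 'n phase" where b: "\<And>j. b j \<in> K" "\<And>i j. b i \<bullet> b j = (if i = j then 1 else 0)"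
    using orthonormal_frame[OF K] by blast
  let ?F = "\<lambda>\<nu> j. tderiv f (hat c) \<nu> (b j)"
  have F: "?F \<nu> j \<in> ?W \<nu>" if "\<nu> \<in> topspace ?Y" for \<nu> j
    using coords_tangent[OF c top(2,1,3)[OF that]] b(1) by blast
  have nz: "det (frame_matrix (?F \<nu>)) \<noteq> 0" if \<nu>: "\<nu> \<in> topspace ?Y" for \<nu>
  proof (rule frame_det_nz[OF Lag[OF \<nu>] F[OF \<nu>]])
    fix x assume "(\<Sum>j\<in>UNIV. x $ j *\<^sub>R ?F \<nu> j) = 0"
    then have "tderiv f (hat c) \<nu> (\<Sum>j\<in>UNIV. x $ j *\<^sub>R b j) = 0"
      using linear_adapted[OF c top(1,2)[OF \<nu>]] by (simp add: linear_sum linear_cmul)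
    then have "(\<Sum>j\<in>UNIV. x $ j *\<^sub>R b j) = tderiv (hat c) f \<nu> 0"
      using adapted_inverse(2)[OF c top(2,1)[OF \<nu>], of "\<Sum>j\<in>UNIV. x $ j *\<^sub>R b j"] by simp
    also have "\<dots> = 0" by (rule linear_0[OF linear_frechet_derivative[OF adapted_differentiable(2)[OF c top(1,2)[OF \<nu>]]]])
    finally have "b i \<bullet> (\<Sum>j\<in>UNIV. x $ j *\<^sub>R b j) = 0" for i by simp
    then have "x $ i = 0" for i
      by (simp add: inner_sum_right b(2) if_distrib cong: if_cong)
    then show "x = 0" by (simp add: vec_eq_iff)
  qed
  show "continuous_map ?Y euclidean (\<lambda>\<nu>. lag_matrix (?W \<nu>))"
    unfolding continuous_map_tendsto
  proof
    fix \<nu> assume \<nu>: "\<nu> \<in> topspace ?Y"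
    have Ft: "((\<lambda>x. ?F x j) \<longlongrightarrow> ?F \<nu> j) (atin ?Y \<nu>)" for j
      using adapted_continuous[OF c V] \<nu> unfolding continuous_map_tendsto by blast
    have t: "((\<lambda>\<nu>. frame_matrix (?F \<nu>)) \<longlongrightarrow> frame_matrix (?F \<nu>)) (atin ?Y \<nu>)"
      unfolding frame_matrix_def complex_of_phase_def complex_eq by (intro tendsto_intros Ft)
    show "((\<lambda>\<nu>. lag_matrix (?W \<nu>)) \<longlongrightarrow> lag_matrix (?W \<nu>)) (atin ?Y \<nu>)"
    proof (rule tendsto_matrix_quotient)
      show "\<forall>\<^sub>F x in atin ?Y \<nu>. lag_matrix (?W x) ** map_matrix cnj (frame_matrix (?F x)) = frame_matrix (?F x) \<and>
         det (map_matrix cnj (frame_matrix (?F x))) \<noteq> 0"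
        by (rule eventually_mono[OF eventually_atin_topspace])
           (intro conjI lag_matrix_frame[OF Lag F], assumption+, simp only: det_map_matrix_cnj complex_cnj_zero_iff nz not_False_eq_True)
      show "lag_matrix (?W \<nu>) ** map_matrix cnj (frame_matrix (?F \<nu>)) = frame_matrix (?F \<nu>)"
        by (rule lag_matrix_frame[OF Lag[OF \<nu>] F[OF \<nu>]])
      show "det (map_matrix cnj (frame_matrix (?F \<nu>))) \<noteq> 0" by (simp add: det_map_matrix_cnj nz[OF \<nu>])
    qed (intro tendsto_intros t)+
  qed
qed

end

lemma tangent_lagrangian: assumes "\<nu> \<in> L" shows "submanifold_tangent hats L \<nu> \<in> lagrangians_at A \<nu>"
proof -
  obtain c where c: "c \<in> A" "\<nu> \<in> fst (hat c)" using L_cover assms by blast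
  obtain f K where f: "is_chart TX f" "\<And>d. d \<in> A \<Longrightarrow> smoothly_compatible f (hat d)" "\<nu> \<in> fst f" "subspace K"
    "dim K = CARD('n)" "snd f ` (L \<inter> fst f) = snd f ` fst f \<inter> K" using adapted_chart[OF assms] by blast
  have "submanifold_tangent hats L \<nu> \<subseteq> tangent_space hats \<nu>" by (auto simp: submanifold_tangent_def)
  then show ?thesis
    using lagrangians_at_iff[OF c] coords_tangent_Lag[OF f(1,2,4,5,6) c f(3) assms] by blast
qed

lemma tangent_section_continuous: "continuous_map LT BT (tangent_section A L)"
proof (rule continuous_map_into_BT)
  show "continuous_map LT LT (\<lambda>y. fst (tangent_section A L y))" by (simp add: tangent_section_def)
  fix \<nu> assume "\<nu> \<in> topspace LT"
  then have \<nu>: "\<nu> \<in> L" by simp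
  then obtain c where c: "c \<in> A" "\<nu> \<in> fst (hat c)" by (rule L_cover)
  show "snd (tangent_section A L \<nu>) \<in> lagrangians_at A (fst (tangent_section A L \<nu>))"
    using tangent_lagrangian[OF \<nu>] by (simp add: tangent_section_def)
  obtain f K where f: "is_chart TX f" "\<And>d. d \<in> A \<Longrightarrow> smoothly_compatible f (hat d)" "\<nu> \<in> fst f" "subspace K"
    "dim K = CARD('n)" "snd f ` (L \<inter> fst f) = snd f ` fst f \<inter> K" using adapted_chart[OF \<nu>] by blast
  let ?V = "L \<inter> (fst f \<inter> fst (hat c))"
  have "openin LT ?V" using openin_Int[OF chart_open(1)[OF f(1)] openin_hat_domain[OF c(1)]] unfolding openin_subtopology by blast
  moreover have "continuous_map (subtopology LT ?V) Lag_topology (\<lambda>z. coords c (snd (tangent_section A L z)))"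
    unfolding tangent_section_def snd_conv by (rule coords_tangent_continuous[OF f(1,2,4,5,6) c(1) Int_lower2])
  ultimately show "\<exists>c\<in>A. \<exists>V. openin LT V \<and> \<nu> \<in> V \<and> (\<forall>z\<in>V. fst (tangent_section A L z) \<in> fst (hat c)) \<and>
      continuous_map (subtopology LT V) Lag_topology (\<lambda>z. coords c (snd (tangent_section A L z)))"
    using c \<nu> f(3) by (intro bexI[of _ c] exI[of _ ?V]) (auto simp: tangent_section_def)
qed

end

lemma continuous_map_local:
  fixes f :: "'a \<Rightarrow> 'b"
  assumes "\<And>y. y \<in> topspace Y \<Longrightarrow> \<exists>V. openin Y V \<and> y \<in> V \<and> continuous_map (subtopology Y V) Z f"
  shows "continuous_map Y Z f"
  unfolding continuous_map_def
proof (intro conjI allI impI Pi_I)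
  fix y assume y: "y \<in> topspace Y"
  obtain V where V: "openin Y V" "y \<in> V" "continuous_map (subtopology Y V) Z f" using assms[OF y] by blast
  then show "f y \<in> topspace Z" using y by (auto simp: continuous_map_def)
next
  fix U assume U: "openin Z U"
  show "openin Y {x \<in> topspace Y. f x \<in> U}"
  proof (rule continuous_map_openin_locally)
    fix y assume y: "y \<in> {x \<in> topspace Y. f x \<in> U}"
    then obtain V where V: "openin Y V" "y \<in> V" "continuous_map (subtopology Y V) Z f" using assms[of y] by blast
    have sub: "{x \<in> V. f x \<in> U} \<subseteq> {x \<in> topspace Y. f x \<in> U}" using openin_subset[OF V(1)] by blast
    have fy: "f y \<in> U" using y by blast
    show "\<exists>V (f' :: _ \<Rightarrow> 'b) Z T. openin Y V \<and> y \<in> V \<and> continuous_map (subtopology Y V) Z f' \<and> openin Z T \<and> f' y \<in> T \<and>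
        {x \<in> V. f' x \<in> T} \<subseteq> {x \<in> topspace Y. f x \<in> U}"
      by (intro exI conjI) (rule V(1), rule V(2), rule V(3), rule U, rule fy, rule sub)
  qed
qed

section \<open>The phase function\<close>

lemma chart_bump_function:
  fixes c :: "('a, 'e::euclidean_space) chart"
  assumes c: "is_chart X c" "x \<in> fst c" and X: "Hausdorff_space X"
  obtains \<phi> K U where "continuous_map X euclideanreal \<phi>" "\<And>y. 0 \<le> \<phi> y" "\<And>y. \<phi> y \<le> 1" "closedin X K" "K \<subseteq> fst c"
    "\<And>y. \<phi> y \<noteq> 0 \<Longrightarrow> y \<in> K" "openin X U" "x \<in> U" "\<And>y. y \<in> U \<Longrightarrow> \<phi> y = 1"
proof -
  have O: "open (snd c ` fst c)" using c by (simp add: is_chart_def)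
  then obtain r where r: "r > 0" "cball (snd c x) r \<subseteq> snd c ` fst c" using c(2) open_contains_cball by blast
  let ?i = "inv_into (fst c) (snd c)"
  \<comment> \<open>Compact, hence closed because \<open>X\<close> is Hausdorff; this makes the
    extension of the bump by 0 continuous.\<close>
  define K where "K = ?i ` cball (snd c x) r"
  \<comment> \<open>Equal to 1 up to distance \<open>r / 2\<close>, to 0 from distance
    \<open>r\<close> on, and linear in between.\<close>
  define \<psi> where "\<psi> = (\<lambda>z. max 0 (min 1 (2 - 2 * dist (snd c x) z / r)))"
  define \<phi> where "\<phi> = (\<lambda>y. if y \<in> fst c then \<psi> (snd c y) else 0)"
  define U where "U = {y \<in> topspace (subtopology X (fst c)). snd c y \<in> ball (snd c x) (r / 2)}"
  have "homeomorphic_map (subtopology X (fst c)) (top_of_set (snd c ` fst c)) (snd c)" using c by (simp add: is_chart_def)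
  then obtain g where "homeomorphic_maps (subtopology X (fst c)) (top_of_set (snd c ` fst c)) (snd c) g"
    using homeomorphic_map_maps by blast
  then have g: "continuous_map (top_of_set (snd c ` fst c)) X g" "\<And>y. y \<in> fst c \<Longrightarrow> g (snd c y) = y"
    using chart_topspace[OF c(1)] by (auto simp: homeomorphic_maps_def continuous_map_in_subtopology)
  have "compactin (top_of_set (snd c ` fst c)) (cball (snd c x) r)"
    using r(2) by (simp add: compactin_subtopology)
  from image_compactin[OF this g(1)] have "compactin X (g ` cball (snd c x) r)" .
  moreover have "g ` cball (snd c x) r = K"
    unfolding K_def using r(2) c(1) g(2) by (intro image_cong) auto
  ultimately have K: "closedin X K" using compactin_imp_closedin[OF X] by simp
  have KU: "K \<subseteq> fst c" unfolding K_def using r(2) by (auto intro!: inv_into_into)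
  have \<psi>0: "\<psi> z = 0" if "r \<le> dist (snd c x) z" for z
    using that r(1) by (simp add: \<psi>_def field_simps max_def)
  have \<phi>K: "y \<in> K" if "\<phi> y \<noteq> 0" for y
  proof -
    have y: "y \<in> fst c" using that by (auto simp: \<phi>_def split: if_splits)
    then have "\<psi> (snd c y) \<noteq> 0" using that by (simp add: \<phi>_def)
    then have "\<not> r \<le> dist (snd c x) (snd c y)" using \<psi>0 by blast
    then have "snd c y \<in> cball (snd c x) r" by simp
    then show ?thesis unfolding K_def using chart_inv[OF c(1) y] by (metis imageI)
  qed
  have cont: "continuous_map X euclideanreal \<phi>"
  proof (rule continuous_map_local)
    fix y assume y: "y \<in> topspace X"
    show "\<exists>V. openin X V \<and> y \<in> V \<and> continuous_map (subtopology X V) euclideanreal \<phi>"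
    proof (cases "y \<in> fst c")
      case True
      have "continuous_map (subtopology X (fst c)) euclideanreal (\<lambda>y. \<psi> (snd c y))"
        by (rule continuous_map_compose_on[OF chart_continuous[OF c(1)], of UNIV])
           (use r(1) in \<open>auto simp: \<psi>_def intro!: continuous_intros\<close>)
      then have "continuous_map (subtopology X (fst c)) euclideanreal \<phi>"
        by (rule continuous_map_eq) (auto simp: \<phi>_def)
      then show ?thesis using True chart_open(1)[OF c(1)] by blast
    next
      case False
      have "continuous_map (subtopology X (topspace X - K)) euclideanreal (\<lambda>_. 0)" by simp
      then have "continuous_map (subtopology X (topspace X - K)) euclideanreal \<phi>"
        by (rule continuous_map_eq) (use \<phi>K in auto)
      then show ?thesis using False y KU K by (intro exI[of _ "topspace X - K"]) auto
    qed
  qed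
  have "openin (subtopology X (fst c)) U"
    unfolding U_def by (rule openin_continuous_map_preimage[OF chart_continuous[OF c(1)]]) simp
  then have U: "openin X U" using openin_trans_full chart_open(1)[OF c(1)] by blast
  show thesis
  proof
    show "0 \<le> \<phi> y" "\<phi> y \<le> 1" for y by (auto simp: \<phi>_def \<psi>_def)
    show "x \<in> U" using c r chart_topspace[OF c(1)] by (simp add: U_def)
    show "\<phi> y = 1" if "y \<in> U" for y
    proof -
      have "y \<in> fst c" "dist (snd c x) (snd c y) < r / 2" using that by (auto simp: U_def)
      then show ?thesis using r(1) by (simp add: \<phi>_def \<psi>_def field_simps)
    qed
  qed (use cont K KU \<phi>K U in auto)
qed

text \<open>By the Lindelof property countably many sets on which a bump equals 1 cover
  \<open>X\<close>. Along an enumeration, each function takes its share of what its predecessors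
  have left, so the partial sums telescope.\<close>

lemma partition_of_unity_charts:
  fixes A :: "('a, 'e::euclidean_space) chart set"
  assumes A: "\<And>c. c \<in> A \<Longrightarrow> is_chart X c" "topspace X \<subseteq> \<Union>(fst ` A)" and X: "Hausdorff_space X" "second_countable X"
    and ne: "topspace X \<noteq> {}"
  obtains \<psi> :: "nat \<Rightarrow> 'a \<Rightarrow> real" and ch K where "\<And>i. ch i \<in> A" "\<And>i. continuous_map X euclideanreal (\<psi> i)" "\<And>i y. 0 \<le> \<psi> i y"
    "\<And>i. closedin X (K i)" "\<And>i. K i \<subseteq> fst (ch i)" "\<And>i y. \<psi> i y \<noteq> 0 \<Longrightarrow> y \<in> K i"
    "\<And>x. x \<in> topspace X \<Longrightarrow> \<exists>U m. openin X U \<and> x \<in> U \<and> (\<forall>y\<in>U. (\<forall>i\<ge>m. \<psi> i y = 0) \<and> (\<Sum>i<m. \<psi> i y) = 1)"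
proof -
  define good where "good U c \<phi> K \<longleftrightarrow> openin X U \<and> c \<in> A \<and> continuous_map X euclideanreal \<phi> \<and> (\<forall>y. 0 \<le> \<phi> y \<and> \<phi> y \<le> 1) \<and>
     closedin X K \<and> K \<subseteq> fst c \<and> (\<forall>y. \<phi> y \<noteq> 0 \<longrightarrow> y \<in> K) \<and> (\<forall>y\<in>U. \<phi> y = 1)" for U c K and \<phi> :: "'a \<Rightarrow> real"
  define \<U> where "\<U> = {U. \<exists>c \<phi> K. good U c \<phi> K}"
  have "\<exists>U\<in>\<U>. x \<in> U" if x: "x \<in> topspace X" for x
  proof -
    obtain c where c: "c \<in> A" "x \<in> fst c" using A(2) x by auto
    obtain \<phi> K U where "continuous_map X euclideanreal \<phi>" "\<And>y. 0 \<le> \<phi> y" "\<And>y. \<phi> y \<le> 1" "closedin X K" "K \<subseteq> fst c"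
      "\<And>y. \<phi> y \<noteq> 0 \<Longrightarrow> y \<in> K" "openin X U" "x \<in> U" "\<And>y. y \<in> U \<Longrightarrow> \<phi> y = 1"
      using chart_bump_function[OF A(1)[OF c(1)] c(2) X(1)] by metis
    then have "good U c \<phi> K" using c(1) unfolding good_def by blast
    then show ?thesis using \<open>x \<in> U\<close> unfolding \<U>_def by blast
  qed
  moreover have op: "openin X U" if "U \<in> \<U>" for U using that unfolding \<U>_def good_def by blast
  ultimately have "\<Union>\<U> = topspace X" using openin_subset by blast
  then obtain \<V> where V: "countable \<V>" "\<V> \<subseteq> \<U>" "\<Union>\<V> = topspace X"
    using second_countable_imp_Lindelof_space[OF X(2)] op unfolding Lindelof_space_def by metis
  have Vne: "\<V> \<noteq> {}" using V(3) ne by blast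
  define U where "U = from_nat_into \<V>"
  have "U i \<in> \<U>" for i using from_nat_into[OF Vne] V(2) unfolding U_def by blast
  then have "\<forall>i. \<exists>c \<phi> K. good (U i) c \<phi> K" unfolding \<U>_def by blast
  then obtain ch \<phi> K where good: "\<And>i. good (U i) (ch i) (\<phi> i) (K i)" by metis
  \<comment> \<open>Since \<open>\<phi> k = 1\<close> on \<open>U k\<close>, all later \<open>\<psi> i\<close> vanish there: the family is locally finite.\<close>
  define \<psi> where "\<psi> i y = \<phi> i y * (\<Prod>j<i. 1 - \<phi> j y)" for i y
  have tele: "(\<Sum>i<m. \<psi> i y) = 1 - (\<Prod>j<m. 1 - \<phi> j y)" for m y
    by (induction m) (auto simp: \<psi>_def algebra_simps)
  show thesis
  proof
    show "ch i \<in> A" "closedin X (K i)" "K i \<subseteq> fst (ch i)" for i using good[of i] by (auto simp: good_def)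
    show "continuous_map X euclideanreal (\<psi> i)" for i
      unfolding \<psi>_def by (intro continuous_intros) (use good in \<open>auto simp: good_def\<close>)
    show "0 \<le> \<psi> i y" for i y
      unfolding \<psi>_def by (intro mult_nonneg_nonneg prod_nonneg) (use good in \<open>auto simp: good_def\<close>)
    show "y \<in> K i" if "\<psi> i y \<noteq> 0" for i y using that good[of i] by (auto simp: \<psi>_def good_def)
    fix x assume "x \<in> topspace X"
    then obtain V0 where "V0 \<in> \<V>" "x \<in> V0" using V(3) by blast
    then obtain k where k: "x \<in> U k" using from_nat_into_surj[OF V(1)] unfolding U_def by blast
    have zero: "(\<Prod>j<i. 1 - \<phi> j y) = 0" if "y \<in> U k" "k < i" for i y
      using that good[of k] by (intro prod_zero) (auto simp: good_def)
    show "\<exists>U m. openin X U \<and> x \<in> U \<and> (\<forall>y\<in>U. (\<forall>i\<ge>m. \<psi> i y = 0) \<and> (\<Sum>i<m. \<psi> i y) = 1)"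
    \<comment> \<open>The bound is \<open>Suc k\<close> and not \<open>k\<close>: the product in
      \<open>\<psi> k\<close> does not yet contain the vanishing factor
      \<open>1 - \<phi> k y\<close>.\<close>
    proof (intro exI[of _ "U k"] exI[of _ "Suc k"] conjI ballI allI impI k)
      show "openin X (U k)" using good[of k] by (simp add: good_def)
      fix y assume y: "y \<in> U k"
      show "\<psi> i y = 0" if "Suc k \<le> i" for i using zero[OF y, of i] that by (simp add: \<psi>_def)
      show "(\<Sum>i<Suc k. \<psi> i y) = 1" unfolding tele zero[OF y lessI] by simp
    qed
  qed
qed

lemma tendsto_pull_back:
  assumes "\<And>v. ((\<lambda>x. M x v) \<longlongrightarrow> M0 v) F" "(Y \<longlongrightarrow> Y0) F"
  shows "((\<lambda>x. pull_back (M x) (Y x)) \<longlongrightarrow> pull_back M0 Y0) F"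
  unfolding pull_back_def base_block_def shear_block_def matrix_def by (intro tendsto_intros assms)

lemma circle_degree_eq: "winding_number f 0 = of_int k \<Longrightarrow> circle_degree f = k"
  unfolding circle_degree_def by (rule the_equality) auto

section \<open>The glued compatible structure and its phase\<close>

locale maslov_setting = lag_setting X A L for X :: "'a topology" and A :: "('a, real ^ 'n::finite) chart set" and L +
  fixes \<psi> :: "nat \<Rightarrow> 'a \<Rightarrow> real" and ch :: "nat \<Rightarrow> ('a, real ^ 'n) chart" and K :: "nat \<Rightarrow> 'a set"
  assumes ch: "ch i \<in> A" and \<psi>_cont: "continuous_map X euclideanreal (\<psi> i)" and \<psi>_nonneg: "0 \<le> \<psi> i y"
    and K_closed: "closedin X (K i)" and K_sub: "K i \<subseteq> fst (ch i)" and \<psi>_K: "\<psi> i y \<noteq> 0 \<Longrightarrow> y \<in> K i"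
    and \<psi>_local: "x \<in> topspace X \<Longrightarrow> \<exists>U m. openin X U \<and> x \<in> U \<and> (\<forall>y\<in>U. (\<forall>i\<ge>m. \<psi> i y = 0) \<and> (\<Sum>i<m. \<psi> i y) = 1)"
begin

text \<open>The standard structure of the chart \<open>ch i\<close>, expressed in the coordinates of
  \<open>c\<close> and weighted. Points of the cotangent bundle outside the domain of
  \<open>ch i\<close> have weight 0.\<close>

definition term_mat where
  "term_mat c \<nu> i = \<psi> i (fst \<nu>) *\<^sub>R pull_back (tderiv (hat c) (hat (ch i)) \<nu>) (mat 1)"

definition ymat where "ymat c \<nu> = (\<Sum>i\<in>{i. \<psi> i (fst \<nu>) \<noteq> 0}. term_mat c \<nu> i)"

lemma ymat_eq:
  assumes "\<And>i. i \<ge> m \<Longrightarrow> \<psi> i (fst \<nu>) = 0" shows "ymat c \<nu> = (\<Sum>i<m. term_mat c \<nu> i)"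
  unfolding ymat_def
proof (rule sum.mono_neutral_left)
  show "{i. \<psi> i (fst \<nu>) \<noteq> 0} \<subseteq> {..<m}"
  proof
    fix i assume "i \<in> {i. \<psi> i (fst \<nu>) \<noteq> 0}"
    then have "\<not> m \<le> i" using assms[of i] by blast
    then show "i \<in> {..<m}" by simp
  qed
qed (auto simp: term_mat_def)

lemma fst_TX: "\<nu> \<in> topspace TX \<Longrightarrow> fst \<nu> \<in> topspace X"
  using fst_continuous by (auto simp: continuous_map_def)

lemma partition_finite:
  assumes "\<nu> \<in> topspace TX"
  obtains m where "\<And>i. i \<ge> m \<Longrightarrow> \<psi> i (fst \<nu>) = 0" "(\<Sum>i<m. \<psi> i (fst \<nu>)) = 1"
  using \<psi>_local[OF fst_TX[OF assms]] by blast

lemma hat_ch: "\<nu> \<in> topspace TX \<Longrightarrow> \<psi> i (fst \<nu>) \<noteq> 0 \<Longrightarrow> \<nu> \<in> fst (hat (ch i))"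
  using \<psi>_K K_sub by (auto simp: fst_hat topspace_TX)

lemma hat_topspace: "c \<in> A \<Longrightarrow> \<nu> \<in> fst (hat c) \<Longrightarrow> \<nu> \<in> topspace TX"
  using openin_subset[OF openin_hat_domain] by blast

lemma accretive_ymat:
  assumes c: "c \<in> A" "\<nu> \<in> fst (hat c)" shows "accretive (ymat c \<nu>)"
proof -
  obtain m where m: "\<And>i. i \<ge> m \<Longrightarrow> \<psi> i (fst \<nu>) = 0" "(\<Sum>i<m. \<psi> i (fst \<nu>)) = 1"
    using partition_finite[OF hat_topspace[OF c]] by blast
  have y: "ymat e \<nu> = (\<Sum>i<m. term_mat e \<nu> i)" for e by (rule ymat_eq) (rule m(1))
  show ?thesis unfolding y term_mat_def
  proof (rule accretive_sum)
    show "accretive (pull_back (tderiv (hat c) (hat (ch i)) \<nu>) (mat 1))" if "\<psi> i (fst \<nu>) \<noteq> 0" for i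
      by (rule accretive_pull_back[OF tderiv_hat_vertical_map[OF c ch hat_ch[OF hat_topspace[OF c] that]] accretive_mat_1])
    show "\<exists>i\<in>{..<m}. \<psi> i (fst \<nu>) \<noteq> 0" using m(2) by (metis sum.neutral zero_neq_one)
  qed (use \<psi>_nonneg in auto)
qed

text \<open>Because the weights sum to 1, the pull-back passes inside the sum; functoriality then
  merges the transitions from \<open>c\<close> to \<open>d\<close> and from \<open>d\<close> to
  \<open>ch i\<close>.\<close>

lemma ymat_transform:
  assumes c: "c \<in> A" "\<nu> \<in> fst (hat c)" and d: "d \<in> A" "\<nu> \<in> fst (hat d)"
  shows "ymat c \<nu> = pull_back (tderiv (hat c) (hat d) \<nu>) (ymat d \<nu>)"
proof -
  obtain m where m: "\<And>i. i \<ge> m \<Longrightarrow> \<psi> i (fst \<nu>) = 0" "(\<Sum>i<m. \<psi> i (fst \<nu>)) = 1"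
    using partition_finite[OF hat_topspace[OF c]] by blast
  have y: "ymat e \<nu> = (\<Sum>i<m. term_mat e \<nu> i)" for e by (rule ymat_eq) (rule m(1))
  let ?N = "tderiv (hat c) (hat d) \<nu>"
  have "pull_back ?N (ymat d \<nu>) = (\<Sum>i<m. \<psi> i (fst \<nu>) *\<^sub>R pull_back ?N (pull_back (tderiv (hat d) (hat (ch i)) \<nu>) (mat 1)))"
    unfolding y term_mat_def by (rule pull_back_sum) (use m in auto)
  also have "\<dots> = (\<Sum>i<m. term_mat c \<nu> i)"
  proof (rule sum.cong[OF refl])
    fix i
    show "\<psi> i (fst \<nu>) *\<^sub>R pull_back ?N (pull_back (tderiv (hat d) (hat (ch i)) \<nu>) (mat 1)) = term_mat c \<nu> i"
    proof (cases "\<psi> i (fst \<nu>) = 0")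
      case False
      note h = hat_ch[OF hat_topspace[OF c] False]
      have "tderiv (hat d) (hat (ch i)) \<nu> \<circ> ?N = tderiv (hat c) (hat (ch i)) \<nu>"
        using tderiv_chain[OF C1_hats hat_mem[OF c(1)] hat_mem[OF d(1)] hat_mem[OF ch] c(2) d(2) h] by (simp add: fun_eq_iff)
      with pull_back_comp[OF tderiv_hat_vertical_map[OF d ch h] tderiv_hat_vertical_map[OF c d]]
      show ?thesis by (simp add: term_mat_def)
    qed (simp add: term_mat_def)
  qed
  finally show ?thesis unfolding y ..
qed

lemma term_mat_continuous:
  assumes c: "c \<in> A" shows "continuous_map (subtopology TX (fst (hat c))) euclidean (\<lambda>\<nu>. term_mat c \<nu> i)"
proof (rule continuous_map_local)
  let ?Y = "subtopology TX (fst (hat c))"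
  fix \<nu> assume "\<nu> \<in> topspace ?Y"
  then have \<nu>: "\<nu> \<in> topspace TX" "\<nu> \<in> fst (hat c)" by auto
  show "\<exists>V. openin ?Y V \<and> \<nu> \<in> V \<and> continuous_map (subtopology ?Y V) euclidean (\<lambda>\<nu>. term_mat c \<nu> i)"
  proof (cases "\<nu> \<in> fst (hat (ch i))")
    case True
    let ?V = "fst (hat c) \<inter> fst (hat (ch i))"
    have "continuous_map (subtopology TX ?V) euclidean (\<lambda>\<nu>. term_mat c \<nu> i)"
      unfolding continuous_map_tendsto term_mat_def
    proof (intro ballI tendsto_intros tendsto_pull_back)
      fix \<mu> assume \<mu>: "\<mu> \<in> topspace (subtopology TX ?V)"
      have "continuous_map (subtopology TX ?V) euclidean (\<lambda>\<nu>. \<psi> i (fst \<nu>))"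
        using continuous_map_compose[OF continuous_map_from_subtopology[OF fst_continuous] \<psi>_cont] by (simp add: o_def)
      then show "((\<lambda>\<nu>. \<psi> i (fst \<nu>)) \<longlongrightarrow> \<psi> i (fst \<mu>)) (atin (subtopology TX ?V) \<mu>)"
        using \<mu> unfolding continuous_map_tendsto by blast
      show "((\<lambda>\<nu>. tderiv (hat c) (hat (ch i)) \<nu> v) \<longlongrightarrow> tderiv (hat c) (hat (ch i)) \<mu> v) (atin (subtopology TX ?V) \<mu>)" for v
        using tderiv_hat_continuous[OF c ch] \<mu> unfolding continuous_map_tendsto by blast
    qed
    moreover have "openin ?Y ?V" using openin_hat_domain[OF ch] unfolding openin_subtopology by blast
    ultimately show ?thesis using True \<nu> by (intro exI[of _ ?V]) (simp add: subtopology_subtopology)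
  next
    case False
    \<comment> \<open>Outside the domain of \<open>ch i\<close> the closed set \<open>K i\<close> is
      avoided on a whole neighbourhood, where the term is 0.\<close>
    let ?V = "fst (hat c) \<inter> {\<mu> \<in> topspace TX. fst \<mu> \<in> topspace X - K i}"
    have "openin TX {\<mu> \<in> topspace TX. fst \<mu> \<in> topspace X - K i}"
      using openin_continuous_map_preimage[OF fst_continuous openin_diff[OF openin_topspace K_closed]] .
    then have "openin ?Y ?V" unfolding openin_subtopology by blast
    moreover have "fst \<nu> \<notin> K i" using False \<nu> K_sub by (auto simp: fst_hat topspace_TX)
    moreover have "continuous_map (subtopology ?Y ?V) euclidean (\<lambda>\<nu>. term_mat c \<nu> i)"
      by (rule continuous_map_eq[where f = "\<lambda>_. 0"]) (use \<psi>_K in \<open>auto simp: term_mat_def\<close>)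
    ultimately show ?thesis using \<nu> fst_TX by (intro exI[of _ ?V]) auto
  qed
qed

lemma ymat_continuous:
  assumes c: "c \<in> A" shows "continuous_map (subtopology TX (fst (hat c))) euclidean (ymat c)"
proof (rule continuous_map_local)
  let ?Y = "subtopology TX (fst (hat c))"
  fix \<nu> assume "\<nu> \<in> topspace ?Y"
  then have \<nu>: "\<nu> \<in> topspace TX" "\<nu> \<in> fst (hat c)" by auto
  obtain U m where U: "openin X U" "fst \<nu> \<in> U" "\<forall>y\<in>U. (\<forall>i\<ge>m. \<psi> i y = 0) \<and> (\<Sum>i<m. \<psi> i y) = 1"
    using \<psi>_local[OF fst_TX[OF \<nu>(1)]] by blast
  let ?V = "fst (hat c) \<inter> {\<mu> \<in> topspace TX. fst \<mu> \<in> U}"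
  have "openin ?Y ?V"
    using openin_continuous_map_preimage[OF fst_continuous U(1)] unfolding openin_subtopology by blast
  moreover have "continuous_map (subtopology ?Y ?V) euclidean (ymat c)"
  proof (rule continuous_map_eq)
    show "continuous_map (subtopology ?Y ?V) euclidean (\<lambda>\<nu>. \<Sum>i<m. term_mat c \<nu> i)"
      using continuous_map_from_subtopology[OF term_mat_continuous[OF c]]
      by (intro continuous_map_sum) auto
    show "(\<Sum>i<m. term_mat c \<mu> i) = ymat c \<mu>" if "\<mu> \<in> topspace (subtopology ?Y ?V)" for \<mu>
      by (rule ymat_eq[symmetric]) (use that U(3) in auto)
  qed
  ultimately show "\<exists>V. openin ?Y V \<and> \<nu> \<in> V \<and> continuous_map (subtopology ?Y V) euclidean (ymat c)"
    using \<nu> U(2) by (intro exI[of _ ?V]) auto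
qed

text \<open>A change of the chart multiplies \<open>twisted_det2\<close> by a positive factor, which \<open>sgn\<close> removes.\<close>

definition phase_chart where
  "phase_chart c p = sgn (twisted_det2 (ymat c (fst p)) (lag_matrix (coords c (snd p))))"

definition phase_map where
  "phase_map p = phase_chart (SOME c. c \<in> A \<and> fst p \<in> fst (hat c)) p"

lemma phase_chart_eq:
  assumes p: "p \<in> topspace BT" and c: "c \<in> A" "fst p \<in> fst (hat c)" and d: "d \<in> A" "fst p \<in> fst (hat d)"
  shows "phase_chart c p = phase_chart d p"
proof -
  let ?M = "tderiv (hat c) (hat d) (fst p)"
  note W = BT_point(2)[OF p]
  obtain r where r: "0 < r" "twisted_det2 (ymat d (fst p)) (lag_matrix (?M ` coords c (snd p))) =
      of_real r * twisted_det2 (pull_back ?M (ymat d (fst p))) (lag_matrix (coords c (snd p)))"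
    using twisted_det2_pull_back[OF tderiv_hat_vertical_map[OF c d] coords_Lag[OF c W]] .
  show ?thesis
    unfolding phase_chart_def coords_transform[OF c d lagrangians_at_subset[OF W]] r(2) ymat_transform[OF c d]
    using r(1) by (simp add: sgn_mult sgn_of_real)
qed

lemma phase_map_eq:
  assumes p: "p \<in> topspace BT" and c: "c \<in> A" "fst p \<in> fst (hat c)" shows "phase_map p = phase_chart c p"
proof -
  have "(SOME c. c \<in> A \<and> fst p \<in> fst (hat c)) \<in> A \<and> fst p \<in> fst (hat (SOME c. c \<in> A \<and> fst p \<in> fst (hat c)))"
    by (rule someI[of _ c]) (use c in simp)
  then show ?thesis unfolding phase_map_def using phase_chart_eq[OF p _ _ c] by blast
qed

lemma phase_chart_nz:
  assumes p: "p \<in> topspace BT" and c: "c \<in> A" "fst p \<in> fst (hat c)"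
  shows "twisted_det2 (ymat c (fst p)) (lag_matrix (coords c (snd p))) \<noteq> 0"
  by (rule twisted_det2_nz[OF lag_matrix_unitary[OF coords_Lag[OF c BT_point(2)[OF p]]] accretive_ymat[OF c]])

lemma phase_map_nz: assumes p: "p \<in> topspace BT" shows "phase_map p \<noteq> 0"
proof -
  obtain c where c: "c \<in> A" "fst p \<in> fst (hat c)" using L_cover[OF BT_point(1)[OF p]] .
  show ?thesis unfolding phase_map_eq[OF p c] phase_chart_def using phase_chart_nz[OF p c] by (simp add: sgn_zero_iff)
qed

lemma phase_map_continuous: "continuous_map BT euclidean phase_map"
proof (rule continuous_map_local)
  fix p assume p: "p \<in> topspace BT"
  obtain c where c: "c \<in> A" "fst p \<in> fst (hat c)" using L_cover[OF BT_point(1)[OF p]] .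
  let ?V = "{p \<in> topspace BT. fst p \<in> fst (hat c)}"
  have V: "openin BT ?V" by (rule openin_BT_over[OF c(1)])
  have eqV: "subtopology BT {p. fst p \<in> fst (hat c)} = subtopology BT ?V"
    by (subst subtopology_restrict[symmetric]) (simp add: Collect_conj_eq)
  have "continuous_map (subtopology BT ?V) (subtopology TX (fst (hat c))) fst"
    using continuous_map_from_subtopology[OF BT_projection, of ?V] by (auto simp: continuous_map_in_subtopology)
  from continuous_map_compose[OF this ymat_continuous[OF c(1)]]
  have y: "continuous_map (subtopology BT ?V) euclidean (\<lambda>p. ymat c (fst p))" by (simp add: o_def)
  have w: "continuous_map (subtopology BT ?V) euclidean (\<lambda>p. lag_matrix (coords c (snd p)))"
    using continuous_map_compose[OF BT_coords[OF c(1), unfolded eqV] continuous_map_lag_matrix] by (simp add: o_def)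
  have "continuous_map (subtopology BT ?V) euclidean (phase_chart c)"
    unfolding continuous_map_tendsto
  proof
    fix q assume q: "q \<in> topspace (subtopology BT ?V)"
    then have q': "q \<in> topspace BT" "fst q \<in> fst (hat c)" by auto
    note lims = y[unfolded continuous_map_tendsto, THEN bspec, OF q] w[unfolded continuous_map_tendsto, THEN bspec, OF q]
    have det: "det (lag_matrix (coords c (snd q))) \<noteq> 0"
      by (rule unitary_det_nz[OF lag_matrix_unitary[OF coords_Lag[OF c(1) q'(2) BT_point(2)[OF q'(1)]]]])
    have nz: "norm (twisted_det2 (ymat c (fst q)) (lag_matrix (coords c (snd q)))) \<noteq> 0"
      using phase_chart_nz[OF q'(1) c(1) q'(2)] by simp
    show "(phase_chart c \<longlongrightarrow> phase_chart c q) (atin (subtopology BT ?V) q)"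
      unfolding phase_chart_def sgn_div_norm by (intro tendsto_intros lims det nz)
  qed
  then have "continuous_map (subtopology BT ?V) euclidean phase_map"
    by (rule continuous_map_eq) (use phase_map_eq[OF _ c(1)] in auto)
  then show "\<exists>V. openin BT V \<and> p \<in> V \<and> continuous_map (subtopology BT V) euclidean phase_map"
    using V p c by blast
qed

section \<open>Comparison with \<mu>0 on one fibre\<close>

lemma symplectic_iso_exists:
  assumes c: "c \<in> A" "\<nu> \<in> fst (hat c)" shows "symplectic_iso_at A \<nu> (\<lambda>v. v (hat c))"
  unfolding symplectic_iso_at_def Let_def
proof (intro conjI ballI allI)
  let ?k = "coordinate_tangent hats \<nu> (hat c)"
  have k: "?k a \<in> tangent_space hats \<nu>" "?k a (hat c) = a" for a
    using coordinate_tangent_mem[OF C1_hats hat_mem[OF c(1)] c(2)] coordinate_tangent_self[OF C1_hats hat_mem[OF c(1)] c(2)] by auto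
  show "bij_betw (\<lambda>v. v (hat c)) (tangent_space hats \<nu>) UNIV"
    by (rule bij_betw_byWitness[where f' = ?k])
       (use k tangent_eq_coordinate_tangent[OF C1_hats _ hat_mem[OF c(1)] c(2)] in auto)
qed (use canonical_form_eq[OF c] in auto)

text \<open>\<open>mu0\<close> uses an arbitrary symplectic identification \<open>T\<close>.
  Composed with the coordinates of one canonical chart, it becomes a symplectic map of the standard
  space, and the comparison of winding numbers for such maps applies.\<close>

lemma mu0_eq_phase_degree:
  assumes \<alpha>: "pathin (lag_fibre_topology A L \<nu>) \<alpha>" "\<alpha> 0 = \<alpha> 1" and \<nu>: "\<nu> \<in> L"
  shows "mu0 A \<nu> \<alpha> = circle_degree (phase_map \<circ> \<alpha>)"
proof -
  obtain c where c: "c \<in> A" "\<nu> \<in> fst (hat c)" using L_cover[OF \<nu>] .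
  define T where "T = (SOME T. symplectic_iso_at A \<nu> T)"
  have "symplectic_iso_at A \<nu> T" unfolding T_def by (rule someI[of _ "\<lambda>v. v (hat c)"]) (rule symplectic_iso_exists[OF c])
  then have T: "\<And>v w. v \<in> tangent_space hats \<nu> \<Longrightarrow> w \<in> tangent_space hats \<nu> \<Longrightarrow> T (\<lambda>c. v c + w c) = T v + T w"
    "\<And>v r. v \<in> tangent_space hats \<nu> \<Longrightarrow> T (\<lambda>c. r *\<^sub>R v c) = r *\<^sub>R T v"
    "\<And>v w. v \<in> tangent_space hats \<nu> \<Longrightarrow> w \<in> tangent_space hats \<nu> \<Longrightarrow> std_form (T v) (T w) = canonical_form A \<nu> v w"
    unfolding symplectic_iso_at_def Let_def by blast+
  let ?k = "coordinate_tangent hats \<nu> (hat c)"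
  note ck = hat_mem[OF c(1)] c(2)
  have k: "?k a \<in> tangent_space hats \<nu>" "?k a (hat c) = a" for a
    using coordinate_tangent_mem[OF C1_hats ck] coordinate_tangent_self[OF C1_hats ck] by auto
  define M where "M = T \<circ> ?k"
  have M: "symplectic_map M"
    unfolding symplectic_map_def
  proof (intro conjI allI)
    show "linear M"
      by (rule linearI) (simp_all add: M_def coordinate_tangent_add[OF C1_hats ck] coordinate_tangent_scaleR[OF C1_hats ck] T k)
    show "std_form (M v) (M w) = std_form v w" for v w
      by (simp add: M_def T k canonical_form_eq[OF c])
  qed
  have TM: "T ` W = M ` coords c W" if "W \<subseteq> tangent_space hats \<nu>" for W
  proof -
    have "T ` W = T ` lift c \<nu> (coords c W)" unfolding lift_coords[OF c that] ..
    also have "\<dots> = M ` coords c W" unfolding M_def lift_def by (rule image_comp)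
    finally show ?thesis .
  qed
  have aB: "\<alpha> t \<in> topspace BT" "fst (\<alpha> t) = \<nu>" if "t \<in> {0..1}" for t
    using \<alpha>(1) that by (auto simp: lag_fibre_topology_def pathin_def continuous_map_def)
  have a: "pathin Lag_topology (\<lambda>t. coords c (snd (\<alpha> t)))"
  proof -
    have "continuous_map (top_of_set {0..1}) (subtopology BT {p. fst p \<in> fst (hat c)}) \<alpha>"
      using \<alpha>(1) c(2) by (auto simp: lag_fibre_topology_def pathin_def continuous_map_in_subtopology)
    from continuous_map_compose[OF this BT_coords[OF c(1)]] show ?thesis by (simp add: pathin_def o_def)
  qed
  have "winding_number (Det2 \<circ> (\<lambda>t. T ` snd (\<alpha> t))) 0 = winding_number (Det2 \<circ> (\<lambda>t. M ` coords c (snd (\<alpha> t)))) 0"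
  proof (rule winding_number_cong)
    fix t :: real assume "0 \<le> t" "t \<le> 1"
    then have "T ` snd (\<alpha> t) = M ` coords c (snd (\<alpha> t))"
      using lagrangians_at_subset[OF BT_point(2)[OF aB(1)]] aB(2) by (intro TM) force
    then show "(Det2 \<circ> (\<lambda>t. T ` snd (\<alpha> t))) t = (Det2 \<circ> (\<lambda>t. M ` coords c (snd (\<alpha> t)))) t" by simp
  qed
  also have "\<dots> = winding_number (\<lambda>t. sgn (twisted_det2 (ymat c \<nu>) (lag_matrix (coords c (snd (\<alpha> t)))))) 0"
    by (rule winding_number_Det2_symplectic[OF M accretive_ymat[OF c] a]) (simp add: \<alpha>(2))
  also have "\<dots> = winding_number (phase_map \<circ> \<alpha>) 0"
  proof (rule winding_number_cong)
    fix t :: real assume "0 \<le> t" "t \<le> 1"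
    then have t: "t \<in> {0..1}" by simp
    show "sgn (twisted_det2 (ymat c \<nu>) (lag_matrix (coords c (snd (\<alpha> t))))) = (phase_map \<circ> \<alpha>) t"
      using phase_map_eq[OF aB(1)[OF t] c(1)] c(2) by (simp add: aB(2)[OF t] phase_chart_def)
  qed
  finally show ?thesis
    unfolding mu0_def Let_def T_def[symmetric] mu0_std_def circle_degree_def by simp
qed


section \<open>Deformation of paths into the fibre\<close>

text \<open>The part of \<open>P\<close> over \<open>p ` {a..b}\<close> is moved to the fibre over \<open>p a\<close>, keeping its coordinates in the
  chart \<open>c\<close> constant.\<close>

lemma retract_step:
  assumes p: "pathin LT p" and c: "c \<in> A" "\<And>t. t \<in> {a..b} \<Longrightarrow> p t \<in> fst (hat c)" and ab: "0 \<le> a" "b \<le> 1"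
    and f: "continuous_on {0..1} f" "f ` {0..1} \<subseteq> {0..b}" "f 0 = 0" "f 1 = 0"
    and P: "pathin BT P" "\<And>t. t \<in> {0..1} \<Longrightarrow> fst (P t) = p (f t)"
  obtains P' where "P' \<in> path_class BT P" "\<And>t. t \<in> {0..1} \<Longrightarrow> fst (P' t) = p (min (f t) a)"
proof -
  \<comment> \<open>At \<open>s = 0\<close> this is \<open>f t\<close>, at \<open>s = 1\<close> it
    is \<open>min (f t) a\<close>; only values above \<open>a\<close> move.\<close>
  define g where "g x = f (snd x) - fst x * max 0 (f (snd x) - a)" for x :: "real \<times> real"
  define G where "G x = (p (g x), lift c (p (g x)) (coords c (snd (P (snd x)))))" for x
  \<comment> \<open>Where \<open>f\<close> is at most \<open>a\<close> the path is left alone, as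
    its base point may lie outside the domain of \<open>c\<close>. On the seam \<open>f = a\<close>
    both branches agree by \<open>GP\<close>.\<close>
  define H where "H x = (if f (snd x) \<le> a then P (snd x) else G x)" for x
  let ?S = "{0..1} \<times> {0..1} :: (real \<times> real) set"
  let ?Y = "top_of_set ?S"
  have f01: "0 \<le> f t" "f t \<le> b" if "t \<in> {0..1}" for t using f(2) that by (auto simp: image_subset_iff)
  have g_ab: "g x \<in> {a..b}" "g x \<in> {0..1}" if "x \<in> ?S" "a \<le> f (snd x)" for x
  proof -
    have x: "0 \<le> fst x" "fst x \<le> 1" "f (snd x) \<le> b" using that f01 by auto
    define d where "d = fst x * (f (snd x) - a)"
    have "fst x * (f (snd x) - a) \<le> 1 * (f (snd x) - a)" using x that by (intro mult_right_mono) auto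
    then have "d \<le> f (snd x) - a" by (simp add: d_def)
    moreover have "0 \<le> d" using x that by (simp add: d_def)
    moreover have "g x = f (snd x) - d" using that by (simp add: g_def d_def)
    ultimately have "a \<le> g x \<and> g x \<le> b" using x(3) by auto
    then show "g x \<in> {a..b}" by simp
    then show "g x \<in> {0..1}" using ab by auto
  qed
  have Pt: "P t \<in> topspace BT" if "t \<in> {0..1}" for t using P(1) that by (auto simp: pathin_def continuous_map_def)
  have P2: "continuous_map ?Y BT (\<lambda>x. P (snd x))"
  proof -
    have "continuous_map ?Y (top_of_set {0..1}) snd" by (auto intro!: continuous_intros)
    from continuous_map_compose[OF this P(1)[unfolded pathin_def]] show ?thesis by (simp add: o_def)
  qed
  have fs: "continuous_map ?Y euclideanreal (\<lambda>x. f (snd x))"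
    by (auto intro!: continuous_on_compose2[OF f(1)] continuous_intros)
  have GP: "G x = P (snd x)" if x: "x \<in> ?S" "a \<le> f (snd x)" "g x = f (snd x)" for x
  proof -
    have t: "snd x \<in> {0..1}" using x(1) by auto
    have "p (f (snd x)) \<in> fst (hat c)" using x(2) f01[OF t] by (intro c(2)) auto
    then have "lift c (fst (P (snd x))) (coords c (snd (P (snd x)))) = snd (P (snd x))"
      using lift_coords[OF c(1) _ lagrangians_at_subset[OF BT_point(2)[OF Pt[OF t]]]] P(2)[OF t] by simp
    then show ?thesis unfolding G_def x(3) using P(2)[OF t] by (simp add: prod_eq_iff)
  qed
  have H: "continuous_map ?Y BT H"
    unfolding H_def
  proof (rule continuous_map_cases_le[OF fs])
    show "continuous_map ?Y euclideanreal (\<lambda>_. a)" by simp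
    show "continuous_map (subtopology ?Y {x \<in> topspace ?Y. f (snd x) \<le> a}) BT (\<lambda>x. P (snd x))"
      by (rule continuous_map_from_subtopology[OF P2])
    show "P (snd x) = G x" if "x \<in> topspace ?Y" "f (snd x) = a" for x
      using GP[of x] that by (simp add: g_def)
    let ?Z = "subtopology ?Y {x \<in> topspace ?Y. a \<le> f (snd x)}"
    have Z: "x \<in> ?S" "a \<le> f (snd x)" if "x \<in> topspace ?Z" for x using that by auto
    show "continuous_map ?Z BT G"
    proof (rule continuous_map_into_BT)
      have "continuous_on ?S g" unfolding g_def
        by (intro continuous_intros continuous_on_compose2[OF f(1)]) auto
      then have "continuous_map ?Y euclideanreal g" by simp
      then have "continuous_map ?Z euclideanreal g" by (rule continuous_map_from_subtopology)
      then have "continuous_map ?Z (top_of_set {0..1}) g"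
        by (rule continuous_map_into_subtopology) (intro Pi_I g_ab(2) Z; assumption)
      from continuous_map_compose[OF this p[unfolded pathin_def]]
      show "continuous_map ?Z LT (\<lambda>x. fst (G x))" by (simp add: o_def G_def)
      have pg: "p (g x) \<in> fst (hat c)" "p (f (snd x)) \<in> fst (hat c)" if "x \<in> topspace ?Z" for x
        using g_ab(1)[OF Z[OF that]] Z[OF that] f01[of "snd x"] by (auto intro!: c(2))
      have W: "coords c (snd (P (snd x))) \<in> Lag" if "x \<in> topspace ?Z" for x
      proof -
        have t: "snd x \<in> {0..1}" using Z(1)[OF that] by auto
        show ?thesis by (rule coords_Lag[OF c(1) _ BT_point(2)[OF Pt[OF t]]]) (simp only: P(2)[OF t] pg(2)[OF that])
      qed
      show "snd (G x) \<in> lagrangians_at A (fst (G x))" if "x \<in> topspace ?Z" for x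
        unfolding G_def using lift_lagrangian[OF c(1) pg(1)[OF that] W[OF that]] by simp
      fix x assume x: "x \<in> topspace ?Z"
      have "continuous_map ?Z (subtopology BT {p. fst p \<in> fst (hat c)}) (\<lambda>x. P (snd x))"
      proof (intro continuous_map_into_subtopology continuous_map_from_subtopology[OF P2] Pi_I)
        fix y assume y: "y \<in> topspace ?Z"
        then have "snd y \<in> {0..1}" using Z(1)[OF y] by auto
        then show "P (snd y) \<in> {p. fst p \<in> fst (hat c)}" using pg(2)[OF y] P(2) by simp
      qed
      from continuous_map_compose[OF this BT_coords[OF c(1)]]
      have "continuous_map ?Z Lag_topology (\<lambda>x. coords c (snd (P (snd x))))" by (simp add: o_def)
      then have "continuous_map ?Z Lag_topology (\<lambda>x. coords c (snd (G x)))"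
        by (rule continuous_map_eq) (simp add: G_def coords_lift[OF c(1) pg(1)])
      then show "\<exists>c\<in>A. \<exists>V. openin ?Z V \<and> x \<in> V \<and> (\<forall>z\<in>V. fst (G z) \<in> fst (hat c)) \<and>
          continuous_map (subtopology ?Z V) Lag_topology (\<lambda>z. coords c (snd (G z)))"
      proof (intro bexI[OF _ c(1)] exI[of _ "topspace ?Z"] conjI openin_topspace x ballI)
        show "fst (G z) \<in> fst (hat c)" if "z \<in> topspace ?Z" for z using pg(1)[OF that] by (simp add: G_def)
      qed (simp only: subtopology_topspace)
    qed
  qed
  show thesis
  proof
    show "(\<lambda>t. H (1, t)) \<in> path_class BT P"
      unfolding mem_path_class_iff
    proof (intro exI[of _ H] conjI ballI H)
      show "H (0, t) = P t" if "t \<in> {0..1}" for t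
        using GP[of "(0, t)"] that by (auto simp: H_def g_def)
    \<comment> \<open>The endpoints stay fixed because \<open>f 0 = f 1 = 0\<close> and
      \<open>0 \<le> a\<close>.\<close>
    qed (use f ab in \<open>auto simp: H_def\<close>)
    show "fst (H (1, t)) = p (min (f t) a)" if "t \<in> {0..1}" for t
      using P(2)[OF that] by (auto simp: H_def G_def g_def min_def max_def)
  qed
qed

text \<open>A Lebesgue number for the cover of the unit interval by preimages of chart
  domains.\<close>

lemma chart_subdivision:
  assumes p: "pathin LT p"
  obtains N c where "0 < N" "\<And>k. k < N \<Longrightarrow> c k \<in> A"
    "\<And>k t. k < N \<Longrightarrow> t \<in> {real k / real N..real (Suc k) / real N} \<Longrightarrow> p t \<in> fst (hat (c k))"
proof -
  define \<C> where "\<C> = {U :: real set. open U \<and> (\<exists>c\<in>A. \<forall>t\<in>U \<inter> {0..1}. p t \<in> fst (hat c))}"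
  have cov: "\<exists>U\<in>\<C>. t \<in> U" if t: "t \<in> {0..1}" for t
  proof -
    have "p t \<in> L" using p t by (auto simp: pathin_def continuous_map_def)
    then obtain c where c: "c \<in> A" "p t \<in> fst (hat c)" by (rule L_cover)
    from openin_continuous_map_preimage[OF p[unfolded pathin_def] openin_LT_hat[OF c(1)]]
    have "openin (top_of_set {0..1}) {s \<in> topspace (top_of_set {0..1}). p s \<in> L \<inter> fst (hat c)}" .
    then obtain U where U: "open U" "{s \<in> topspace (top_of_set {0..1}). p s \<in> L \<inter> fst (hat c)} = {0..1} \<inter> U"
      unfolding openin_open by blast
    then have "U \<in> \<C>" using c(1) unfolding \<C>_def by auto
    moreover have "t \<in> U" using U(2) t c(2) \<open>p t \<in> L\<close> by auto
    ultimately show ?thesis by blast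
  qed
  have ne: "\<C> \<noteq> {}" using cov[of 0] by auto
  obtain \<delta> where \<delta>: "0 < \<delta>" "\<And>T. T \<subseteq> {0..1} \<Longrightarrow> diameter T < \<delta> \<Longrightarrow> \<exists>U\<in>\<C>. T \<subseteq> U"
  proof (rule Lebesgue_number_lemma[OF compact_Icc ne])
    show "{0..1} \<subseteq> \<Union>\<C>" using cov by blast
  qed (auto simp: \<C>_def)
  obtain n where n: "inverse (real (Suc n)) < \<delta>" using reals_Archimedean[OF \<delta>(1)] by blast
  let ?N = "Suc n"
  have "\<exists>c\<in>A. \<forall>t\<in>{real k / real ?N..real (Suc k) / real ?N}. p t \<in> fst (hat c)" if k: "k < ?N" for k
  proof -
    let ?T = "{real k / real ?N..real (Suc k) / real ?N}"
    have T: "?T \<subseteq> {0..1}" using k by (auto simp: field_simps)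
    have "diameter ?T = inverse (real ?N)" by (simp add: diameter_closed_interval field_simps)
    then obtain U where "U \<in> \<C>" "?T \<subseteq> U" using \<delta>(2)[OF T] n by auto
    then show ?thesis using T unfolding \<C>_def by blast
  qed
  then obtain c where "\<And>k. k < ?N \<Longrightarrow> c k \<in> A \<and> (\<forall>t\<in>{real k / real ?N..real (Suc k) / real ?N}. p t \<in> fst (hat (c k)))"
    by metis
  then show thesis using that[of ?N c] by blast
qed

text \<open>The projection of \<open>P\<close> is \<open>p\<close> with a parameter that starts and
  ends at 0, hence contractible along \<open>p\<close>. The induction runs over the subintervals
  that the parameter still reaches: \<open>retract_step\<close> lowers its bound from
  \<open>(k + 1) / N\<close> to \<open>k / N\<close>.\<close>

lemma retract_to_fibre:
  assumes p: "pathin LT p" and f: "continuous_on {0..1} f" "f ` {0..1} \<subseteq> {0..1}" "f 0 = 0" "f 1 = 0"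
    and P: "pathin BT P" "\<And>t. t \<in> {0..1} \<Longrightarrow> fst (P t) = p (f t)"
  obtains \<alpha> where "\<alpha> \<in> path_class BT P" "\<And>t. t \<in> {0..1} \<Longrightarrow> fst (\<alpha> t) = p 0"
proof -
  obtain N c where N: "0 < N" "\<And>k. k < N \<Longrightarrow> c k \<in> A"
    "\<And>k t. k < N \<Longrightarrow> t \<in> {real k / real N..real (Suc k) / real N} \<Longrightarrow> p t \<in> fst (hat (c k))"
    using chart_subdivision[OF p] by blast
  have "\<exists>\<alpha>. \<alpha> \<in> path_class BT P \<and> (\<forall>t\<in>{0..1}. fst (\<alpha> t) = p 0)"
    if "k \<le> N" "continuous_on {0..1} f" "f ` {0..1} \<subseteq> {0..real k / real N}" "f 0 = 0" "f 1 = 0"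
       "pathin BT P" "\<And>t. t \<in> {0..1} \<Longrightarrow> fst (P t) = p (f t)" for k f P
    using that
  proof (induction k arbitrary: f P)
    case 0
    then have "f t = 0" if "t \<in> {0..1}" for t using that by (auto simp: image_subset_iff)
    then show ?case using path_class_self[OF 0(6)] 0(7) by auto
  next
    case (Suc k)
    let ?a = "real k / real N" and ?b = "real (Suc k) / real N"
    have kN: "k < N" using Suc.prems(1) by simp
    have b1: "?b \<le> 1" using Suc.prems(1) N(1) by (simp add: field_simps)
    have a0: "0 \<le> ?a" by simp
    have "\<exists>P'. P' \<in> path_class BT P \<and> (\<forall>t\<in>{0..1}. fst (P' t) = p (min (f t) ?a))"
    proof (rule retract_step[where p = p and c = "c k" and a = ?a and b = ?b and f = f and P = P])
      fix P' assume "P' \<in> path_class BT P" "\<And>t. t \<in> {0..1} \<Longrightarrow> fst (P' t) = p (min (f t) ?a)"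
      then show ?thesis by blast
    qed (fact p N(2)[OF kN] N(3)[OF kN] a0 b1 Suc.prems)+
    then obtain P' where P': "P' \<in> path_class BT P" "\<And>t. t \<in> {0..1} \<Longrightarrow> fst (P' t) = p (min (f t) ?a)"
      by blast
    have "\<exists>\<alpha>. \<alpha> \<in> path_class BT P' \<and> (\<forall>t\<in>{0..1}. fst (\<alpha> t) = p 0)"
    proof (rule Suc.IH[of "\<lambda>t. min (f t) ?a"])
      show "continuous_on {0..1} (\<lambda>t. min (f t) ?a)" by (intro continuous_intros Suc.prems(2))
      show "(\<lambda>t. min (f t) ?a) ` {0..1} \<subseteq> {0..?a}" using Suc.prems(3) by (auto simp: image_subset_iff)
      show "pathin BT P'" using path_class_pathin[OF P'(1)] by simp
    qed (use kN Suc.prems P' in auto)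
    then show ?case using path_class_trans[OF P'(1)] by blast
  qed
  note main = this
  have "f ` {0..1} \<subseteq> {0..real N / real N}" using f(2) N(1) by simp
  have "\<exists>\<alpha>. \<alpha> \<in> path_class BT P \<and> (\<forall>t\<in>{0..1}. fst (\<alpha> t) = p 0)"
    by (rule main[OF order_refl f(1) \<open>f ` {0..1} \<subseteq> {0..real N / real N}\<close> f(3,4) P(1)]) (rule P(2))
  then obtain \<alpha> where \<alpha>: "\<alpha> \<in> path_class BT P" "\<forall>t\<in>{0..1}. fst (\<alpha> t) = p 0" by (elim exE conjE)
  show thesis by (rule that[OF \<alpha>(1) bspec[OF \<alpha>(2)]])
qed


section \<open>The Maslov class\<close>

text \<open>Taken for open paths too, where it need not be an integer: the loop defining the Maslov
  class is cut into pieces, and \<open>\<sigma>\<close> is one of them.\<close>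

definition phase_winding where "phase_winding q = winding_number (phase_map \<circ> q) 0"

lemma phase_path:
  assumes "pathin BT q" shows "path (phase_map \<circ> q)" "0 \<notin> path_image (phase_map \<circ> q)"
proof -
  show "path (phase_map \<circ> q)"
    using continuous_map_compose[OF assms[unfolded pathin_def] phase_map_continuous] by (simp add: path_def)
  show "0 \<notin> path_image (phase_map \<circ> q)"
  proof
    assume "0 \<in> path_image (phase_map \<circ> q)"
    then obtain t where "t \<in> {0..1}" "phase_map (q t) = 0" by (auto simp: path_image_def)
    moreover from this have "q t \<in> topspace BT" using assms by (auto simp: pathin_def continuous_map_def)
    ultimately show False using phase_map_nz by blast
  qed
qed

lemma phase_winding_path_class: assumes "q \<in> path_class BT p" shows "phase_winding q = phase_winding p"
proof -
  obtain h :: "real \<times> real \<Rightarrow> _" where h: "continuous_map (top_of_set ({0..1} \<times> {0..1})) BT h"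
    "\<forall>t\<in>{0..1}. h (0, t) = p t" "\<forall>t\<in>{0..1}. h (1, t) = q t" "\<forall>s\<in>{0..1}. h (s, 0) = p 0 \<and> h (s, 1) = p 1"
    using assms unfolding mem_path_class_iff by blast
  have hB: "h x \<in> topspace BT" if "x \<in> {0..1} \<times> {0..1}" for x using h(1) that by (auto simp: continuous_map_def)
  have "homotopic_paths (- {0}) (phase_map \<circ> p) (phase_map \<circ> q)"
    unfolding homotopic_paths
  proof (intro exI[of _ "phase_map \<circ> h"] conjI ballI)
    show "continuous_on ({0..1} \<times> {0..1}) (phase_map \<circ> h)"
      using continuous_map_compose[OF h(1) phase_map_continuous] by simp
    show "phase_map \<circ> h \<in> {0..1} \<times> {0..1} \<rightarrow> - {0}" using phase_map_nz[OF hB] by auto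
  qed (use h in \<open>auto simp: pathstart_def pathfinish_def\<close>)
  then show ?thesis unfolding phase_winding_def using winding_number_homotopic_paths by metis
qed

lemma phase_winding_join:
  assumes "pathin BT p" "pathin BT q" "p 1 = q 0" shows "phase_winding (join_path p q) = phase_winding p + phase_winding q"
proof -
  have "phase_map \<circ> join_path p q = (phase_map \<circ> p) +++ (phase_map \<circ> q)"
    by (auto simp: join_path_def joinpaths_def)
  then show ?thesis
    unfolding phase_winding_def using phase_path[OF assms(1)] phase_path[OF assms(2)] assms(3)
    by (simp add: winding_number_join pathstart_def pathfinish_def)
qed

lemma phase_winding_reverse: assumes "pathin BT p" shows "phase_winding (reverse_path p) = - phase_winding p"
proof -
  have "phase_map \<circ> reverse_path p = reversepath (phase_map \<circ> p)"
    by (auto simp: reverse_path_def reversepath_def)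
  then show ?thesis unfolding phase_winding_def using phase_path[OF assms] by (simp add: winding_number_reversepath)
qed

lemma circle_degree_phase_winding:
  assumes "pathin BT q" "q 0 = q 1" shows "of_int (circle_degree (phase_map \<circ> q)) = phase_winding q"
proof -
  have "phase_winding q \<in> \<int>" unfolding phase_winding_def
    by (rule integer_winding_number[OF phase_path(1)[OF assms(1)] _ phase_path(2)[OF assms(1)]])
       (simp add: pathstart_def pathfinish_def assms(2))
  then obtain k where "phase_winding q = of_int k" by (auto elim: Ints_cases)
  then show ?thesis using circle_degree_eq unfolding phase_winding_def by metis
qed

context
  fixes \<nu>\<^sub>0 \<sigma>
  assumes \<nu>0: "\<nu>\<^sub>0 \<in> L" and \<sigma>: "joining_path A L \<nu>\<^sub>0 \<sigma>"
begin

lemma \<sigma>_path: "pathin BT \<sigma>" "\<And>t. t \<in> {0..1} \<Longrightarrow> fst (\<sigma> t) = \<nu>\<^sub>0"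
  "\<sigma> 0 = tangent_section A L \<nu>\<^sub>0" "\<sigma> 1 = vertical_section A \<nu>\<^sub>0"
  using \<sigma> by (auto simp: joining_path_def lag_fibre_topology_def pathin_subtopology)

text \<open>\<open>inv_into\<close> picks some preimage \<open>C\<close> of the class of the loop
  \<open>Q\<close>. Every representative of \<open>C\<close> is homotopic to \<open>Q\<close> in the
  bundle, so its degree is the phase winding of \<open>Q\<close>; this splits over the four pieces
  of \<open>Q\<close>, and the contributions of \<open>\<sigma>\<close> and its reverse
  cancel.\<close>

lemma maslov_eq:
  assumes p: "pathin LT p" "p 0 = \<nu>\<^sub>0" "p 1 = \<nu>\<^sub>0"
  shows "of_int (maslov A L \<nu>\<^sub>0 \<sigma> (path_class LT p)) = phase_winding (tangent_section A L \<circ> p) - phase_winding (vertical_section A \<circ> p)"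
proof -
  let ?t = "tangent_section A L" and ?v = "vertical_section A"
  let ?a = "tangent_section A L \<nu>\<^sub>0"
  define F where "F q = join_path \<sigma> (join_path (?v \<circ> q) (reverse_path \<sigma>))" for q
  have rp: "pathin LT (reverse_path p)" by (rule pathin_reverse[OF p(1)])
  have tp: "pathin BT (?t \<circ> p)" and vp: "pathin BT (?v \<circ> q)" if "pathin LT q" for q
    using pathin_compose[OF p(1) tangent_section_continuous] pathin_compose[OF that vertical_section_continuous] by auto
  note tp = tp[OF p(1)]
  have Fp: "pathin BT (F q)" if "pathin LT q" "q 0 = \<nu>\<^sub>0" "q 1 = \<nu>\<^sub>0" for q
    unfolding F_def by (intro pathin_join pathin_reverse \<sigma>_path vp that) (simp_all add: \<sigma>_path that)
  have conj: "conjugated_vertical_map A L \<sigma> (path_class LT (reverse_path p)) = path_class BT (F (reverse_path p))"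
    unfolding conjugated_vertical_map_def F_def
  proof (rule class_map_path_class[OF rp])
    fix q assume q: "q \<in> path_class LT (reverse_path p)"
    have "join_path (?v \<circ> q) (reverse_path \<sigma>) \<in> path_class BT (join_path (?v \<circ> reverse_path p) (reverse_path \<sigma>))"
      by (rule path_class_join[OF path_class_map[OF q vertical_section_continuous]
            path_class_self[OF pathin_reverse[OF \<sigma>_path(1)]]]) (simp add: \<sigma>_path p)
    then show "join_path \<sigma> (join_path (?v \<circ> q) (reverse_path \<sigma>)) \<in>
        path_class BT (join_path \<sigma> (join_path (?v \<circ> reverse_path p) (reverse_path \<sigma>)))"
      by (rule path_class_join[OF path_class_self[OF \<sigma>_path(1)]]) (simp add: \<sigma>_path p)
  qed
  define Q where "Q = join_path (?t \<circ> p) (F (reverse_path p))"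
  have Q: "pathin BT Q" "Q 0 = ?a" "Q 1 = ?a"
    unfolding Q_def by (rule pathin_join[OF tp Fp[OF rp]]) (simp_all add: p F_def \<sigma>_path)
  have prod: "pi1_map BT ?t (path_class LT p) \<otimes>\<^bsub>pi1_lag_bundle A L \<nu>\<^sub>0\<^esub>
      conjugated_vertical_map A L \<sigma> (inv\<^bsub>pi1_submanifold A L \<nu>\<^sub>0\<^esub> (path_class LT p)) = path_class BT Q"
    unfolding fundamental_group_inv[OF p] conj pi1_map_path_class[OF p(1) tangent_section_continuous] Q_def
    by (rule fundamental_group_mult[OF tp Fp[OF rp]]) (simp_all add: p F_def \<sigma>_path)
  let ?one = "\<lambda>_. 1 :: real" and ?zero = "\<lambda>_. 0 :: real" and ?id = "\<lambda>t. t :: real" and ?rev = "\<lambda>t. 1 - t :: real"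
  \<comment> \<open>The parameter of the projection of \<open>Q\<close>: forward along
    \<open>p\<close>, at rest while \<open>\<sigma>\<close> is run, back along \<open>p\<close>, at
    rest again. Both rests lie over the base point, as \<open>p 0 = p 1\<close>.\<close>
  define f where "f = join_path ?id (join_path ?one (join_path ?rev ?zero))"
  have base: "fst (Q t) = p (f t)" if t: "t \<in> {0..1}" for t
  proof -
    have st: "fst (?t x) = x" "fst (?v x) = x" for x by (simp_all add: tangent_section_def vertical_section_def)
    consider "t \<le> 1/2" | "1/2 < t" "2 * t - 1 \<le> 1/2" | "1/2 < t" "1/2 < 2 * t - 1" "2 * (2 * t - 1) - 1 \<le> 1/2"
      | "1/2 < t" "1/2 < 2 * t - 1" "1/2 < 2 * (2 * t - 1) - 1" by linarith
    then show ?thesis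
    proof cases
      case 2
      then have "fst (\<sigma> (2 * (2 * t - 1))) = \<nu>\<^sub>0" by (intro \<sigma>_path) auto
      then show ?thesis using 2 by (simp add: Q_def F_def f_def join_path_def p)
    next
      case 4
      then have "fst (\<sigma> (1 - (2 * (2 * (2 * t - 1) - 1) - 1))) = \<nu>\<^sub>0" using t by (intro \<sigma>_path) auto
      then show ?thesis using 4 by (simp add: Q_def F_def f_def join_path_def reverse_path_def p)
    qed (auto simp: Q_def F_def f_def join_path_def reverse_path_def st)
  qed
  obtain \<alpha> where \<alpha>: "\<alpha> \<in> path_class BT Q" "\<And>t. t \<in> {0..1} \<Longrightarrow> fst (\<alpha> t) = p 0"
  proof (rule retract_to_fibre[OF p(1) _ _ _ _ Q(1) base])
    show "continuous_on {0..1} f"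
      unfolding f_def by (intro continuous_on_join_path continuous_intros) auto
    show "f ` {0..1} \<subseteq> {0..1}"
      unfolding f_def by (intro join_path_image) auto
  qed (auto simp: f_def)
  let ?FT = "lag_fibre_topology A L \<nu>\<^sub>0"
  have incl: "continuous_map ?FT BT id"
    unfolding lag_fibre_topology_def by (simp add: continuous_map_from_subtopology)
  have "pathin ?FT \<alpha>" "\<alpha> 0 = ?a" "\<alpha> 1 = ?a"
    using \<alpha>(2) path_class_pathin[OF \<alpha>(1)] path_class_endpoints[OF \<alpha>(1)] Q p(2)
    by (auto simp: lag_fibre_topology_def pathin_subtopology)
  then have "path_class ?FT \<alpha> \<in> carrier (pi1_lag_fibre A L \<nu>\<^sub>0)" "pi1_map BT id (path_class ?FT \<alpha>) = path_class BT Q"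
    using path_class_eqI[OF \<alpha>(1)] by (auto simp: carrier_fundamental_group pi1_map_path_class[OF _ incl])
  \<comment> \<open>\<open>inv_into\<close> yields a genuine preimage for classes in the image; the
    deformed loop \<open>\<alpha>\<close> shows that this class is one.\<close>
  then have img: "path_class BT Q \<in> pi1_map BT id ` carrier (pi1_lag_fibre A L \<nu>\<^sub>0)" by (metis imageI)
  define C where "C = inv_into (carrier (pi1_lag_fibre A L \<nu>\<^sub>0)) (pi1_map BT id) (path_class BT Q)"
  have C: "C \<in> carrier (pi1_lag_fibre A L \<nu>\<^sub>0)" "pi1_map BT id C = path_class BT Q"
    unfolding C_def by (rule inv_into_into[OF img], rule f_inv_into_f[OF img])
  then obtain \<beta> where \<beta>: "C = path_class ?FT \<beta>" "pathin ?FT \<beta>" "\<beta> 0 = ?a" "\<beta> 1 = ?a"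
    by (auto simp: carrier_fundamental_group)
  have \<beta>Q: "path_class BT \<beta> = path_class BT Q"
    using C(2) pi1_map_path_class[OF \<beta>(2) incl] by (simp add: \<beta>(1))
  have "of_int (mu0 A \<nu>\<^sub>0 \<beta>') = phase_winding Q" if "\<beta>' \<in> C" for \<beta>'
  proof -
    have b: "\<beta>' \<in> path_class ?FT \<beta>" using that \<beta>(1) by simp
    have b': "pathin ?FT \<beta>'" "\<beta>' 0 = \<beta>' 1"
      using path_class_pathin[OF b] path_class_endpoints[OF b] \<beta> by auto
    have "\<beta>' \<in> path_class BT Q" using path_class_map[OF b incl] \<beta>Q by simp
    then have "phase_winding \<beta>' = phase_winding Q" by (rule phase_winding_path_class)
    moreover have "pathin BT \<beta>'" using b'(1) by (simp add: lag_fibre_topology_def pathin_subtopology)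
    ultimately show ?thesis
      using circle_degree_phase_winding[OF _ b'(2)] by (simp add: mu0_eq_phase_degree[OF b' \<nu>0])
  qed
  moreover have "\<beta> \<in> C" using \<beta>(1) path_class_self[OF \<beta>(2)] by simp
  \<comment> \<open>All representatives have one value, so \<open>the_elem\<close> in
    \<open>mu0_class\<close> is applied to a singleton.\<close>
  ultimately have "mu0 A \<nu>\<^sub>0 ` C = {mu0 A \<nu>\<^sub>0 \<beta>}" "of_int (mu0 A \<nu>\<^sub>0 \<beta>) = phase_winding Q" by (auto, metis of_int_eq_iff)
  then have "of_int (maslov A L \<nu>\<^sub>0 \<sigma> (path_class LT p)) = phase_winding Q"
    unfolding maslov_def prod C_def[symmetric] mu0_class_def by simp
  also have "phase_winding Q = phase_winding (?t \<circ> p) + (phase_winding \<sigma> + (phase_winding (?v \<circ> reverse_path p) + phase_winding (reverse_path \<sigma>)))"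
  proof -
    have 1: "phase_winding (join_path (?v \<circ> reverse_path p) (reverse_path \<sigma>)) = phase_winding (?v \<circ> reverse_path p) + phase_winding (reverse_path \<sigma>)"
      by (intro phase_winding_join vp rp pathin_reverse \<sigma>_path) (simp add: p \<sigma>_path)
    have 2: "phase_winding (F (reverse_path p)) = phase_winding \<sigma> + phase_winding (join_path (?v \<circ> reverse_path p) (reverse_path \<sigma>))"
      unfolding F_def by (intro phase_winding_join pathin_join vp rp pathin_reverse \<sigma>_path) (simp_all add: p \<sigma>_path)
    have "phase_winding Q = phase_winding (?t \<circ> p) + phase_winding (F (reverse_path p))"
      unfolding Q_def by (intro phase_winding_join tp Fp rp) (simp_all add: p F_def \<sigma>_path)
    then show ?thesis by (simp only: 1 2)
  qed
  also have "\<dots> = phase_winding (?t \<circ> p) - phase_winding (?v \<circ> p)"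
    using phase_winding_reverse[OF \<sigma>_path(1)] phase_winding_reverse[OF vp[OF p(1)]] by (simp add: comp_reverse_path)
  finally show ?thesis .
qed

text \<open>Both winding terms of \<open>maslov_eq\<close> are additive under concatenation of
  loops.\<close>

lemma maslov_hom: "maslov A L \<nu>\<^sub>0 \<sigma> \<in> hom (pi1_submanifold A L \<nu>\<^sub>0) integer_group"
proof (rule homI)
  fix x y assume "x \<in> carrier (pi1_submanifold A L \<nu>\<^sub>0)" "y \<in> carrier (pi1_submanifold A L \<nu>\<^sub>0)"
  then obtain p q where p: "x = path_class LT p" "pathin LT p" "p 0 = \<nu>\<^sub>0" "p 1 = \<nu>\<^sub>0"
    and q: "y = path_class LT q" "pathin LT q" "q 0 = \<nu>\<^sub>0" "q 1 = \<nu>\<^sub>0" by (auto simp: carrier_fundamental_group)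
  have pq: "pathin LT (join_path p q)" by (rule pathin_join) (use p q in auto)
  have w: "phase_winding (s \<circ> join_path p q) = phase_winding (s \<circ> p) + phase_winding (s \<circ> q)" if s: "continuous_map LT BT s" for s
    unfolding comp_join_path by (rule phase_winding_join[OF pathin_compose[OF p(2) s] pathin_compose[OF q(2) s]]) (simp add: p q)
  have "complex_of_int (maslov A L \<nu>\<^sub>0 \<sigma> (x \<otimes>\<^bsub>pi1_submanifold A L \<nu>\<^sub>0\<^esub> y)) =
      of_int (maslov A L \<nu>\<^sub>0 \<sigma> x + maslov A L \<nu>\<^sub>0 \<sigma> y)"
    unfolding p(1) q(1) of_int_add maslov_eq[OF p(2-4)] maslov_eq[OF q(2-4)]
    using p q by (simp add: fundamental_group_mult maslov_eq[OF pq] w tangent_section_continuous vertical_section_continuous)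
  then show "maslov A L \<nu>\<^sub>0 \<sigma> (x \<otimes>\<^bsub>pi1_submanifold A L \<nu>\<^sub>0\<^esub> y) =
      maslov A L \<nu>\<^sub>0 \<sigma> x \<otimes>\<^bsub>integer_group\<^esub> maslov A L \<nu>\<^sub>0 \<sigma> y"
    unfolding of_int_eq_iff by simp
qed simp

end

lemma maslov_independent:
  assumes "\<nu>\<^sub>0 \<in> L" "joining_path A L \<nu>\<^sub>0 \<sigma>" "joining_path A L \<nu>\<^sub>0 \<tau>" "\<gamma> \<in> carrier (pi1_submanifold A L \<nu>\<^sub>0)"
  shows "maslov A L \<nu>\<^sub>0 \<sigma> \<gamma> = maslov A L \<nu>\<^sub>0 \<tau> \<gamma>"
proof -
  obtain p where p: "\<gamma> = path_class LT p" "pathin LT p" "p 0 = \<nu>\<^sub>0" "p 1 = \<nu>\<^sub>0"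
    using assms(4) by (auto simp: carrier_fundamental_group)
  show ?thesis unfolding p(1)
    using maslov_eq[OF assms(1,2) p(2-4)] maslov_eq[OF assms(1,3) p(2-4)] of_int_eq_iff by metis
qed

end

theorem proposition1p2:
  fixes X :: "'a topology"
    and A :: "('a, real ^ 'n::finite) chart set"
    and L :: "('a, 'n) cotangent_point set"
    and \<nu>\<^sub>0 :: "('a, 'n) cotangent_point"
  assumes "smooth_manifold X A"
    and "lagrangian_submanifold A L"
    and "connectedin (cotangent_topology A) L"
    and "\<nu>\<^sub>0 \<in> L"
  shows "(\<forall>\<sigma> \<tau>. joining_path A L \<nu>\<^sub>0 \<sigma> \<and> joining_path A L \<nu>\<^sub>0 \<tau> \<longrightarrow>
            (\<forall>\<gamma> \<in> carrier (pi1_submanifold A L \<nu>\<^sub>0). maslov A L \<nu>\<^sub>0 \<sigma> \<gamma> = maslov A L \<nu>\<^sub>0 \<tau> \<gamma>)) \<and>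
         (\<forall>\<sigma>. joining_path A L \<nu>\<^sub>0 \<sigma> \<longrightarrow>
            maslov A L \<nu>\<^sub>0 \<sigma> \<in> hom (pi1_submanifold A L \<nu>\<^sub>0) integer_group)"
proof -
  have X: "Hausdorff_space X" "second_countable X" "smooth_atlas X A"
    using assms(1) by (auto simp: smooth_manifold_def)
  interpret lag_setting X A L by unfold_locales (use X assms in auto)
  have "fst \<nu>\<^sub>0 \<in> topspace X"
    using fst_continuous L_subset assms(4) by (auto simp: continuous_map_def)
  then have ne: "topspace X \<noteq> {}" by blast
  have cover: "topspace X \<subseteq> \<Union>(fst ` A)" using X(3) by (simp add: smooth_atlas_def)
  \<comment> \<open>The phase function depends on a partition of unity on \<open>X\<close>, but the
    conclusion does not mention it, so any one may be fixed.\<close>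
  have "\<exists>\<psi> ch K. maslov_setting X A L \<psi> ch K"
  proof (rule partition_of_unity_charts[OF base_chart cover X(1,2) ne])
    fix \<psi> :: "nat \<Rightarrow> 'a \<Rightarrow> real" and ch K
    assume *: "\<And>i. ch i \<in> A" "\<And>i. continuous_map X euclideanreal (\<psi> i)"
      "\<And>i y. 0 \<le> \<psi> i y" "\<And>i. closedin X (K i)" "\<And>i. K i \<subseteq> fst (ch i)" "\<And>i y. \<psi> i y \<noteq> 0 \<Longrightarrow> y \<in> K i"
      "\<And>x. x \<in> topspace X \<Longrightarrow> \<exists>U m. openin X U \<and> x \<in> U \<and> (\<forall>y\<in>U. (\<forall>i\<ge>m. \<psi> i y = 0) \<and> (\<Sum>i<m. \<psi> i y) = 1)"
    have "maslov_setting X A L \<psi> ch K" by unfold_locales (fact *)+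
    then show ?thesis by blast
  qed
  then obtain \<psi> ch K where "maslov_setting X A L \<psi> ch K" by blast
  then interpret maslov_setting X A L \<psi> ch K .
  show ?thesis using maslov_independent[OF assms(4)] maslov_hom[OF assms(4)] by blast
qed

end
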